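(* Let $m,n$ be positive integers with $\gcd(m,n)=1$ and let $\mathbb{H}_{m/n}=\{(z_1,z_2)\in\mathbb{C}^2:|z_1|^{m/n}<|z_2|<1\}$. For $k\in\{1-2m-2n,\dots,-1,0\}$ put $p_k=\frac{2m+2n}{1-k}$, and put $p_1=\infty$. Let $1<p<2$ and let $p'$ be conjugate to $p$. Choose $k\in\{1-2m-2n,\dots,-1,0\}$ so that $p'<p_{k+1}$ (where $p_{k+1}=\frac{2m+2n}{-k}$), and fix $r\in[p_k,p_{k+1})$. Then $f\in A^p(\mathbb{H}_{m/n})$ can be approximated by functions in $A^r(\mathbb{H}_{m/n})$ in the $L^p$ norm if and only if $\widetilde{\mathbf{B}^r}f=f$.
   Context: $A^p(\Omega)$ is the Bergman space of holomorphic functions on $\Omega$ lying in $L^p(\Omega)$ (Lebesgue measure $dV$). For $r\ge2$ (which holds under the hypotheses) the $L^r$ sub-Bergman projection on $\mathbb{H}_{m/n}$ is the integral operator $\widetilde{\mathbf{B}^r}f(z)=\int_{\mathbb{H}_{m/n}}\widetilde{B^r}(z,w)f(w)\,dV(w)$ with kernel $\widetilde{B^r}(z,w)=\sum_{\alpha}\frac{z^\alpha\overline{w^\alpha}}{\|z^\alpha\|_{2}^2}$, the sum over all $\alpha\in\mathbb{Z}^2$ such that the monomial $z^\alpha$ belongs to $A^r(\mathbb{H}_{m/n})$; on $L^2$ it is the orthogonal projection onto the $L^2$-closure of $A^r(\mathbb{H}_{m/n})$. For $f\in L^p$ with $p<2$, $\widetilde{\mathbf{B}^r}f$ is defined by this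 integral. *)

theory Defs
  imports "HOL-Analysis.Analysis"
begin

definition holomorphic2_on :: "(complex \<times> complex \<Rightarrow> complex) \<Rightarrow> (complex \<times> complex) set \<Rightarrow> bool"
  where "holomorphic2_on f \<Omega> \<longleftrightarrow>
    (\<forall>z\<in>\<Omega>. \<exists>a b. (f has_derivative (\<lambda>h. a * fst h + b * snd h)) (at z))"

definition Lp_space :: "'a::euclidean_space set \<Rightarrow> real \<Rightarrow> ('a \<Rightarrow> complex) set"
  where "Lp_space \<Omega> p =
    {f. f \<in> borel_measurable (lebesgue_on \<Omega>) \<and>
        integrable (lebesgue_on \<Omega>) (\<lambda>z. norm (f z) powr p)}"

definition Lp_norm :: "'a::euclidean_space set \<Rightarrow> real \<Rightarrow> ('a \<Rightarrow> complex) \<Rightarrow> real"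
  where "Lp_norm \<Omega> p f = (LINT z|lebesgue_on \<Omega>. norm (f z) powr p) powr (1 / p)"

definition bergman :: "(complex \<times> complex) set \<Rightarrow> real \<Rightarrow> (complex \<times> complex \<Rightarrow> complex) set"
  where "bergman \<Omega> p = {f \<in> Lp_space \<Omega> p. holomorphic2_on f \<Omega>}"

(* Membership of the difference in L^p is required explicitly because Lp_norm is 0 on
   functions whose p-th power is not integrable. *)
definition Lp_approximable_by ::
    "'a::euclidean_space set \<Rightarrow> real \<Rightarrow> ('a \<Rightarrow> complex) \<Rightarrow> ('a \<Rightarrow> complex) set \<Rightarrow> bool"
  where "Lp_approximable_by \<Omega> p f G \<longleftrightarrow>
    (\<forall>\<epsilon>>0. \<exists>g\<in>G. (\<lambda>z. f z - g z) \<in> Lp_space \<Omega> p \<and> Lp_norm \<Omega> p (\<lambda>z. f z - g z) < \<epsilon>)"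

definition hartogs :: "nat \<Rightarrow> nat \<Rightarrow> (complex \<times> complex) set"
  where "hartogs m n =
    {(z1, z2). norm z1 powr (real m / real n) < norm z2 \<and> norm z2 < 1}"

(* 0 powi k = 0 for k < 0, so for a negative first exponent the function is total but
   discontinuous where z1 = 0; it is then not in the Bergman space of a domain that meets
   this axis, such as the generalized Hartogs triangle. *)
definition monomial2 :: "int \<times> int \<Rightarrow> complex \<times> complex \<Rightarrow> complex"
  where "monomial2 \<alpha> z = (fst z) powi (fst \<alpha>) * (snd z) powi (snd \<alpha>)"

definition sub_bergman_kernel ::
    "(complex \<times> complex) set \<Rightarrow> real \<Rightarrow> complex \<times> complex \<Rightarrow> complex \<times> complex \<Rightarrow> complex"
  where "sub_bergman_kernel \<Omega> r z w =
    (\<Sum>\<^sub>\<infinity>\<alpha> | monomial2 \<alpha> \<in> bergman \<Omega> r.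
       monomial2 \<alpha> z * cnj (monomial2 \<alpha> w) / of_real ((Lp_norm \<Omega> 2 (monomial2 \<alpha>))\<^sup>2))"

definition sub_bergman_projection ::
    "(complex \<times> complex) set \<Rightarrow> real \<Rightarrow> (complex \<times> complex \<Rightarrow> complex) \<Rightarrow> complex \<times> complex \<Rightarrow> complex"
  where "sub_bergman_projection \<Omega> r f z =
    (LINT w|lebesgue_on \<Omega>. sub_bergman_kernel \<Omega> r z w * f w)"

definition threshold_exponent :: "nat \<Rightarrow> nat \<Rightarrow> int \<Rightarrow> ereal"
  where "threshold_exponent m n k =
    (if k = 1 then \<infinity> else ereal ((2 * real m + 2 * real n) / (1 - real_of_int k)))"

end

theory Submission
  imports Defs "HOL-Complex_Analysis.Complex_Analysis"
begin

text \<open>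
  Put \<open>d = n \<alpha>\<^sub>1 + m \<alpha>\<^sub>2\<close>. The monomials in \<open>A\<^sup>r\<close> are those with \<open>\<alpha>\<^sub>1 \<ge> 0\<close> and \<open>d \<ge> k\<close>, and
  all of them are dominated on the domain by the weight \<open>W z = |z\<^sub>2| powr (k/m)\<close>, which lies in
  \<open>L\<^sup>s\<close> for every exponent \<open>s\<close> below the upper threshold, in particular for \<open>s = p'\<close>, \<open>2\<close> and \<open>r\<close>.
  Hence the projection of \<open>f\<close> at a point is the sum of \<open>z\<^sup>\<alpha> \<langle>f, w\<^sup>\<alpha>\<rangle> / \<parallel>w\<^sup>\<alpha>\<parallel>\<^sup>2\<close> over these
  \<open>\<alpha>\<close>, and both the projection and point evaluation are continuous in the norm of \<open>L\<^sup>1(W dV)\<close>,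
  which is weaker than that of \<open>L\<^sup>p\<close>.

  The map \<open>(z\<^sub>1, z\<^sub>2) \<mapsto> (t\<^sup>n\<^sup>+\<^sup>1 z\<^sub>1, t\<^sup>m z\<^sub>2)\<close> sends the domain into itself for \<open>0 < t < 1\<close>, and
  \<open>f\<^sub>t = t powr (-k) f(t\<^sup>n\<^sup>+\<^sup>1 z\<^sub>1, t\<^sup>m z\<^sub>2)\<close> tends to \<open>f\<close> in \<open>L\<^sup>p\<close> as \<open>t \<rightarrow> 1\<close>: it converges pointwise
  and the change of variables bounds its norm, so Scheffe's lemma applies. If \<open>f\<close> is a sum of
  monomials in \<open>A\<^sup>r\<close>, the coefficients of \<open>f\<^sub>t\<close> are absolutely summable, so \<open>f\<^sub>t\<close> is bounded by a
  multiple of \<open>W\<close>. If \<open>f\<close> is fixed by the projection, this puts \<open>f\<^sub>t\<close> in \<open>A\<^sup>r\<close>. Conversely, every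
  \<open>g\<close> in \<open>A\<^sup>r\<close> has such an expansion (a Taylor series in \<open>z\<^sub>1\<close> whose coefficients have poles of
  controlled order at \<open>z\<^sub>2 = 0\<close>), the projection fixes each \<open>g\<^sub>t\<close> by orthogonality, and continuity
  carries this over to \<open>g\<close> and then to every \<open>f\<close> approximable by such \<open>g\<close>.
\<close>

section \<open>Linear changes of variables\<close>

text \<open>Under a dilation with exponents \<open>(n, m)\<close> and ratio \<tau>, a monomial
  scales by \<open>\<tau>^d\<close> and volume by \<open>\<tau>^(2m + 2n)\<close>. A monomial in
  \<open>L^s\<close> therefore needs \<open>d s > -(2m + 2n)\<close>, and the \<open>p_k\<close> are
  the exponents at which an integer \<open>d\<close> drops out: \<open>r < p_(k+1)\<close> admits
  \<open>d = k\<close>, while \<open>r \<ge> p_k\<close> excludes \<open>d = k - 1\<close>.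

  The argument has no \<open>L^p\<close> bound for the projection at its disposal. It therefore
  works with the value at one point at a time, where duality between \<open>L^p\<close> and
  \<open>L^p'\<close> through the weight is enough.

  The dilation with exponents \<open>(n, m)\<close> alone would not make coefficients summable: all
  \<alpha> with the same \<open>d\<close> receive the same multiplier, and there are infinitely many
  of them with \<open>\<alpha>_1 \<ge> 0\<close>. The extra factor \<open>t\<close> on
  \<open>z_1\<close> turns the multiplier into \<open>t^(\<alpha>_1 + d - k)\<close>, whose exponent
  takes each value only finitely often. Summability then follows as soon as the coefficients grow
  more slowly than every geometric sequence in that exponent. Lower bounds for the norms of
  monomials give this for functions fixed by the projection, Cauchy estimates give it for functions
  in \<open>A^r\<close>.\<close>

lemma lborel_complex_eq_distr:
  "(lborel :: complex measure) = distr (lborel \<Otimes>\<^sub>M lborel) borel (\<lambda>(x, y). Complex x y)"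
proof (rule lborel_eqI)
  have [measurable]: "(\<lambda>(x, y). Complex x y) \<in> borel_measurable (borel \<Otimes>\<^sub>M borel)"
    unfolding borel_prod
    by (intro borel_measurable_continuous_onI) (auto simp: case_prod_unfold Complex_eq intro!: continuous_intros)
  fix l u :: complex
  assume lu: "\<And>b. b \<in> Basis \<Longrightarrow> l \<bullet> b \<le> u \<bullet> b"
  have le: "Re l \<le> Re u" "Im l \<le> Im u"
    using lu[of 1] lu[of \<i>] by (auto simp: Basis_complex_def)
  have "(\<lambda>(x, y). Complex x y) -` box l u \<inter> space (lborel \<Otimes>\<^sub>M lborel)
      = {Re l<..<Re u} \<times> {Im l<..<Im u}"
    by (auto simp: space_pair_measure in_box_complex_iff)
  moreover have "emeasure (lborel \<Otimes>\<^sub>M lborel) ({Re l<..<Re u} \<times> {Im l<..<Im u})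
      = emeasure lborel {Re l<..<Re u} * emeasure lborel {Im l<..<Im u}"
    by (intro lborel.emeasure_pair_measure_Times) auto
  moreover have "(\<Prod>b\<in>Basis. (u - l) \<bullet> b) = (Re u - Re l) * (Im u - Im l)"
    by (simp add: Basis_complex_def)
  ultimately show "emeasure (distr (lborel \<Otimes>\<^sub>M lborel) borel (\<lambda>(x, y). Complex x y)) (box l u) =
      ennreal (\<Prod>b\<in>Basis. (u - l) \<bullet> b)"
    using le by (subst emeasure_distr) (auto simp: ennreal_mult)
qed simp

lemma nn_integral_lborel_complex:
  assumes "F \<in> borel_measurable borel"
  shows "(\<integral>\<^sup>+z. F z \<partial>lborel) = (\<integral>\<^sup>+y. \<integral>\<^sup>+x. F (Complex x y) \<partial>lborel \<partial>lborel)"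
    and "(\<integral>\<^sup>+z. F z \<partial>lborel) = (\<integral>\<^sup>+x. \<integral>\<^sup>+y. F (Complex x y) \<partial>lborel \<partial>lborel)"
proof -
  have C[measurable]: "(\<lambda>(x, y). Complex x y) \<in> borel_measurable (borel \<Otimes>\<^sub>M borel)"
    unfolding borel_prod
    by (intro borel_measurable_continuous_onI) (auto simp: case_prod_unfold Complex_eq intro!: continuous_intros)
  note assms[measurable]
  have eq: "(\<integral>\<^sup>+z. F z \<partial>lborel) = (\<integral>\<^sup>+z. F (case z of (x, y) \<Rightarrow> Complex x y) \<partial>(lborel \<Otimes>\<^sub>M lborel))"
    by (subst lborel_complex_eq_distr, subst nn_integral_distr) (auto simp: case_prod_unfold)
  have M: "(\<lambda>z. F (case z of (x, y) \<Rightarrow> Complex x y)) \<in> borel_measurable (lborel \<Otimes>\<^sub>M lborel)"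
    by measurable
  show "(\<integral>\<^sup>+z. F z \<partial>lborel) = (\<integral>\<^sup>+y. \<integral>\<^sup>+x. F (Complex x y) \<partial>lborel \<partial>lborel)"
    unfolding eq using lborel_pair.nn_integral_snd[OF M] by simp
  show "(\<integral>\<^sup>+z. F z \<partial>lborel) = (\<integral>\<^sup>+x. \<integral>\<^sup>+y. F (Complex x y) \<partial>lborel \<partial>lborel)"
    unfolding eq using lborel.nn_integral_fst[OF M] by simp
qed

lemma nn_integral_complex_mult:
  fixes F :: "complex \<Rightarrow> ennreal" and l :: complex
  assumes [measurable]: "F \<in> borel_measurable borel" and "l \<noteq> 0"
  shows "(\<integral>\<^sup>+z. F z \<partial>lborel) = ennreal ((norm l)\<^sup>2) * (\<integral>\<^sup>+z. F (l * z) \<partial>lborel)"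
proof -
  have *: "(\<integral>\<^sup>+z. F z \<partial>lborel) = ennreal ((norm l)\<^sup>2) * (\<integral>\<^sup>+z. F (l * z) \<partial>lborel)"
    if "Re l \<noteq> 0" and [measurable]: "F \<in> borel_measurable borel" for l and F :: "complex \<Rightarrow> ennreal"
  proof -
    define a b where "a = Re l" and "b = Im l"
    have a: "a \<noteq> 0" using that by (simp add: a_def)
    \<comment> \<open>Multiplication by \<open>a + i b\<close> factors into two shears in one real variable each, with
      Jacobians \<open>c\<close> and \<open>a\<close>.\<close>
    define c where "c = (a\<^sup>2 + b\<^sup>2) / a"
    have c: "c \<noteq> 0" using a unfolding c_def by (auto simp: sum_power2_eq_zero_iff)
    have [measurable]: "case_prod Complex \<in> borel_measurable (borel \<Otimes>\<^sub>M borel)"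
      unfolding borel_prod
      by (intro borel_measurable_continuous_onI) (auto simp: case_prod_unfold Complex_eq intro!: continuous_intros)
    have "(\<integral>\<^sup>+z. F z \<partial>lborel) = (\<integral>\<^sup>+x. \<integral>\<^sup>+y. F (Complex x y) \<partial>lborel \<partial>lborel)"
      by (rule nn_integral_lborel_complex) measurable
    also have "\<dots> = (\<integral>\<^sup>+x. ennreal \<bar>c\<bar> * (\<integral>\<^sup>+y. F (Complex x (b / a * x + c * y)) \<partial>lborel) \<partial>lborel)"
      by (intro nn_integral_cong nn_integral_real_affine) (use c in measurable)
    also have "\<dots> = ennreal \<bar>c\<bar> * (\<integral>\<^sup>+x. \<integral>\<^sup>+y. F (Complex x (b / a * x + c * y)) \<partial>lborel \<partial>lborel)"
      by (intro nn_integral_cmult) measurable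
    also have "(\<integral>\<^sup>+x. \<integral>\<^sup>+y. F (Complex x (b / a * x + c * y)) \<partial>lborel \<partial>lborel)
        = (\<integral>\<^sup>+y. \<integral>\<^sup>+x. F (Complex x (b / a * x + c * y)) \<partial>lborel \<partial>lborel)"
      by (rule lborel_pair.Fubini') measurable
    also have "\<dots> = (\<integral>\<^sup>+y. ennreal \<bar>a\<bar> * (\<integral>\<^sup>+x. F (Complex (- b * y + a * x) (b / a * (- b * y + a * x) + c * y)) \<partial>lborel) \<partial>lborel)"
      by (intro nn_integral_cong nn_integral_real_affine) (use a in measurable)
    also have "\<dots> = ennreal \<bar>a\<bar> * (\<integral>\<^sup>+y. \<integral>\<^sup>+x. F (Complex (- b * y + a * x) (b / a * (- b * y + a * x) + c * y)) \<partial>lborel \<partial>lborel)"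
      by (intro nn_integral_cmult) measurable
    also have "(\<integral>\<^sup>+y. \<integral>\<^sup>+x. F (Complex (- b * y + a * x) (b / a * (- b * y + a * x) + c * y)) \<partial>lborel \<partial>lborel)
        = (\<integral>\<^sup>+y. \<integral>\<^sup>+x. F (l * Complex x y) \<partial>lborel \<partial>lborel)"
    proof (intro nn_integral_cong arg_cong[where f = F])
      fix x y
      have "b / a * (- b * y + a * x) + c * y = b * x + a * y"
        using a by (simp add: c_def field_simps power2_eq_square)
      then show "Complex (- b * y + a * x) (b / a * (- b * y + a * x) + c * y) = l * Complex x y"
        by (simp add: complex_eq_iff a_def b_def)
    qed
    also have "\<dots> = (\<integral>\<^sup>+z. F (l * z) \<partial>lborel)"
      by (rule nn_integral_lborel_complex(1)[symmetric]) measurable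
    finally have "(\<integral>\<^sup>+z. F z \<partial>lborel) = ennreal (\<bar>c\<bar> * \<bar>a\<bar>) * (\<integral>\<^sup>+z. F (l * z) \<partial>lborel)"
      by (simp add: ennreal_mult mult.assoc)
    also have "\<bar>c\<bar> * \<bar>a\<bar> = (norm l)\<^sup>2"
      using a by (simp add: c_def cmod_def a_def b_def flip: abs_mult)
    finally show ?thesis .
  qed
  show ?thesis
  proof (cases "Re l = 0")
    case False
    then show ?thesis using * assms(1) by blast
  next
    case True
    \<comment> \<open>A purely imaginary factor is a product of two factors with nonzero real part.\<close>
    define l1 where "l1 = Complex 1 1"
    define l2 where "l2 = l / l1"
    have l: "l = l1 * l2" by (simp add: l2_def l1_def complex_eq_iff)
    have "Im l \<noteq> 0" using True assms(2) by (simp add: complex_eq_iff)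
    then have r: "Re l1 \<noteq> 0" "Re l2 \<noteq> 0" using True by (auto simp: l1_def l2_def Re_divide)
    have "(\<integral>\<^sup>+z. F z \<partial>lborel) = ennreal ((norm l1)\<^sup>2) * (\<integral>\<^sup>+z. F (l1 * z) \<partial>lborel)"
      by (rule *[OF r(1)]) measurable
    also have "(\<integral>\<^sup>+z. F (l1 * z) \<partial>lborel) = ennreal ((norm l2)\<^sup>2) * (\<integral>\<^sup>+z. F (l1 * (l2 * z)) \<partial>lborel)"
      by (rule *[OF r(2), of "\<lambda>z. F (l1 * z)"]) measurable
    finally show ?thesis
      by (simp add: l norm_mult power_mult_distrib ennreal_mult mult.assoc)
  qed
qed

text \<open>The common form of the dilations \<open>dil\<close> and \<open>shrink\<close>, of the
  torus rotations, and of multiplication of a vector by a scalar.\<close>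

definition scale2 :: "complex \<Rightarrow> complex \<Rightarrow> complex \<times> complex \<Rightarrow> complex \<times> complex"
  where "scale2 l u z = (l * fst z, u * snd z)"

lemma continuous_on_scale2 [continuous_intros]:
  "continuous_on A f \<Longrightarrow> continuous_on A (\<lambda>x. scale2 l u (f x))"
  unfolding scale2_def by (intro continuous_intros)

lemma measurable_scale2 [measurable]: "scale2 l u \<in> borel_measurable borel"
  using continuous_on_scale2[OF continuous_on_id, of UNIV l u]
  by (auto intro: borel_measurable_continuous_onI)

lemma nn_integral_scale2:
  fixes F :: "complex \<times> complex \<Rightarrow> ennreal"
  assumes F[measurable]: "F \<in> borel_measurable borel" and "l \<noteq> 0" "u \<noteq> 0"
  shows "(\<integral>\<^sup>+z. F z \<partial>lborel) = ennreal ((norm l * norm u)\<^sup>2) * (\<integral>\<^sup>+z. F (scale2 l u z) \<partial>lborel)"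
proof -
  have [measurable]: "F \<in> borel_measurable (lborel \<Otimes>\<^sub>M lborel)"
    "F \<in> borel_measurable (borel \<Otimes>\<^sub>M borel)"
    by (simp_all add: lborel_prod borel_prod)
  have "(\<integral>\<^sup>+z. F z \<partial>lborel) = (\<integral>\<^sup>+x. \<integral>\<^sup>+y. F (x, y) \<partial>lborel \<partial>lborel)"
    by (simp add: lborel.nn_integral_fst lborel_prod)
  also have "\<dots> = (\<integral>\<^sup>+x. ennreal ((norm u)\<^sup>2) * (\<integral>\<^sup>+y. F (x, u * y) \<partial>lborel) \<partial>lborel)"
    by (intro nn_integral_cong nn_integral_complex_mult) (use assms in measurable)
  also have "\<dots> = ennreal ((norm u)\<^sup>2) * (\<integral>\<^sup>+x. (\<integral>\<^sup>+y. F (x, u * y) \<partial>lborel) \<partial>lborel)"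
    by (intro nn_integral_cmult) measurable
  also have "(\<integral>\<^sup>+x. (\<integral>\<^sup>+y. F (x, u * y) \<partial>lborel) \<partial>lborel) =
      ennreal ((norm l)\<^sup>2) * (\<integral>\<^sup>+x. (\<integral>\<^sup>+y. F (l * x, u * y) \<partial>lborel) \<partial>lborel)"
    by (intro nn_integral_complex_mult) (use assms in measurable)
  also have "(\<integral>\<^sup>+x. (\<integral>\<^sup>+y. F (l * x, u * y) \<partial>lborel) \<partial>lborel) = (\<integral>\<^sup>+z. F (l * fst z, u * snd z) \<partial>(lborel \<Otimes>\<^sub>M lborel))"
    by (subst lborel.nn_integral_fst[symmetric]) auto
  finally show ?thesis
    by (simp add: scale2_def lborel_prod power_mult_distrib ennreal_mult mult_ac)
qed

section \<open>Holomorphic functions of two variables\<close>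

lemma holomorphic2_on_imp_continuous_on:
  "holomorphic2_on h \<Omega> \<Longrightarrow> continuous_on \<Omega> h"
  unfolding holomorphic2_on_def continuous_on_eq_continuous_within
  by (meson continuous_at_imp_continuous_at_within has_derivative_continuous)

text \<open>Reduces questions in two variables to one: slices with a fixed coordinate and complex
  lines through a point are both curves of this kind.\<close>

lemma holomorphic2_on_compose_curve:
  assumes h: "holomorphic2_on h \<Omega>" and "open U"
    and "\<phi> holomorphic_on U" "\<psi> holomorphic_on U"
    and sub: "\<And>x. x \<in> U \<Longrightarrow> (\<phi> x, \<psi> x) \<in> \<Omega>"
  shows "(\<lambda>x. h (\<phi> x, \<psi> x)) holomorphic_on U"
  unfolding holomorphic_on_open[OF \<open>open U\<close>]
proof
  fix x assume x: "x \<in> U"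
  obtain a b where ab: "(h has_derivative (\<lambda>v. a * fst v + b * snd v)) (at (\<phi> x, \<psi> x))"
    using h sub[OF x] by (auto simp: holomorphic2_on_def)
  obtain p q where "(\<phi> has_field_derivative p) (at x)" "(\<psi> has_field_derivative q) (at x)"
    using assms(2-4) x by (metis holomorphic_on_open)
  then have "((\<lambda>x. (\<phi> x, \<psi> x)) has_derivative (\<lambda>t. (p * t, q * t))) (at x)"
    unfolding has_field_derivative_def by (rule has_derivative_Pair)
  from diff_chain_at[OF this ab]
  have "((\<lambda>x. h (\<phi> x, \<psi> x)) has_derivative (\<lambda>t. (a * p + b * q) * t)) (at x)"
    by (simp add: o_def algebra_simps)
  then show "\<exists>f'. ((\<lambda>x. h (\<phi> x, \<psi> x)) has_field_derivative f') (at x)"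
    unfolding has_field_derivative_def by blast
qed

lemma holomorphic2_on_scale2:
  assumes h: "holomorphic2_on h \<Omega>" and sub: "\<And>z. z \<in> U \<Longrightarrow> scale2 l u z \<in> \<Omega>"
  shows "holomorphic2_on (\<lambda>z. c * h (scale2 l u z)) U"
  unfolding holomorphic2_on_def
proof
  fix z assume "z \<in> U"
  then obtain a b where ab: "(h has_derivative (\<lambda>v. a * fst v + b * snd v)) (at (scale2 l u z))"
    using h sub by (fastforce simp: holomorphic2_on_def)
  have "(scale2 l u has_derivative (\<lambda>v. (l * fst v, u * snd v))) (at z)"
    unfolding scale2_def[abs_def] by (auto intro!: derivative_eq_intros)
  from diff_chain_at[OF this ab]
  have "((\<lambda>z. h (scale2 l u z)) has_derivative (\<lambda>v. a * (l * fst v) + b * (u * snd v))) (at z)"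
    by (simp add: o_def)
  then have "((\<lambda>z. c * h (scale2 l u z)) has_derivative (\<lambda>v. c * (a * (l * fst v) + b * (u * snd v)))) (at z)"
    by (rule has_derivative_mult_right)
  also have "(\<lambda>v. c * (a * (l * fst v) + b * (u * snd v))) = (\<lambda>v. (c * a * l) * fst v + (c * b * u) * snd v)"
    by (auto simp: algebra_simps)
  finally show "\<exists>a b. ((\<lambda>z. c * h (scale2 l u z)) has_derivative (\<lambda>v. a * fst v + b * snd v)) (at z)"
    by blast
qed

lemma holomorphic2_on_diff:
  assumes "holomorphic2_on f \<Omega>" "holomorphic2_on g \<Omega>"
  shows "holomorphic2_on (\<lambda>z. f z - g z) \<Omega>"
  unfolding holomorphic2_on_def
proof
  fix z assume "z \<in> \<Omega>"
  then obtain a b a' b' where "(f has_derivative (\<lambda>v. a * fst v + b * snd v)) (at z)"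
    "(g has_derivative (\<lambda>v. a' * fst v + b' * snd v)) (at z)"
    using assms by (fastforce simp: holomorphic2_on_def)
  from has_derivative_diff[OF this]
  have "((\<lambda>z. f z - g z) has_derivative (\<lambda>v. (a - a') * fst v + (b - b') * snd v)) (at z)"
    by (simp add: algebra_simps)
  then show "\<exists>a b. ((\<lambda>z. f z - g z) has_derivative (\<lambda>v. a * fst v + b * snd v)) (at z)"
    by blast
qed

text \<open>Cauchy's formula at the centre of the disc. The nonnegative integral on the right lets
  the bound be averaged over directions by Tonelli without integrability conditions.\<close>

lemma circle_mean_le:
  assumes "open U" "\<phi> holomorphic_on U" "cball 0 1 \<subseteq> U"
  shows "ennreal (norm (\<phi> 0)) \<le> (\<integral>\<^sup>+t\<in>{0..1}. ennreal (norm (\<phi> (exp (2 * of_real pi * \<i> * of_real t)))) \<partial>lborel)"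
proof -
  have "((\<lambda>u. \<phi> u / (u - 0)) has_contour_integral 2 * of_real pi * \<i> * \<phi> 0) (circlepath 0 1)"
    by (rule Cauchy_integral_circlepath)
      (auto intro!: holomorphic_on_imp_continuous_on holomorphic_on_subset[OF assms(2)]
         order_trans[OF ball_subset_cball assms(3)] assms(3))
  then have "((\<lambda>t. 2 * of_real pi * \<i> * \<phi> (exp (2 * of_real pi * \<i> * of_real t))) has_integral 2 * of_real pi * \<i> * \<phi> 0) {0..1}"
    unfolding has_contour_integral_def
    by (rule has_integral_cong[THEN iffD1, rotated])
      (simp add: vector_derivative_circlepath01, simp add: circlepath)
  then have "((\<lambda>t. (1 / (2 * of_real pi * \<i>)) * (2 * of_real pi * \<i> * \<phi> (exp (2 * of_real pi * \<i> * of_real t)))) has_integral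
      (1 / (2 * of_real pi * \<i>)) * (2 * of_real pi * \<i> * \<phi> 0)) {0..1}"
    by (rule has_integral_mult_right)
  then have I: "((\<lambda>t. \<phi> (exp (2 * of_real pi * \<i> * of_real t))) has_integral \<phi> 0) {0..1}"
    by simp
  have "continuous_on {0..1} (\<lambda>t. \<phi> (exp (2 * of_real pi * \<i> * of_real t)))"
    by (rule continuous_on_compose2[OF holomorphic_on_imp_continuous_on[OF assms(2)]])
      (use assms(3) in \<open>auto intro!: continuous_intros subsetD[OF assms(3)]\<close>)
  then have S: "set_integrable lborel {0..1} (\<lambda>t. \<phi> (exp (2 * of_real pi * \<i> * of_real t)))"
    by (rule borel_integrable_atLeastAtMost')
  have "\<phi> 0 = (LINT t:{0..1}|lborel. \<phi> (exp (2 * of_real pi * \<i> * of_real t)))"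
    using set_borel_integral_eq_integral(2)[OF S] I by (simp add: integral_unique)
  also have "ennreal (norm \<dots>) \<le> (\<integral>\<^sup>+t. ennreal (norm (indicat_real {0..1} t *\<^sub>R \<phi> (exp (2 * of_real pi * \<i> * of_real t)))) \<partial>lborel)"
    using S unfolding set_lebesgue_integral_def set_integrable_def
    by (rule integral_norm_bound_ennreal)
  also have "\<dots> = (\<integral>\<^sup>+t\<in>{0..1}. ennreal (norm (\<phi> (exp (2 * of_real pi * \<i> * of_real t)))) \<partial>lborel)"
    by (intro nn_integral_cong) (auto simp: indicator_def)
  finally show ?thesis .
qed

lemma nn_integral_lborel_translate:
  fixes F :: "'a::euclidean_space \<Rightarrow> ennreal"
  assumes [measurable]: "F \<in> borel_measurable borel"
  shows "(\<integral>\<^sup>+x. F (c + x) \<partial>lborel) = (\<integral>\<^sup>+x. F x \<partial>lborel)"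
  using nn_integral_distr[of "(+) c" lborel borel F] by (simp add: lborel_distr_plus)

lemma norm_scale2_same: "norm (scale2 l l x) = norm l * norm x"
  by (simp add: scale2_def norm_Pair power_mult_distrib real_sqrt_mult norm_mult
      flip: distrib_left norm_prod_def)

text \<open>For fixed \<open>x\<close> in the centred ball, \<open>h (z + l x)\<close> is
  holomorphic in \<open>l\<close> near the closed unit disc, so \<open>|h z|\<close> is at most its
  mean over \<open>|l| = 1\<close>. Averaging over \<open>x\<close> finishes, because multiplication
  by a unimodular scalar preserves volume; no polar coordinates are involved.\<close>

lemma holomorphic2_mean_value_le:
  fixes h :: "complex \<times> complex \<Rightarrow> complex"
  assumes h: "holomorphic2_on h \<Omega>" and sub: "ball z \<delta> \<subseteq> \<Omega>"
  shows "ennreal (norm (h z)) * emeasure lborel (ball (0 :: complex \<times> complex) \<delta>)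
    \<le> (\<integral>\<^sup>+x\<in>ball z \<delta>. ennreal (norm (h x)) \<partial>lborel)"
proof -
  define H where "H y = ennreal (norm (indicat_real (ball z \<delta>) y *\<^sub>R h y))" for y
  define e where "e t = exp (2 * of_real pi * \<i> * of_real t)" for t :: real
  define D where "D = ball (0 :: complex \<times> complex) \<delta>"
  have "continuous_on (ball z \<delta>) h"
    using h sub holomorphic2_on_imp_continuous_on continuous_on_subset by blast
  then have H[measurable]: "H \<in> borel_measurable borel"
    unfolding H_def by (intro measurable_compose[OF borel_measurable_continuous_on_indicator]) auto
  have D[measurable]: "D \<in> sets borel" by (simp add: D_def)
  have pw: "ennreal (norm (h z)) * indicator D x \<le> (\<integral>\<^sup>+t\<in>{0..1}. H (z + scale2 (e t) (e t) x) \<partial>lborel)" for x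
  proof (cases "x \<in> D")
    case True
    then have x: "norm x < \<delta>" by (simp add: D_def)
    \<comment> \<open>The strict bound on \<open>norm x\<close> leaves room for an open set around
      the closed unit disc.\<close>
    define U where "U = {l. norm (scale2 l l x) < \<delta>}"
    define \<phi> where "\<phi> l = h (fst z + l * fst x, snd z + l * snd x)" for l
    have "open U"
      unfolding U_def scale2_def by (intro open_Collect_less continuous_intros)
    have memb: "(fst z + l * fst x, snd z + l * snd x) \<in> ball z \<delta>" if "l \<in> U" for l
    proof -
      have "dist z (fst z + l * fst x, snd z + l * snd x) = norm (scale2 l l x)"
        by (subst surjective_pairing[of z]) (simp only: dist_norm diff_Pair norm_Pair scale2_def, simp)
      then show ?thesis using that by (simp add: U_def)
    qed
    have "\<phi> holomorphic_on U"
      unfolding \<phi>_def using memb sub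
      by (intro holomorphic2_on_compose_curve[OF h \<open>open U\<close>] holomorphic_intros) auto
    moreover have "cball 0 1 \<subseteq> U"
    proof
      fix l :: complex assume "l \<in> cball 0 1"
      then have "norm l * norm x \<le> norm x" by (simp add: mult_left_le_one_le)
      then show "l \<in> U" using x by (simp add: U_def norm_scale2_same)
    qed
    ultimately have "ennreal (norm (\<phi> 0)) \<le> (\<integral>\<^sup>+t\<in>{0..1}. ennreal (norm (\<phi> (e t))) \<partial>lborel)"
      using circle_mean_le[OF \<open>open U\<close>] by (simp add: e_def)
    also have "\<dots> = (\<integral>\<^sup>+t\<in>{0..1}. H (z + scale2 (e t) (e t) x) \<partial>lborel)"
    proof (intro nn_integral_cong)
      fix t :: real
      have "norm (e t) = 1" by (simp add: e_def)
      then have "e t \<in> U" using x by (simp add: U_def norm_scale2_same)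
      moreover have "z + scale2 (e t) (e t) x = (fst z + e t * fst x, snd z + e t * snd x)"
        by (simp add: scale2_def prod_eq_iff)
      ultimately show "ennreal (norm (\<phi> (e t))) * indicator {0..1} t = H (z + scale2 (e t) (e t) x) * indicator {0..1} t"
        using memb by (simp add: H_def \<phi>_def)
    qed
    finally show ?thesis using True by (simp add: \<phi>_def)
  qed simp
  have [measurable]: "(\<lambda>(t, x). z + scale2 (e t) (e t) x) \<in> borel_measurable (borel \<Otimes>\<^sub>M borel)"
    unfolding borel_prod scale2_def e_def case_prod_unfold
    by (intro borel_measurable_continuous_onI continuous_intros)
  have [measurable]: "(\<lambda>(x, t). z + scale2 (e t) (e t) x) \<in> borel_measurable (borel \<Otimes>\<^sub>M borel)"
    unfolding borel_prod scale2_def e_def case_prod_unfold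
    by (intro borel_measurable_continuous_onI continuous_intros)
  have "ennreal (norm (h z)) * emeasure lborel D = (\<integral>\<^sup>+x. ennreal (norm (h z)) * indicator D x \<partial>lborel)"
    by (simp add: nn_integral_cmult_indicator)
  also have "\<dots> \<le> (\<integral>\<^sup>+x. \<integral>\<^sup>+t. H (z + scale2 (e t) (e t) x) * indicator {0..1} t \<partial>lborel \<partial>lborel)"
    using pw by (intro nn_integral_mono) auto
  also have "\<dots> = (\<integral>\<^sup>+t. \<integral>\<^sup>+x. H (z + scale2 (e t) (e t) x) * indicator {0..1} t \<partial>lborel \<partial>lborel)"
    by (rule lborel_pair.Fubini'[symmetric]) measurable
  also have "\<dots> = (\<integral>\<^sup>+t. (\<integral>\<^sup>+x. H (z + scale2 (e t) (e t) x) \<partial>lborel) * indicator {0..1} t \<partial>lborel)"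
    by (intro nn_integral_cong nn_integral_multc) measurable
  also have "\<dots> = (\<integral>\<^sup>+t. (\<integral>\<^sup>+x. H x \<partial>lborel) * indicator {0..1::real} t \<partial>lborel)"
  proof (rule nn_integral_cong)
    fix t
    have "e t \<noteq> 0" "norm (e t) = 1" by (simp_all add: e_def)
    then have "(\<integral>\<^sup>+x. H (z + scale2 (e t) (e t) x) \<partial>lborel) = (\<integral>\<^sup>+x. H (z + x) \<partial>lborel)"
      using nn_integral_scale2[of "\<lambda>x. H (z + x)" "e t" "e t"] by simp
    then show "(\<integral>\<^sup>+x. H (z + scale2 (e t) (e t) x) \<partial>lborel) * indicator {0..1} t = (\<integral>\<^sup>+x. H x \<partial>lborel) * indicator {0..1} t"
      by (simp add: nn_integral_lborel_translate)
  qed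
  also have "\<dots> = (\<integral>\<^sup>+x. H x \<partial>lborel)"
    by (simp add: nn_integral_cmult_indicator)
  also have "\<dots> = (\<integral>\<^sup>+x\<in>ball z \<delta>. ennreal (norm (h x)) \<partial>lborel)"
    by (intro nn_integral_cong) (auto simp: H_def indicator_def)
  finally show ?thesis by (simp add: D_def)
qed

section \<open>The generalized Hartogs triangle\<close>

lemma nn_integral_lebesgue_on:
  fixes \<Omega> :: "'a::euclidean_space set"
  assumes "\<Omega> \<in> sets borel"
  shows "(\<integral>\<^sup>+z. F z \<partial>lebesgue_on \<Omega>) = (\<integral>\<^sup>+z\<in>\<Omega>. F z \<partial>lborel)"
  using assms by (simp add: nn_integral_restrict_space nn_integral_completion)

lemma Lp_space_iff:
  assumes "\<Omega> \<in> sets borel"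
  shows "f \<in> Lp_space \<Omega> s \<longleftrightarrow> f \<in> borel_measurable (lebesgue_on \<Omega>) \<and>
    (\<integral>\<^sup>+z\<in>\<Omega>. ennreal (norm (f z) powr s) \<partial>lborel) < \<infinity>"
  unfolding Lp_space_def integrable_iff_bounded
  using assms by (auto simp: nn_integral_lebesgue_on)

lemma measurable_lebesgue_on_continuous:
  "open \<Omega> \<Longrightarrow> continuous_on \<Omega> f \<Longrightarrow> f \<in> borel_measurable (lebesgue_on \<Omega>)"
  by (rule continuous_imp_measurable_on_sets_lebesgue) auto

text \<open>Takes the place of Hoelder's inequality on a set of finite measure: for
  \<open>t > \<epsilon>\<close> the factor \<open>(t / \<epsilon>) powr (r - 1)\<close> is at least
  1. The free level \<epsilon> is tuned in \<open>decay\<close>.\<close>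

lemma young_split:
  fixes t \<epsilon> r :: real
  assumes "0 \<le> t" "0 < \<epsilon>" "1 \<le> r"
  shows "t \<le> \<epsilon> + \<epsilon> powr (1 - r) * t powr r"
proof (cases "t \<le> \<epsilon>")
  case False
  then have "t powr (1 - r) \<le> \<epsilon> powr (1 - r)"
    using assms by (intro powr_mono2') auto
  then have "t powr (1 - r) * t powr r \<le> \<epsilon> powr (1 - r) * t powr r"
    by (intro mult_right_mono) auto
  moreover have "t powr (1 - r) * t powr r = t"
    using False assms by (simp flip: powr_add)
  ultimately show ?thesis using assms by linarith
qed (use assms in \<open>auto intro: add_increasing2\<close>)

locale hartogs_domain =
  fixes m n :: nat
  assumes m_pos: "0 < m" and n_pos: "0 < n"
begin

definition \<Omega> :: "(complex \<times> complex) set" where "\<Omega> = hartogs m n"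

text \<open>These maps preserve \<open>|z_1|^m < |z_2|^n\<close> for every
  \<open>\<tau> > 0\<close>. Ratios above 1 are used as well; only the condition
  \<open>|z_2| < 1\<close> can then be lost.\<close>

definition dil :: "real \<Rightarrow> complex \<times> complex \<Rightarrow> complex \<times> complex"
  where "dil \<tau> = scale2 (of_real \<tau> ^ n) (of_real \<tau> ^ m)"

lemma mem_\<Omega>: "z \<in> \<Omega> \<longleftrightarrow> norm (fst z) ^ m < norm (snd z) ^ n \<and> norm (snd z) < 1"
proof -
  have "x powr (real m / real n) < y \<longleftrightarrow> x ^ m < y ^ n" if "0 \<le> x" "0 \<le> y" for x y :: real
  proof (cases "x = 0")
    case True
    then show ?thesis using that m_pos n_pos by (auto simp: zero_power zero_less_power_eq)
  next
    case False
    have "(x powr (real m / real n)) ^ n = x ^ m"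
      using False that n_pos by (simp add: powr_powr flip: powr_realpow)
    then show ?thesis
      using that n_pos by (metis powr_ge_zero power_strict_mono power_less_imp_less_base)
  qed
  then show ?thesis
    by (auto simp: \<Omega>_def hartogs_def split: prod.splits)
qed

lemma snd_nonzero: "z \<in> \<Omega> \<Longrightarrow> snd z \<noteq> 0"
  using n_pos m_pos by (auto simp: mem_\<Omega> zero_power)

lemma norm_fst_less_1: "z \<in> \<Omega> \<Longrightarrow> norm (fst z) < 1"
proof -
  assume z: "z \<in> \<Omega>"
  then have "norm (fst z) ^ m < 1 ^ m"
    using power_le_one[of "norm (snd z)" n] by (auto simp: mem_\<Omega>)
  then show ?thesis by (rule power_less_imp_less_base) simp
qed

lemma open_\<Omega>: "open \<Omega>"
proof -
  have "\<Omega> = {z. norm (fst z) ^ m < norm (snd z) ^ n} \<inter> {z. norm (snd z) < 1}"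
    by (auto simp: mem_\<Omega>)
  then show ?thesis
    by (auto intro!: open_Int open_Collect_less continuous_intros)
qed

lemma sets_\<Omega> [measurable, simp]: "\<Omega> \<in> sets borel"
  using open_\<Omega> by auto

lemma emeasure_\<Omega>_finite: "emeasure lborel \<Omega> < \<infinity>"
proof (rule emeasure_bounded_finite)
  have "\<Omega> \<subseteq> cball 0 1 \<times> cball 0 1"
    using norm_fst_less_1 by (force simp: mem_\<Omega>)
  then show "bounded \<Omega>"
    by (rule bounded_subset[OF bounded_Times[OF bounded_cball bounded_cball]])
qed

section \<open>Weighted dilations and integrability of powers of the second coordinate\<close>

lemma dil_mem_iff:
  assumes "0 < \<tau>"
  shows "dil \<tau> z \<in> \<Omega> \<longleftrightarrow> norm (fst z) ^ m < norm (snd z) ^ n \<and> \<tau> ^ m * norm (snd z) < 1"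
proof -
  have "(\<tau> ^ n * norm (fst z)) ^ m < (\<tau> ^ m * norm (snd z)) ^ n \<longleftrightarrow> norm (fst z) ^ m < norm (snd z) ^ n"
    using assms by (simp add: power_mult_distrib flip: power_mult) (simp add: mult.commute)
  then show ?thesis
    using assms by (simp add: mem_\<Omega> dil_def scale2_def norm_mult norm_power)
qed

lemma dil_mem: "0 < \<tau> \<Longrightarrow> \<tau> \<le> 1 \<Longrightarrow> z \<in> \<Omega> \<Longrightarrow> dil \<tau> z \<in> \<Omega>"
proof -
  assume *: "0 < \<tau>" "\<tau> \<le> 1" "z \<in> \<Omega>"
  have "\<tau> ^ m * norm (snd z) \<le> norm (snd z)"
    using * by (simp add: mult_left_le_one_le power_le_one)
  then show ?thesis using * unfolding dil_mem_iff[OF *(1)] by (auto simp: mem_\<Omega>)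
qed

lemma nn_integral_dil:
  fixes F :: "complex \<times> complex \<Rightarrow> ennreal"
  assumes "F \<in> borel_measurable borel" "0 < \<tau>"
  shows "(\<integral>\<^sup>+z. F (dil \<tau> z) \<partial>lborel) = ennreal (\<tau> powr (- (2 * real m + 2 * real n))) * (\<integral>\<^sup>+z. F z \<partial>lborel)"
proof -
  have c: "(norm (of_real \<tau> ^ n :: complex) * norm (of_real \<tau> ^ m :: complex))\<^sup>2 = \<tau> powr (2 * real m + 2 * real n)"
  proof -
    have "(norm (of_real \<tau> ^ n :: complex) * norm (of_real \<tau> ^ m :: complex))\<^sup>2 = \<tau> ^ (2 * m + 2 * n)"
      using assms(2) by (simp add: norm_power power_add power_mult power_mult_distrib mult.commute power2_eq_square)
    also have "\<dots> = \<tau> powr real (2 * m + 2 * n)"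
      using assms(2) by (simp only: powr_realpow)
    finally show ?thesis by simp
  qed
  have "(\<integral>\<^sup>+z. F z \<partial>lborel) = ennreal (\<tau> powr (2 * real m + 2 * real n)) * (\<integral>\<^sup>+z. F (dil \<tau> z) \<partial>lborel)"
    unfolding dil_def c[symmetric] by (rule nn_integral_scale2) (use assms in auto)
  then have "ennreal (\<tau> powr (- (2 * real m + 2 * real n))) * (\<integral>\<^sup>+z. F z \<partial>lborel)
    = ennreal (\<tau> powr (- (2 * real m + 2 * real n)) * \<tau> powr (2 * real m + 2 * real n)) * (\<integral>\<^sup>+z. F (dil \<tau> z) \<partial>lborel)"
    by (simp add: ennreal_mult mult.assoc)
  also have "\<tau> powr (- (2 * real m + 2 * real n)) * \<tau> powr (2 * real m + 2 * real n) = 1"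
    using assms(2) by (simp flip: powr_add)
  finally show ?thesis by simp
qed

lemma dyadic_shell:
  assumes "z \<in> \<Omega>"
  obtains j :: nat where "2 ^ (j * m) * norm (snd z) < 1" "1 \<le> 2 ^ (Suc j * m) * norm (snd z)"
proof -
  define P where "P j \<longleftrightarrow> 1 \<le> 2 ^ (j * m) * norm (snd z)" for j :: nat
  have s: "0 < norm (snd z)" using snd_nonzero[OF assms] by simp
  obtain j where "1 / norm (snd z) < 2 ^ j"
    using real_arch_pow[of 2 "1 / norm (snd z)"] by auto
  also have "(2::real) ^ j \<le> 2 ^ (j * m)"
    using m_pos by (intro power_increasing) auto
  finally have "\<exists>j. P j" using s by (auto simp: P_def field_simps intro!: exI[of _ j])
  moreover have "\<not> P 0" using assms by (simp add: P_def mem_\<Omega>)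
  moreover obtain i where "P i" "\<And>l. l < i \<Longrightarrow> \<not> P l"
    using \<open>\<exists>j. P j\<close> exists_least_iff[of P] by blast
  ultimately obtain j where "P (Suc j)" "\<not> P j"
    by (cases i) auto
  then show ?thesis by (intro that[of j]) (auto simp: P_def not_le)
qed

text \<open>For \<open>c < 0\<close> the domain is cut into shells where \<open>|z_2|\<close> lies
  between \<open>2^(-(j+1) m)\<close> and \<open>2^(-j m)\<close>. On the shell with index
  \<open>j\<close> the integrand is at most \<open>a j\<close>, and the shell lies in
  \<open>D j\<close>, whose volume is \<open>2^(-j (2m + 2n))\<close> times that of the domain. The
  resulting series is geometric with ratio \<open>\<rho>\<close>, and \<open>\<rho> < 1\<close> is
  exactly the hypothesis.\<close>

lemma weight_integral_finite:
  assumes c: "real m * c > - (2 * real m + 2 * real n)"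
  shows "(\<integral>\<^sup>+z\<in>\<Omega>. ennreal (norm (snd z) powr c) \<partial>lborel) < \<infinity>"
proof (cases "c \<ge> 0")
  case True
  have "(\<integral>\<^sup>+z\<in>\<Omega>. ennreal (norm (snd z) powr c) \<partial>lborel) \<le> (\<integral>\<^sup>+z. indicator \<Omega> z \<partial>lborel)"
    using True by (intro nn_integral_mono) (auto simp: indicator_def mem_\<Omega> intro!: powr_le1)
  then show ?thesis using emeasure_\<Omega>_finite by (simp add: top.not_eq_extremum le_less_trans)
next
  case False
  define a where "a j = 2 powr (- real (Suc j * m) * c)" for j :: nat
  define D where "D j = dil (2 ^ j) -` \<Omega>" for j :: nat
  define \<rho> where "\<rho> = 2 powr (- real m * c - (2 * real m + 2 * real n))"
  define v where "v = measure lborel \<Omega>"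
  have D_sets[measurable]: "D j \<in> sets borel" for j
    unfolding D_def dil_def
    by (intro borel_open open_vimage[OF open_\<Omega>] continuous_intros)
  have v: "emeasure lborel \<Omega> = ennreal v"
    using emeasure_\<Omega>_finite by (simp add: v_def emeasure_eq_ennreal_measure top.not_eq_extremum)
  have D_meas: "emeasure lborel (D j) = ennreal ((2 ^ j) powr (- (2 * real m + 2 * real n)) * v)" for j
  proof -
    have "emeasure lborel (D j) = (\<integral>\<^sup>+z. indicator (D j) z \<partial>lborel)"
      using D_sets by simp
    also have "\<dots> = (\<integral>\<^sup>+z. indicator \<Omega> (dil (2 ^ j) z) \<partial>lborel)"
      by (intro nn_integral_cong) (auto simp: D_def indicator_def)
    also have "\<dots> = ennreal ((2 ^ j) powr (- (2 * real m + 2 * real n))) * (\<integral>\<^sup>+z. indicator \<Omega> z \<partial>lborel)"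
      by (rule nn_integral_dil) auto
    finally show ?thesis by (simp add: v ennreal_mult v_def)
  qed
  have le_suminf: "F j \<le> suminf F" for F :: "nat \<Rightarrow> ennreal" and j
    using sum_le_suminf[of F "{j}"] by simp
  have "(\<integral>\<^sup>+z\<in>\<Omega>. ennreal (norm (snd z) powr c) \<partial>lborel) \<le> (\<integral>\<^sup>+z. (\<Sum>j. ennreal (a j) * indicator (D j) z) \<partial>lborel)"
  proof (rule nn_integral_mono)
    fix z
    show "ennreal (norm (snd z) powr c) * indicator \<Omega> z \<le> (\<Sum>j. ennreal (a j) * indicator (D j) z)"
    proof (cases "z \<in> \<Omega>")
      case z: True
      obtain j where j: "2 ^ (j * m) * norm (snd z) < 1" "1 \<le> 2 ^ (Suc j * m) * norm (snd z)"
        using dyadic_shell[OF z] .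
      have "dil (2 ^ j) z \<in> \<Omega>"
        using j(1) z by (subst dil_mem_iff) (auto simp: mem_\<Omega> power_mult)
      then have "z \<in> D j" by (simp add: D_def)
      have "norm (snd z) powr c \<le> (1 / 2 ^ (Suc j * m)) powr c"
        using j(2) False snd_nonzero[OF z] by (intro powr_mono2') (auto simp: field_simps)
      also have "\<dots> = a j"
        unfolding a_def by (simp add: powr_minus_divide powr_powr powr_divide powr_realpow[symmetric]
            del: of_nat_Suc of_nat_mult power_Suc mult_Suc)
      finally have "ennreal (norm (snd z) powr c) * indicator \<Omega> z \<le> ennreal (a j) * indicator (D j) z"
        using z \<open>z \<in> D j\<close> by (simp add: ennreal_leI)
      also have "\<dots> \<le> (\<Sum>j. ennreal (a j) * indicator (D j) z)"
        by (rule le_suminf)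
      finally show ?thesis .
    qed simp
  qed
  also have "\<dots> = (\<Sum>j. ennreal (a j) * emeasure lborel (D j))"
    by (subst nn_integral_suminf) (auto simp: nn_integral_cmult_indicator)
  also have "\<dots> = (\<Sum>j. ennreal (2 powr (- real m * c) * v * \<rho> ^ j))"
  proof (intro arg_cong[where f = suminf] ext)
    fix j
    have "a j * ((2 ^ j) powr (- (2 * real m + 2 * real n)) * v) = 2 powr (- real m * c) * v * \<rho> ^ j"
    proof -
      have "a j * (2 ^ j) powr (- (2 * real m + 2 * real n))
          = 2 powr (- real (Suc j * m) * c + real j * (- (2 * real m + 2 * real n)))"
        unfolding a_def by (simp only: powr_realpow[symmetric] powr_powr powr_add zero_less_numeral)
      also have "- real (Suc j * m) * c + real j * (- (2 * real m + 2 * real n))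
          = - real m * c + (- real m * c - (2 * real m + 2 * real n)) * real j"
        by (simp add: algebra_simps)
      also have "2 powr \<dots> = 2 powr (- real m * c) * \<rho> ^ j"
        unfolding powr_add \<rho>_def by (simp add: powr_powr flip: powr_realpow)
      finally show ?thesis by (simp add: mult_ac)
    qed
    moreover have "ennreal (a j) * emeasure lborel (D j) = ennreal (a j * ((2 ^ j) powr (- (2 * real m + 2 * real n)) * v))"
      unfolding D_meas by (rule ennreal_mult[symmetric]) (auto simp: a_def v_def)
    ultimately show "ennreal (a j) * emeasure lborel (D j) = ennreal (2 powr (- real m * c) * v * \<rho> ^ j)"
      by (simp only:)
  qed
  also have "\<dots> < \<infinity>"
  proof -
    have "\<rho> < 1" "0 \<le> \<rho>" using c by (auto simp: \<rho>_def powr_less_one)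
    then have "summable (\<lambda>j. 2 powr (- real m * c) * v * \<rho> ^ j)" by (intro summable_mult summable_geometric) auto
    then show ?thesis using \<open>0 \<le> \<rho>\<close> by (subst suminf_ennreal2) (auto simp: v_def)
  qed
  finally show ?thesis .
qed

text \<open>Rescaling by \<open>dil \<tau>\<close> keeps the radius of the mean value inequality fixed; the Jacobian
  produces the exponent, and the remaining integral lives on \<open>|z\<^sub>2| < \<tau>\<^sup>m\<close>, so it tends to zero.\<close>

lemma decay:
  assumes g: "holomorphic2_on g \<Omega>" and r: "1 \<le> r"
    and fin: "(\<integral>\<^sup>+z\<in>\<Omega>. ennreal (norm (g z) powr r) \<partial>lborel) < \<infinity>"
    and K: "compact K" "K \<subseteq> \<Omega>" and "0 < \<eta>"
  obtains \<tau>0 where "0 < \<tau>0" "\<tau>0 \<le> 1"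
    "\<And>\<tau> z. 0 < \<tau> \<Longrightarrow> \<tau> \<le> \<tau>0 \<Longrightarrow> z \<in> K \<Longrightarrow> norm (g (dil \<tau> z)) * \<tau> powr ((2 * real m + 2 * real n) / r) \<le> \<eta>"
proof -
  obtain \<delta> where \<delta>: "0 < \<delta>" "\<And>z. z \<in> K \<Longrightarrow> ball z \<delta> \<subseteq> \<Omega>"
    using compact_subset_open_imp_ball_epsilon_subset[OF K(1) open_\<Omega> K(2)] by (metis UN_subset_iff)
  define V where "V = measure lborel (ball (0 :: complex \<times> complex) \<delta>)"
  have V: "emeasure lborel (ball (0 :: complex \<times> complex) \<delta>) = ennreal V" "0 < V"
    unfolding V_def using \<delta>(1) content_ball_pos[OF \<delta>(1)] emeasure_lborel_ball_finite[of "0 :: complex \<times> complex" \<delta>]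
    by (auto intro: emeasure_eq_ennreal_measure)
  define v where "v = measure lborel \<Omega>"
  have v: "emeasure lborel \<Omega> = ennreal v" "0 \<le> v"
    using emeasure_\<Omega>_finite by (simp_all add: v_def emeasure_eq_ennreal_measure top.not_eq_extremum)
  define q where "q = (2 * real m + 2 * real n) / r"
  \<comment> \<open>\<open>\<eta>1\<close>, and \<open>\<epsilon>\<close> below, are chosen so that
    each of the two terms produced by \<open>young_split\<close> is at most half of
    \<open>\<eta> * V\<close>.\<close>
  define \<eta>1 where "\<eta>1 = \<eta> * V / (2 * (v + 1))"
  have \<eta>1: "0 < \<eta>1" "\<eta>1 * v \<le> \<eta> * V / 2"
    using \<open>0 < \<eta>\<close> V v by (auto simp: \<eta>1_def field_simps)
  define G where "G z = ennreal (norm (indicat_real \<Omega> z *\<^sub>R g z) powr r)" for z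
  have G[measurable]: "G \<in> borel_measurable borel"
    unfolding G_def
    by (intro measurable_compose[OF borel_measurable_continuous_on_indicator[OF sets_\<Omega> holomorphic2_on_imp_continuous_on[OF g]]]) auto
  have G_eq: "G z = ennreal (norm (g z) powr r) * indicator \<Omega> z" for z
    using r by (auto simp: G_def indicator_def)
  \<comment> \<open>For \<open>\<tau> \<le> 1 / Suc j\<close> the image of the domain under
    \<open>dil \<tau>\<close> lies in \<open>A j\<close>. These sets decrease to the axis
    \<open>z_2 = 0\<close>, which misses the domain, so the mass of \<open>|g|^r\<close> on them
    tends to 0.\<close>
  define A where "A j = {z :: complex \<times> complex. norm (snd z) < (1 / real (Suc j)) ^ m}" for j :: nat
  have A[measurable]: "A j \<in> sets borel" for j
    unfolding A_def by (intro borel_open open_Collect_less continuous_intros)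
  define N where "N = density lborel G"
  have "(\<lambda>j. emeasure N (A j)) \<longlonglongrightarrow> emeasure N (\<Inter>j. A j)"
  proof (rule Lim_emeasure_decseq)
    show "decseq A"
      unfolding decseq_Suc_iff
    proof
      fix j
      have "(1 / real (Suc (Suc j))) ^ m \<le> (1 / real (Suc j)) ^ m"
        by (intro power_mono) (auto simp: field_simps)
      then show "A (Suc j) \<subseteq> A j" by (auto simp: A_def)
    qed
    show "emeasure N (A j) \<noteq> \<infinity>" for j
    proof -
      have "emeasure N (A j) \<le> emeasure N (space N)" by (rule emeasure_space)
      also have "\<dots> < \<infinity>" using fin by (simp add: N_def emeasure_density G_eq)
      finally show ?thesis by simp
    qed
  qed (use A in \<open>auto simp: N_def\<close>)
  moreover have "emeasure N (\<Inter>j. A j) = 0"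
  proof -
    have "(\<Inter>j. A j) = {z. snd z = 0}"
    proof safe
      fix a b assume *: "(a, b) \<in> (\<Inter>j. A j)"
      have "(\<lambda>j. (1 / real (Suc j)) ^ m) \<longlonglongrightarrow> 0 ^ m"
        by (intro tendsto_power LIMSEQ_Suc lim_1_over_n)
      moreover have "norm b \<le> (1 / real (Suc j)) ^ m" for j
        using * by (auto simp: A_def less_imp_le)
      ultimately have "norm b \<le> 0 ^ m" by (intro LIMSEQ_le_const) auto
      then show "snd (a, b) = 0" using m_pos by (simp add: zero_power)
    qed (simp add: A_def)
    moreover have "(\<lambda>z. G z * indicator {z. snd z = 0} z) = (\<lambda>z. 0)"
      using snd_nonzero by (auto simp: G_eq indicator_def)
    moreover have "{z :: complex \<times> complex. snd z = 0} \<in> sets lborel"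
      by (auto intro!: borel_closed closed_Collect_eq continuous_intros)
    ultimately show ?thesis
      unfolding N_def by (subst emeasure_density) simp_all
  qed
  ultimately have "(\<lambda>j. emeasure N (A j)) \<longlonglongrightarrow> 0" by simp
  moreover define \<epsilon> where "\<epsilon> = \<eta> * V / 2 * \<eta>1 powr (r - 1)"
  have "0 < \<epsilon>" using \<eta>1 \<open>0 < \<eta>\<close> V by (simp add: \<epsilon>_def)
  then have "0 < ennreal \<epsilon>" by simp
  ultimately have "\<forall>\<^sub>F j in sequentially. emeasure N (A j) < ennreal \<epsilon>"
    by (rule order_tendstoD(2))
  then obtain j where j: "emeasure N (A j) < ennreal \<epsilon>"
    by (auto simp: eventually_sequentially)
  show ?thesis
  proof (rule that[of "1 / real (Suc j)"])
    fix \<tau> z assume \<tau>: "0 < \<tau>" "\<tau> \<le> 1 / real (Suc j)" and z: "z \<in> K"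
    have \<tau>1: "\<tau> \<le> 1" using \<tau>(2) by (rule order_trans) simp
    \<comment> \<open>The splitting level follows the growth rate \<open>\<tau> powr (- q)\<close>;
      after multiplication by \<open>\<tau> powr q\<close> both terms are then free of
      \<tau>.\<close>
    define e where "e = \<eta>1 * \<tau> powr (- q)"
    have e: "0 < e" using \<eta>1 \<tau> by (simp add: e_def)
    have hol: "holomorphic2_on (\<lambda>z. 1 * g (dil \<tau> z)) \<Omega>"
      unfolding dil_def
      by (rule holomorphic2_on_scale2[OF g]) (use dil_mem[OF \<tau>(1) \<tau>1] in \<open>simp add: dil_def\<close>)
    have m1[measurable]: "(\<lambda>x. ennreal (norm (g (dil \<tau> x)) powr r) * indicator \<Omega> x) \<in> borel_measurable borel"
    proof -
      have "(\<lambda>x. ennreal (norm (indicat_real \<Omega> x *\<^sub>R (1 * g (dil \<tau> x))) powr r)) \<in> borel_measurable borel"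
        by (intro measurable_compose[OF borel_measurable_continuous_on_indicator[OF sets_\<Omega> holomorphic2_on_imp_continuous_on[OF hol]]]) auto
      also have "(\<lambda>x. ennreal (norm (indicat_real \<Omega> x *\<^sub>R (1 * g (dil \<tau> x))) powr r)) =
          (\<lambda>x. ennreal (norm (g (dil \<tau> x)) powr r) * indicator \<Omega> x)"
        using r by (auto simp: indicator_def)
      finally show ?thesis .
    qed
    have "(\<integral>\<^sup>+x. ennreal (norm (g (dil \<tau> x)) powr r) * indicator \<Omega> x \<partial>lborel)
        \<le> (\<integral>\<^sup>+x. G (dil \<tau> x) * indicator (A j) (dil \<tau> x) \<partial>lborel)"
    proof (rule nn_integral_mono)
      fix x
      have "dil \<tau> x \<in> A j" if "x \<in> \<Omega>"
      proof -
        have "norm (snd (dil \<tau> x)) = \<tau> ^ m * norm (snd x)"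
          using \<tau> by (simp add: dil_def scale2_def norm_mult norm_power)
        also have "\<dots> < \<tau> ^ m" using that \<tau> by (simp add: mem_\<Omega>)
        also have "\<dots> \<le> (1 / real (Suc j)) ^ m" using \<tau> by (intro power_mono) auto
        finally show ?thesis by (simp add: A_def)
      qed
      then show "ennreal (norm (g (dil \<tau> x)) powr r) * indicator \<Omega> x \<le> G (dil \<tau> x) * indicator (A j) (dil \<tau> x)"
        using dil_mem[OF \<tau>(1) \<tau>1] by (auto simp: G_eq indicator_def)
    qed
    also have "(\<integral>\<^sup>+x. G (dil \<tau> x) * indicator (A j) (dil \<tau> x) \<partial>lborel) = ennreal (\<tau> powr (- (2 * real m + 2 * real n))) * emeasure N (A j)"
      using nn_integral_dil[of "\<lambda>x. G x * indicator (A j) x" \<tau>] \<tau> by (simp add: N_def emeasure_density)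
    also have "\<dots> \<le> ennreal (\<tau> powr (- (2 * real m + 2 * real n))) * ennreal \<epsilon>"
      using j by (intro mult_left_mono) auto
    finally have I: "(\<integral>\<^sup>+x. ennreal (norm (g (dil \<tau> x)) powr r) * indicator \<Omega> x \<partial>lborel)
        \<le> ennreal (\<tau> powr (- (2 * real m + 2 * real n)) * \<epsilon>)"
      using \<open>0 < \<epsilon>\<close> by (simp add: ennreal_mult)
    have "ennreal (norm (g (dil \<tau> z))) * ennreal V \<le> (\<integral>\<^sup>+x\<in>ball z \<delta>. ennreal (norm (g (dil \<tau> x))) \<partial>lborel)"
      using holomorphic2_mean_value_le[OF hol \<delta>(2)[OF z]] V by simp
    also have "\<dots> \<le> (\<integral>\<^sup>+x. ennreal e * indicator \<Omega> x + ennreal (e powr (1 - r)) * (ennreal (norm (g (dil \<tau> x)) powr r) * indicator \<Omega> x) \<partial>lborel)"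
      using \<delta>(2)[OF z] young_split[OF norm_ge_zero e r] e
      by (intro nn_integral_mono) (auto simp: indicator_def ennreal_leI simp flip: ennreal_mult ennreal_plus)
    also have "\<dots> = ennreal e * ennreal v + ennreal (e powr (1 - r)) * (\<integral>\<^sup>+x. ennreal (norm (g (dil \<tau> x)) powr r) * indicator \<Omega> x \<partial>lborel)"
      by (subst nn_integral_add) (auto simp: nn_integral_cmult nn_integral_cmult_indicator v)
    also have "\<dots> \<le> ennreal e * ennreal v + ennreal (e powr (1 - r)) * ennreal (\<tau> powr (- (2 * real m + 2 * real n)) * \<epsilon>)"
      by (intro add_left_mono mult_left_mono I) simp
    finally have "ennreal (norm (g (dil \<tau> z)) * V) \<le> ennreal (e * v + e powr (1 - r) * (\<tau> powr (- (2 * real m + 2 * real n)) * \<epsilon>))"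
      using e v V \<open>0 < \<epsilon>\<close> by (simp add: ennreal_mult ennreal_plus)
    then have "norm (g (dil \<tau> z)) * V \<le> e * v + e powr (1 - r) * (\<tau> powr (- (2 * real m + 2 * real n)) * \<epsilon>)"
      using e v \<open>0 < \<epsilon>\<close> by (subst (asm) ennreal_le_iff) auto
    then have "norm (g (dil \<tau> z)) * V * \<tau> powr q \<le>
        (e * v + e powr (1 - r) * (\<tau> powr (- (2 * real m + 2 * real n)) * \<epsilon>)) * \<tau> powr q"
      by (rule mult_right_mono) simp
    also have "\<dots> = \<eta>1 * v + \<eta>1 powr (1 - r) * \<epsilon> * (\<tau> powr (- q * (1 - r)) * \<tau> powr (- (2 * real m + 2 * real n)) * \<tau> powr q)"
    proof -
      have "e powr (1 - r) = \<eta>1 powr (1 - r) * \<tau> powr (- q * (1 - r))"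
        using \<eta>1 by (simp only: e_def powr_mult powr_powr)
      moreover have "e * \<tau> powr q = \<eta>1"
        using \<tau> by (simp add: e_def mult.assoc flip: powr_add)
      moreover have "(e * v + A * B * (T * \<epsilon>)) * Q = e * Q * v + A * \<epsilon> * (B * T * Q)" for A B T Q
        by (simp add: algebra_simps)
      ultimately show ?thesis
        by (simp only:)
    qed
    also have "\<tau> powr (- q * (1 - r)) * \<tau> powr (- (2 * real m + 2 * real n)) * \<tau> powr q = \<tau> powr 0"
      unfolding powr_add[symmetric] using r by (intro arg_cong2[where f = "(powr)"] refl) (simp add: q_def field_simps)
    also have "\<eta>1 powr (1 - r) * \<epsilon> * \<tau> powr 0 = \<eta> * V / 2 * (\<eta>1 powr (1 - r) * \<eta>1 powr (r - 1))"
      using \<tau> by (simp add: \<epsilon>_def)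
    also have "\<eta>1 powr (1 - r) * \<eta>1 powr (r - 1) = 1"
      using \<eta>1 by (simp flip: powr_add)
    finally have "norm (g (dil \<tau> z)) * V * \<tau> powr q \<le> \<eta> * V"
      using \<eta>1 by simp
    then show "norm (g (dil \<tau> z)) * \<tau> powr ((2 * real m + 2 * real n) / r) \<le> \<eta>"
      using V by (simp add: q_def[symmetric] mult.assoc mult.commute[of V])
  next
    show "0 < 1 / real (Suc j)" by simp
    show "1 / real (Suc j) \<le> 1" by simp
  qed
qed

end

section \<open>Monomials and the sub-Bergman projection\<close>

lemma monomial2_scale2:
  "monomial2 \<alpha> (scale2 l u z) = l powi fst \<alpha> * u powi snd \<alpha> * monomial2 \<alpha> z"
  by (simp add: monomial2_def scale2_def power_int_mult_distrib)

lemma holomorphic2_on_monomial2: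
  assumes "0 \<le> fst \<alpha>" and "\<And>z. z \<in> A \<Longrightarrow> snd z \<noteq> 0"
  shows "holomorphic2_on (monomial2 \<alpha>) A"
  unfolding holomorphic2_on_def
proof
  fix z :: "complex \<times> complex" assume "z \<in> A"
  then have z: "snd z \<noteq> 0" using assms by auto
  define a where "a = nat (fst \<alpha>)"
  have eq: "monomial2 \<alpha> = (\<lambda>z. fst z ^ a * snd z powi snd \<alpha>)"
    using assms by (auto simp: monomial2_def a_def power_int_def)
  have "((\<lambda>w. w ^ a) has_field_derivative of_nat a * fst z ^ (a - Suc 0)) (at (fst z))"
    using DERIV_pow[of a] by (auto intro!: derivative_eq_intros)
  then have 1: "((\<lambda>w. w ^ a) has_derivative (\<lambda>h. of_nat a * fst z ^ (a - Suc 0) * h)) (at (fst z))"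
    by (simp add: has_field_derivative_def)
  have "((\<lambda>w. w powi snd \<alpha>) has_field_derivative of_int (snd \<alpha>) * snd z powi (snd \<alpha> - 1)) (at (snd z))"
    using z by (auto intro!: derivative_eq_intros)
  then have 2: "((\<lambda>w. w powi snd \<alpha>) has_derivative (\<lambda>h. of_int (snd \<alpha>) * snd z powi (snd \<alpha> - 1) * h)) (at (snd z))"
    by (simp add: has_field_derivative_def)
  have "((\<lambda>z. fst z ^ a) has_derivative (\<lambda>h. of_nat a * fst z ^ (a - Suc 0) * fst h)) (at z)"
    using diff_chain_at[OF has_derivative_fst[OF has_derivative_ident] 1] by (simp add: o_def)
  moreover have "((\<lambda>z. snd z powi snd \<alpha>) has_derivative (\<lambda>h. of_int (snd \<alpha>) * snd z powi (snd \<alpha> - 1) * snd h)) (at z)"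
    using diff_chain_at[OF has_derivative_snd[OF has_derivative_ident] 2] by (simp add: o_def)
  ultimately have "(monomial2 \<alpha> has_derivative (\<lambda>h. fst z ^ a * (of_int (snd \<alpha>) * snd z powi (snd \<alpha> - 1) * snd h)
      + of_nat a * fst z ^ (a - Suc 0) * fst h * snd z powi snd \<alpha>)) (at z)"
    unfolding eq by (rule has_derivative_mult)
  also have "(\<lambda>h. fst z ^ a * (of_int (snd \<alpha>) * snd z powi (snd \<alpha> - 1) * snd h)
      + of_nat a * fst z ^ (a - Suc 0) * fst h * snd z powi snd \<alpha>)
    = (\<lambda>h. (of_nat a * fst z ^ (a - Suc 0) * snd z powi snd \<alpha>) * fst h
        + (fst z ^ a * of_int (snd \<alpha>) * snd z powi (snd \<alpha> - 1)) * snd h)"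
    by (auto simp: algebra_simps)
  finally show "\<exists>a b. (monomial2 \<alpha> has_derivative (\<lambda>v. a * fst v + b * snd v)) (at z)"
    by blast
qed

text \<open>The bound separates \<open>i\<close> from \<open>x\<close>. Hence one summable family
  \<open>b\<close> controls both the pointwise series and the series of integrals, and after an
  enumeration of \<open>A\<close> the theorem on termwise integration of series applies.\<close>

lemma integral_infsum_dominated:
  fixes F :: "'i \<Rightarrow> 'a \<Rightarrow> complex" and b :: "'i \<Rightarrow> real"
  assumes "countable A" "infinite A"
    and meas: "\<And>i. i \<in> A \<Longrightarrow> F i \<in> borel_measurable M"
    and bound: "\<And>i x. i \<in> A \<Longrightarrow> x \<in> space M \<Longrightarrow> norm (F i x) \<le> b i * G x"
    and b: "b summable_on A" "\<And>i. i \<in> A \<Longrightarrow> 0 \<le> b i"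
    and G: "integrable M G" "\<And>x. x \<in> space M \<Longrightarrow> 0 \<le> G x"
  shows "integrable M (\<lambda>x. \<Sum>\<^sub>\<infinity>i\<in>A. F i x)"
    and "((\<lambda>i. LINT x|M. F i x) has_sum (LINT x|M. (\<Sum>\<^sub>\<infinity>i\<in>A. F i x))) A"
proof -
  define h where "h = from_nat_into A"
  have h: "bij_betw h UNIV A" unfolding h_def by (rule bij_betw_from_nat_into[OF assms(1,2)])
  then have hA: "h j \<in> A" for j by (auto simp: bij_betw_def)
  have bs: "summable (\<lambda>j. b (h j))"
    using b h summable_on_imp_summable summable_on_reindex_bij_betw by blast
  have Fs: "summable (\<lambda>j. norm (F (h j) x))" if "x \<in> space M" for x
    by (rule summable_comparison_test'[OF summable_mult2[OF bs, of "G x"], of 0])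
      (use bound[OF hA that] in simp)
  have inf: "(\<Sum>\<^sub>\<infinity>i\<in>A. F i x) = (\<Sum>j. F (h j) x)" if "x \<in> space M" for x
  proof -
    have "((\<lambda>j. F (h j) x) has_sum (\<Sum>j. F (h j) x)) UNIV"
      by (rule norm_summable_imp_has_sum[OF Fs[OF that] summable_sums[OF summable_norm_cancel[OF Fs[OF that]]]])
    then show ?thesis
      using has_sum_reindex_bij_betw[OF h, of "\<lambda>i. F i x"] infsumI by blast
  qed
  have Fi: "integrable M (F (h j))" for j
    by (rule Bochner_Integration.integrable_bound[OF integrable_mult_right[OF G(1), of "b (h j)"] meas[OF hA]])
      (use bound[OF hA] b(2)[OF hA] G(2) in \<open>auto simp: abs_mult\<close>)
  have si: "summable (\<lambda>j. LINT x|M. norm (F (h j) x))"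
  proof (rule summable_comparison_test'[OF summable_mult2[OF bs, of "LINT x|M. G x"], of 0])
    fix j :: nat
    have "(LINT x|M. norm (F (h j) x)) \<le> (LINT x|M. b (h j) * G x)"
      by (rule integral_mono) (use Fi G bound[OF hA] in auto)
    then show "norm (LINT x|M. norm (F (h j) x)) \<le> b (h j) * (LINT x|M. G x)" by simp
  qed
  have ae: "AE x in M. summable (\<lambda>j. norm (F (h j) x))" using Fs by auto
  show "integrable M (\<lambda>x. \<Sum>\<^sub>\<infinity>i\<in>A. F i x)"
    by (rule Bochner_Integration.integrable_cong[OF refl inf, THEN iffD2, OF _ integrable_suminf[OF Fi ae si]])
  have eq: "(LINT x|M. (\<Sum>\<^sub>\<infinity>i\<in>A. F i x)) = (LINT x|M. (\<Sum>j. F (h j) x))"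
    by (rule Bochner_Integration.integral_cong) (auto simp: inf)
  have "summable (\<lambda>j. norm (LINT x|M. F (h j) x))"
    by (rule summable_comparison_test'[OF si, of 0]) auto
  then have "((\<lambda>j. LINT x|M. F (h j) x) has_sum (LINT x|M. (\<Sum>\<^sub>\<infinity>i\<in>A. F i x))) UNIV"
    using sums_integral[OF Fi ae si] unfolding eq by (rule norm_summable_imp_has_sum)
  then show "((\<lambda>i. LINT x|M. F i x) has_sum (LINT x|M. (\<Sum>\<^sub>\<infinity>i\<in>A. F i x))) A"
    using has_sum_reindex_bij_betw[OF h, of "\<lambda>i. LINT x|M. F i x"] by blast
qed

section \<open>Moduli and homogeneity of monomials\<close>

context hartogs_domain
begin

definition weight :: "int \<times> int \<Rightarrow> int"
  where "weight \<alpha> = int n * fst \<alpha> + int m * snd \<alpha>"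

text \<open>The first coordinate measured in units of the radius of the disc obtained by fixing
  \<open>z_2\<close>. On the domain \<open>rad z\<close> and \<open>|z_2|\<close> vary independently
  below 1, and the modulus of a monomial becomes a product of powers of the two.\<close>

definition rad :: "complex \<times> complex \<Rightarrow> real"
  where "rad z = norm (fst z) / norm (snd z) powr (real n / real m)"

lemma rad_nonneg: "0 \<le> rad z"
  by (simp add: rad_def)

lemma rad_less_1: "z \<in> \<Omega> \<Longrightarrow> rad z < 1"
proof -
  assume z: "z \<in> \<Omega>"
  have s: "0 < norm (snd z)" using snd_nonzero[OF z] by simp
  have "(norm (fst z) ^ m) powr (1 / real m) < (norm (snd z) ^ n) powr (1 / real m)"
    using z m_pos by (intro powr_less_mono2) (auto simp: mem_\<Omega>)
  moreover have "(norm (snd z) ^ n) powr (1 / real m) = norm (snd z) powr (real n / real m)"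
    using s by (simp add: powr_powr flip: powr_realpow)
  moreover have "(norm (fst z) ^ m) powr (1 / real m) = norm (fst z)"
    using m_pos by (cases "fst z = 0") (simp_all add: powr_powr zero_power flip: powr_realpow)
  ultimately show ?thesis using s by (simp add: rad_def)
qed

lemma norm_monomial2:
  assumes z: "z \<in> \<Omega>" and "0 \<le> fst \<alpha>"
  shows "norm (monomial2 \<alpha> z) = rad z ^ nat (fst \<alpha>) * norm (snd z) powr (real_of_int (weight \<alpha>) / real m)"
proof -
  define s where "s = norm (snd z)"
  define a where "a = nat (fst \<alpha>)"
  have a: "fst \<alpha> = int a" using assms by (simp add: a_def)
  have s: "0 < s" using snd_nonzero[OF z] by (simp add: s_def)
  have "norm (monomial2 \<alpha> z) = norm (fst z) ^ a * s powi snd \<alpha>"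
    by (simp add: monomial2_def norm_mult norm_power_int a s_def norm_power)
  also have "norm (fst z) = rad z * s powr (real n / real m)"
    using s by (simp add: rad_def s_def)
  also have "s powi snd \<alpha> = s powr real_of_int (snd \<alpha>)"
    using s by (simp add: powr_real_of_int')
  also have "(rad z * s powr (real n / real m)) ^ a * s powr real_of_int (snd \<alpha>)
      = rad z ^ a * (s powr (real n / real m * real a) * s powr real_of_int (snd \<alpha>))"
    using s by (simp add: power_mult_distrib powr_powr flip: powr_realpow)
  also have "s powr (real n / real m * real a) * s powr real_of_int (snd \<alpha>)
      = s powr (real_of_int (weight \<alpha>) / real m)"
    using m_pos by (simp add: weight_def a field_simps flip: powr_add)
  finally show ?thesis by (simp add: s_def a_def)
qed

lemma norm_monomial2_dil:
  assumes "0 < \<tau>"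
  shows "norm (monomial2 \<alpha> (dil \<tau> z)) = \<tau> powr real_of_int (weight \<alpha>) * norm (monomial2 \<alpha> z)"
proof -
  have "norm ((of_real \<tau> ^ n) powi fst \<alpha> * (of_real \<tau> ^ m) powi snd \<alpha> :: complex)
      = \<tau> powi (int n * fst \<alpha>) * \<tau> powi (int m * snd \<alpha>)"
    using assms by (simp add: norm_mult norm_power_int norm_power power_int_mult)
  also have "\<dots> = \<tau> powi weight \<alpha>"
    using assms by (simp add: weight_def power_int_add)
  also have "\<dots> = \<tau> powr real_of_int (weight \<alpha>)"
    using assms by (simp add: powr_real_of_int')
  finally show ?thesis
    by (simp add: dil_def monomial2_scale2 norm_mult)
qed

end

text \<open>The thresholds are \<open>r < p_(k+1)\<close>, \<open>p_k \<le> r\<close> and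
  \<open>2 < p_(k+1)\<close>, multiplied out so that the case \<open>k = 0\<close>, where
  \<open>p_(k+1)\<close> is infinite, is included.\<close>

locale sub_bergman = hartogs_domain +
  fixes k :: int and r :: real
  assumes k_nonpos: "k \<le> 0" and r_ge_1: "1 \<le> r"
    and upper_threshold: "- real_of_int k * r < 2 * real m + 2 * real n"
    and lower_threshold: "2 * real m + 2 * real n \<le> r * (1 - real_of_int k)"
    and square_threshold: "- real_of_int k * 2 < 2 * real m + 2 * real n"
begin

definition S :: "(int \<times> int) set"
  where "S = {\<alpha>. 0 \<le> fst \<alpha> \<and> k \<le> weight \<alpha>}"

text \<open>The sum of the two exponents in \<open>norm_monomial2_eq\<close>, and at the same time
  the exponent of the multiplier in \<open>shrunk_monomial2\<close>.\<close>

definition excess :: "int \<times> int \<Rightarrow> nat"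
  where "excess \<alpha> = nat (fst \<alpha>) + nat (weight \<alpha> - k)"

definition W :: "complex \<times> complex \<Rightarrow> real"
  where "W z = norm (snd z) powr (real_of_int k / real m)"

text \<open>The larger of the two bases in \<open>norm_monomial2_eq\<close>. It is below 1, so it
  serves as a single geometric rate for all monomials at \<open>z\<close>.\<close>

definition mag :: "complex \<times> complex \<Rightarrow> real"
  where "mag z = max (rad z) (norm (snd z) powr (1 / real m))"

lemma W_ge_1: "z \<in> \<Omega> \<Longrightarrow> 1 \<le> W z"
proof -
  assume z: "z \<in> \<Omega>"
  then have "1 powr (real_of_int k / real m) \<le> W z"
    unfolding W_def using k_nonpos m_pos snd_nonzero[OF z]
    by (intro powr_mono2') (auto simp: mem_\<Omega> divide_nonpos_pos)
  then show ?thesis by simp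
qed

lemma mag_bounds: "z \<in> \<Omega> \<Longrightarrow> 0 < mag z" "z \<in> \<Omega> \<Longrightarrow> mag z < 1"
  using rad_less_1[of z] snd_nonzero[of z] m_pos powr_less_mono2[of "1 / real m" "norm (snd z)" 1]
  by (auto simp: mag_def mem_\<Omega> less_max_iff_disj)

lemma norm_monomial2_eq:
  assumes "z \<in> \<Omega>" "\<alpha> \<in> S"
  shows "norm (monomial2 \<alpha> z) =
    W z * (rad z ^ nat (fst \<alpha>) * (norm (snd z) powr (1 / real m)) ^ nat (weight \<alpha> - k))"
proof -
  define d where "d = nat (weight \<alpha> - k)"
  have w: "weight \<alpha> = k + int d" and a: "0 \<le> fst \<alpha>"
    using assms(2) by (auto simp: d_def S_def)
  have "norm (snd z) powr (real_of_int (weight \<alpha>) / real m)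
      = W z * norm (snd z) powr (1 / real m * real d)"
    by (simp add: w W_def add_divide_distrib flip: powr_add)
  also have "norm (snd z) powr (1 / real m * real d) = (norm (snd z) powr (1 / real m)) ^ d"
    using snd_nonzero[OF assms(1)] by (simp add: powr_powr flip: powr_realpow)
  finally show ?thesis
    by (simp add: norm_monomial2[OF assms(1) a] d_def mult_ac)
qed

lemma norm_monomial2_le:
  assumes "z \<in> \<Omega>" "\<alpha> \<in> S"
  shows "norm (monomial2 \<alpha> z) \<le> W z * mag z ^ excess \<alpha>"
  unfolding norm_monomial2_eq[OF assms] excess_def power_add
  using W_ge_1[OF assms(1)]
  by (intro mult_left_mono mult_mono power_mono) (auto simp: mag_def rad_nonneg le_max_iff_disj intro!: zero_le_power)

lemma norm_monomial2_le_W: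
  assumes "z \<in> \<Omega>" "\<alpha> \<in> S"
  shows "norm (monomial2 \<alpha> z) \<le> W z"
proof -
  have "W z * mag z ^ excess \<alpha> \<le> W z * 1"
    using W_ge_1[OF assms(1)] mag_bounds[OF assms(1)]
    by (intro mult_left_mono power_le_one) auto
  then show ?thesis using norm_monomial2_le[OF assms] by simp
qed

lemma W_powr_integral_finite:
  assumes "0 < s" "- real_of_int k * s < 2 * real m + 2 * real n"
  shows "(\<integral>\<^sup>+z\<in>\<Omega>. ennreal (W z powr s) \<partial>lborel) < \<infinity>"
proof -
  have "real m * (real_of_int k / real m * s) > - (2 * real m + 2 * real n)"
    using assms m_pos by (simp add: field_simps)
  from weight_integral_finite[OF this] show ?thesis by (simp add: W_def powr_powr)
qed

lemma monomial2_measurable: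
  assumes "\<alpha> \<in> S"
  shows "monomial2 \<alpha> \<in> borel_measurable (lebesgue_on \<Omega>)"
proof -
  have "holomorphic2_on (monomial2 \<alpha>) \<Omega>"
    using assms snd_nonzero by (intro holomorphic2_on_monomial2) (auto simp: S_def)
  then show ?thesis
    by (rule measurable_lebesgue_on_continuous[OF open_\<Omega> holomorphic2_on_imp_continuous_on])
qed

lemma W_measurable: "W \<in> borel_measurable (lebesgue_on \<Omega>)"
proof (rule measurable_lebesgue_on_continuous[OF open_\<Omega>])
  show "continuous_on \<Omega> W"
    unfolding W_def using snd_nonzero by (intro continuous_intros) auto
qed

lemma measurable_powr_lebesgue_on:
  fixes f :: "complex \<times> complex \<Rightarrow> real"
  shows "f \<in> borel_measurable (lebesgue_on \<Omega>) \<Longrightarrow> (\<lambda>z. f z powr s) \<in> borel_measurable (lebesgue_on \<Omega>)"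
  by measurable

lemma integrable_W_powr:
  assumes "0 < s" "- real_of_int k * s < 2 * real m + 2 * real n"
  shows "integrable (lebesgue_on \<Omega>) (\<lambda>z. W z powr s)"
  unfolding integrable_iff_bounded
  using measurable_powr_lebesgue_on[OF W_measurable] W_powr_integral_finite[OF assms]
  by (simp add: nn_integral_lebesgue_on)

lemma monomial2_in_Lp:
  assumes "\<alpha> \<in> S" "0 < s" "- real_of_int k * s < 2 * real m + 2 * real n"
  shows "monomial2 \<alpha> \<in> Lp_space \<Omega> s"
proof -
  have m: "(\<lambda>z. norm (monomial2 \<alpha> z) powr s) \<in> borel_measurable (lebesgue_on \<Omega>)"
    using monomial2_measurable[OF assms(1)] by measurable
  have "integrable (lebesgue_on \<Omega>) (\<lambda>z. norm (monomial2 \<alpha> z) powr s)"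
    by (rule Bochner_Integration.integrable_bound[OF integrable_W_powr[OF assms(2,3)] m])
      (use norm_monomial2_le_W[OF _ assms(1)] assms(2) in \<open>auto intro!: powr_mono2 AE_I2\<close>)
  then show ?thesis using monomial2_measurable[OF assms(1)] by (simp add: Lp_space_def)
qed

text \<open>Off both axes no monomial vanishes, so its growth along dilations can be read off at
  this point.\<close>

lemma test_point:
  obtains z where "z \<in> \<Omega>" "fst z \<noteq> 0"
proof (rule that[of "((1/2) ^ (n + 1), 1/2)"])
  have "((1/2::real) ^ (n + 1)) ^ m \<le> ((1/2) ^ (n + 1)) ^ 1"
    by (rule power_decreasing) (use m_pos power_le_one[of "1/2::real" "n + 1"] in auto)
  also have "\<dots> < (1/2) ^ n" by simp
  finally show "((1/2) ^ (n + 1), 1/2) \<in> \<Omega>"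
    by (simp add: mem_\<Omega> norm_power norm_divide norm_mult)
qed simp

text \<open>The convention for negative powers of 0 gives the value 0 at \<open>(0, 1/2)\<close>, a
  point of the domain, while along \<open>p\<close> the modulus stays above a positive constant;
  this contradicts continuity.\<close>

lemma fst_nonneg_if_holomorphic2:
  assumes "holomorphic2_on (monomial2 \<alpha>) \<Omega>"
  shows "0 \<le> fst \<alpha>"
proof (rule ccontr)
  assume neg: "\<not> 0 \<le> fst \<alpha>"
  define p where "p j = (of_real (1 / real (Suc j)) :: complex, 1/2 :: complex)" for j
  have 1: "p \<longlonglongrightarrow> (of_real 0, 1/2)"
    unfolding p_def by (intro tendsto_intros LIMSEQ_Suc lim_1_over_n)
  have 2: "isCont (monomial2 \<alpha>) (of_real 0, 1/2)"
    using holomorphic2_on_imp_continuous_on[OF assms] open_\<Omega> m_pos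
    by (auto simp: continuous_on_eq_continuous_at mem_\<Omega> zero_power)
  have "(\<lambda>j. norm (monomial2 \<alpha> (p j))) \<longlonglongrightarrow> norm (monomial2 \<alpha> (of_real 0, 1/2))"
    by (rule tendsto_norm[OF isCont_tendsto_compose[OF 2 1]])
  moreover have "monomial2 \<alpha> (of_real 0, 1/2) = 0"
    using neg by (simp add: monomial2_def)
  moreover have "(1/2) powi snd \<alpha> \<le> norm (monomial2 \<alpha> (p j))" for j
  proof -
    have "1 \<le> (1 / real (Suc j)) powi fst \<alpha>"
      using neg by (simp add: power_int_def one_le_power)
    then have "1 * (1/2) powi snd \<alpha> \<le> (1 / real (Suc j)) powi fst \<alpha> * (1/2 :: real) powi snd \<alpha>"
      by (intro mult_right_mono) auto
    also have "\<dots> = norm (monomial2 \<alpha> (p j))"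
      unfolding monomial2_def p_def fst_conv snd_conv norm_mult norm_power_int norm_of_real
      by (simp add: norm_divide)
    finally show ?thesis by simp
  qed
  ultimately have "(1/2 :: real) powi snd \<alpha> \<le> 0"
    by (intro LIMSEQ_le_const[of "\<lambda>j. norm (monomial2 \<alpha> (p j))"]) auto
  then show False
    using zero_less_power_int[of "1/2 :: real" "snd \<alpha>"] by linarith
qed

text \<open>Membership implies the exponent conditions through \<open>decay\<close> at one point:
  along \<open>dil \<tau>\<close> the modulus is exactly a multiple of
  \<open>\<tau> powr weight \<alpha>\<close>, which forces \<open>weight \<alpha> + q > 0\<close>.
  As \<open>q \<le> 1 - k\<close>, the weight exceeds \<open>k - 1\<close>, and integrality closes
  the gap. The converse is domination by \<open>W\<close>.\<close>

lemma monomial2_in_bergman_iff: "monomial2 \<alpha> \<in> bergman \<Omega> r \<longleftrightarrow> \<alpha> \<in> S"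
proof
  assume "\<alpha> \<in> S"
  then show "monomial2 \<alpha> \<in> bergman \<Omega> r"
    using r_ge_1 upper_threshold snd_nonzero
    by (auto simp: bergman_def S_def intro!: monomial2_in_Lp holomorphic2_on_monomial2)
next
  assume b: "monomial2 \<alpha> \<in> bergman \<Omega> r"
  then have hol: "holomorphic2_on (monomial2 \<alpha>) \<Omega>" and "monomial2 \<alpha> \<in> Lp_space \<Omega> r"
    by (auto simp: bergman_def)
  then have fin: "(\<integral>\<^sup>+z\<in>\<Omega>. ennreal (norm (monomial2 \<alpha> z) powr r) \<partial>lborel) < \<infinity>"
    by (simp add: Lp_space_iff)
  obtain z where z: "z \<in> \<Omega>" "fst z \<noteq> 0" using test_point .
  define c where "c = norm (monomial2 \<alpha> z)"
  have c: "0 < c" using z snd_nonzero[OF z(1)] by (simp add: c_def monomial2_def)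
  define q where "q = (2 * real m + 2 * real n) / r"
  obtain \<tau> where \<tau>: "0 < \<tau>" "\<tau> \<le> 1" "norm (monomial2 \<alpha> (dil \<tau> z)) * \<tau> powr q \<le> c / 2"
    using decay[OF hol r_ge_1 fin, of "{z}" "c / 2"] z(1) c unfolding q_def
    by (metis compact_sing empty_subsetI half_gt_zero insert_subset order_refl singletonI)
  have "\<not> real_of_int (weight \<alpha>) + q \<le> 0"
  proof
    assume "real_of_int (weight \<alpha>) + q \<le> 0"
    then have "1 \<le> \<tau> powr (real_of_int (weight \<alpha>) + q)"
      using \<tau> powr_mono'[of "real_of_int (weight \<alpha>) + q" 0 \<tau>] by simp
    then have "c \<le> c * \<tau> powr (real_of_int (weight \<alpha>) + q)"
      using c by simp
    also have "\<dots> = norm (monomial2 \<alpha> (dil \<tau> z)) * \<tau> powr q"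
      using \<tau> by (simp add: norm_monomial2_dil c_def powr_add)
    finally show False using \<tau> c by simp
  qed
  moreover have "q \<le> 1 - real_of_int k"
    using lower_threshold r_ge_1 by (simp add: q_def field_simps)
  ultimately have "k - 1 < weight \<alpha>" by linarith
  then show "\<alpha> \<in> S" using fst_nonneg_if_holomorphic2[OF hol] by (simp add: S_def)
qed

text \<open>\<open>base a\<close> is the ceiling of \<open>(k - n a) / m\<close>, the least exponent of \<open>z\<^sub>2\<close> allowed next to \<open>z\<^sub>1\<^sup>a\<close>.\<close>

definition base :: "nat \<Rightarrow> int"
  where "base a = - ((int n * int a - k) div int m)"

text \<open>Parametrizes \<open>S\<close> by pairs of naturals: the power of \<open>z_1\<close>, and
  the height of the power of \<open>z_2\<close> above its least value. Unordered sums over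
  \<open>S\<close> thereby become iterated power series.\<close>

definition idx :: "nat \<times> nat \<Rightarrow> int \<times> int"
  where "idx p = (int (fst p), base (fst p) + int (snd p))"

lemma base_le_iff: "base a \<le> b \<longleftrightarrow> k \<le> int n * int a + int m * b"
proof -
  have le: "x \<le> y div int m \<longleftrightarrow> x * int m \<le> y" for x y :: int
  proof
    assume "x \<le> y div int m"
    then have "x * int m \<le> y div int m * int m"
      by (rule mult_right_mono) simp
    also have "\<dots> \<le> y"
      using m_pos div_mult_mod_eq[of y "int m"] pos_mod_sign[of "int m" y] by linarith
    finally show "x * int m \<le> y" .
  next
    assume "x * int m \<le> y"
    also have "y < y div int m * int m + int m"
      using m_pos div_mult_mod_eq[of y "int m"] pos_mod_bound[of "int m" y] by linarith
    also have "\<dots> = (y div int m + 1) * int m"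
      by (simp add: distrib_right)
    finally show "x \<le> y div int m"
      using m_pos by (simp add: mult_less_cancel_right)
  qed
  show ?thesis
    using le[of "- b" "int n * int a - k"] by (simp add: base_def mult.commute) linarith
qed

lemma bij_idx: "bij_betw idx UNIV S"
  unfolding bij_betw_def
proof
  show "inj idx" by (auto simp: inj_on_def idx_def)
  show "range idx = S"
  proof
    show "range idx \<subseteq> S"
      by (auto simp: idx_def S_def weight_def base_le_iff[symmetric])
    show "S \<subseteq> range idx"
    proof
      fix \<alpha> assume "\<alpha> \<in> S"
      then have "0 \<le> fst \<alpha>" "base (nat (fst \<alpha>)) \<le> snd \<alpha>"
        by (auto simp: S_def weight_def base_le_iff)
      then have "\<alpha> = idx (nat (fst \<alpha>), nat (snd \<alpha> - base (nat (fst \<alpha>))))"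
        by (simp add: idx_def prod_eq_iff)
      then show "\<alpha> \<in> range idx" by blast
    qed
  qed
qed

lemma excess_idx: "fst p + snd p \<le> excess (idx p)"
proof -
  have "k \<le> int n * int (fst p) + int m * base (fst p)"
    using base_le_iff[of "fst p" "base (fst p)"] by simp
  moreover have "int (snd p) \<le> int m * int (snd p)"
    using m_pos mult_right_mono[of 1 "int m" "int (snd p)"] by simp
  ultimately show ?thesis
    by (simp add: excess_def idx_def weight_def algebra_simps)
qed

text \<open>By \<open>excess_idx\<close> the family is dominated by a product of two geometric
  series.\<close>

lemma summable_power_excess:
  fixes x :: real
  assumes "0 \<le> x" "x < 1"
  shows "(\<lambda>\<alpha>. x ^ excess \<alpha>) summable_on S"
proof -
  have "((\<lambda>i. x ^ i) has_sum 1 / (1 - x)) (UNIV :: nat set)"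
    using assms geometric_sums[of x] by (intro sums_nonneg_imp_has_sum) auto
  note geo = this
  have "(\<lambda>p. x ^ fst p * x ^ snd p) summable_on UNIV \<times> (UNIV :: nat set)"
  proof (rule summable_on_SigmaI)
    show "((\<lambda>l. x ^ fst (a, l) * x ^ snd (a, l)) has_sum x ^ a * (1 / (1 - x))) UNIV" for a :: nat
      using has_sum_cmult_right[OF geo, of "x ^ a"] by simp
    show "(\<lambda>a. x ^ a * (1 / (1 - x))) summable_on UNIV"
      by (rule has_sum_imp_summable[OF has_sum_cmult_left[OF geo]])
  qed (use assms in auto)
  then have "(\<lambda>p. x ^ excess (idx p)) summable_on UNIV"
    unfolding UNIV_Times_UNIV
    by (rule summable_on_comparison_test)
      (use assms in \<open>auto simp flip: power_add intro!: power_decreasing excess_idx\<close>)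
  then show ?thesis using summable_on_reindex_bij_betw[OF bij_idx, of "\<lambda>\<alpha>. x ^ excess \<alpha>"] by simp
qed

lemma countable_S: "countable S" by simp

lemma infinite_S: "infinite S"
  using bij_betw_finite[OF bij_idx] by (simp add: finite_prod)

end

section \<open>Norms of monomials and the kernel series\<close>

context sub_bergman
begin

definition kappa :: "int \<times> int \<Rightarrow> real"
  where "kappa \<alpha> = (Lp_norm \<Omega> 2 (monomial2 \<alpha>))\<^sup>2"

definition coeff_pairing :: "int \<times> int \<Rightarrow> (complex \<times> complex \<Rightarrow> complex) \<Rightarrow> complex"
  where "coeff_pairing \<alpha> f = (LINT w|lebesgue_on \<Omega>. cnj (monomial2 \<alpha> w) * f w)"

definition wL1 :: "(complex \<times> complex \<Rightarrow> complex) set"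
  where "wL1 = {f. f \<in> borel_measurable (lebesgue_on \<Omega>) \<and> integrable (lebesgue_on \<Omega>) (\<lambda>w. W w * norm (f w))}"

definition wint :: "(complex \<times> complex \<Rightarrow> complex) \<Rightarrow> real"
  where "wint f = (LINT w|lebesgue_on \<Omega>. W w * norm (f w))"

lemma square_integrable_monomial2:
  "\<alpha> \<in> S \<Longrightarrow> integrable (lebesgue_on \<Omega>) (\<lambda>z. (norm (monomial2 \<alpha> z))\<^sup>2)"
  using monomial2_in_Lp[of \<alpha> 2] square_threshold by (simp add: Lp_space_def)

lemma kappa_eq: "kappa \<alpha> = (LINT z|lebesgue_on \<Omega>. (norm (monomial2 \<alpha> z))\<^sup>2)"
  by (simp add: kappa_def Lp_norm_def powr_half_sqrt)

lemma rad_power: "z \<in> \<Omega> \<Longrightarrow> rad z ^ m * norm (snd z) ^ n = norm (fst z) ^ m"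
proof -
  assume z: "z \<in> \<Omega>"
  have s: "0 < norm (snd z)" using snd_nonzero[OF z] by simp
  then have "(norm (snd z) powr (real n / real m)) ^ m = norm (snd z) ^ n"
    using m_pos by (simp add: powr_powr flip: powr_realpow)
  then show ?thesis using s by (simp add: rad_def power_divide)
qed

text \<open>Since \<sigma> may be arbitrarily close to 1, division by \<open>kappa\<close> costs
  less than any prescribed geometric growth. The convergence of the kernel and the growth of the
  coefficients of a projection both rest on this.\<close>

lemma kappa_lower:
  assumes \<sigma>: "0 < \<sigma>" "\<sigma> < 1"
  obtains c where "0 < c" "\<And>\<alpha>. \<alpha> \<in> S \<Longrightarrow> c * \<sigma> ^ excess \<alpha> \<le> kappa \<alpha>"
proof -
  \<comment> \<open>\<open>kappa\<close> integrates the square of the modulus, hence the square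
    root.\<close>
  define s where "s = sqrt \<sigma>"
  have s: "0 < s" "s < 1" "s\<^sup>2 = \<sigma>" using \<sigma> by (auto simp: s_def)
  \<comment> \<open>Near the corner \<open>|z\<^sub>1| = |z\<^sub>2| = 1\<close> the moduli of the monomials decay as slowly as desired.\<close>
  define E where "E = {z :: complex \<times> complex. s ^ m * norm (snd z) ^ n < norm (fst z) ^ m}
    \<inter> {z. norm (fst z) ^ m < norm (snd z) ^ n} \<inter> {z. norm (snd z) < 1} \<inter> {z. s ^ m < norm (snd z)}"
  have "open E" unfolding E_def by (intro open_Int open_Collect_less continuous_intros)
  \<comment> \<open>\<open>y\<close> and \<open>c\<close> serve to show that \<open>E\<close> is
    nonempty: \<open>c * y ^ n\<close> lies strictly between \<open>s ^ m * y ^ n\<close> and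
    \<open>y ^ n\<close>, and \<open>x\<close> is its root of order \<open>m\<close>.\<close>
  obtain y where y: "s ^ m < y" "y < 1"
    using dense[of "s ^ m" 1] s m_pos by (auto simp: power_less_one_iff)
  obtain c where c: "s ^ m < c" "c < 1"
    using dense[of "s ^ m" 1] s m_pos by (auto simp: power_less_one_iff)
  have pos: "0 < s ^ m" using s by simp
  define x where "x = root m (c * y ^ n)"
  have y0: "0 < y" "0 < c" using pos y c by linarith+
  then have "0 \<le> x" "x ^ m = c * y ^ n" using m_pos by (auto simp: x_def real_root_pow_pos2)
  then have "(of_real x, of_real y) \<in> E"
    using y c y0 by (simp add: E_def)
  then obtain z0 \<delta> where \<delta>: "0 < \<delta>" "ball z0 \<delta> \<subseteq> E"
    using \<open>open E\<close> by (meson open_contains_ball)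
  have E: "z \<in> \<Omega>" "s \<le> rad z" "s \<le> norm (snd z) powr (1 / real m)" if "z \<in> E" for z
  proof -
    show z: "z \<in> \<Omega>" using that by (simp add: E_def mem_\<Omega>)
    have "s ^ m * norm (snd z) ^ n < rad z ^ m * norm (snd z) ^ n"
      using that rad_power[OF z] by (simp add: E_def)
    then have "s ^ m < rad z ^ m" by (simp add: mult_less_cancel_right)
    then show "s \<le> rad z" using rad_nonneg by (meson less_imp_le power_less_imp_less_base)
    have "(s ^ m) powr (1 / real m) \<le> norm (snd z) powr (1 / real m)"
      using that s by (intro powr_mono2) (auto simp: E_def)
    moreover have "(s ^ m) powr (1 / real m) = s"
      unfolding powr_realpow[OF s(1), symmetric] powr_powr using s(1) m_pos by simp
    ultimately show "s \<le> norm (snd z) powr (1 / real m)"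
      by (simp only:)
  qed
  define B where "B = ball z0 \<delta>"
  have B: "B \<subseteq> \<Omega>" "B \<in> sets (lebesgue_on \<Omega>)"
    using \<delta>(2) E(1) by (auto simp: B_def sets_restrict_space intro!: image_eqI[of _ _ "ball z0 \<delta>"])
  have mB: "measure (lebesgue_on \<Omega>) B = measure lebesgue B"
    using B by (simp add: measure_restrict_space)
  have fB: "emeasure (lebesgue_on \<Omega>) B < \<infinity>"
    using B emeasure_lborel_ball_finite[of z0 \<delta>] by (simp add: emeasure_restrict_space B_def)
  show ?thesis
  proof (rule that[of "measure lebesgue B"])
    show "0 < measure lebesgue B" using content_ball_pos[OF \<delta>(1), of z0] by (simp add: B_def)
    fix \<alpha> assume \<alpha>: "\<alpha> \<in> S"
    have "measure lebesgue B * \<sigma> ^ excess \<alpha> = (LINT z|lebesgue_on \<Omega>. indicator B z * \<sigma> ^ excess \<alpha>)"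
      using B mB by (simp add: Int_absorb2)
    also have "\<dots> \<le> (LINT z|lebesgue_on \<Omega>. (norm (monomial2 \<alpha> z))\<^sup>2)"
    proof (rule integral_mono[OF _ square_integrable_monomial2[OF \<alpha>]])
      show "integrable (lebesgue_on \<Omega>) (\<lambda>z. indicator B z * \<sigma> ^ excess \<alpha>)"
        using B fB by (intro integrable_mult_left integrable_real_indicator) auto
      fix z assume "z \<in> space (lebesgue_on \<Omega>)"
      then have z: "z \<in> \<Omega>" by simp
      show "indicator B z * \<sigma> ^ excess \<alpha> \<le> (norm (monomial2 \<alpha> z))\<^sup>2"
      proof (cases "z \<in> B")
        case True
        then have "z \<in> E" using \<delta> by (auto simp: B_def)
        have "1 * (s ^ nat (fst \<alpha>) * s ^ nat (weight \<alpha> - k)) \<le> norm (monomial2 \<alpha> z)"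
          unfolding norm_monomial2_eq[OF z \<alpha>]
          using W_ge_1[OF z] s E[OF \<open>z \<in> E\<close>] by (intro mult_mono power_mono) (auto simp: rad_nonneg)
        then have "s ^ excess \<alpha> \<le> norm (monomial2 \<alpha> z)"
          by (simp add: excess_def power_add)
        then have "(s ^ excess \<alpha>)\<^sup>2 \<le> (norm (monomial2 \<alpha> z))\<^sup>2"
          using s by (intro power_mono) auto
        moreover have "(s ^ excess \<alpha>)\<^sup>2 = \<sigma> ^ excess \<alpha>"
          using s by (metis power_mult mult.commute)
        ultimately show ?thesis using True by simp
      qed simp
    qed
    finally show "measure lebesgue B * \<sigma> ^ excess \<alpha> \<le> kappa \<alpha>" by (simp add: kappa_eq)
  qed
qed

lemma kappa_pos: "\<alpha> \<in> S \<Longrightarrow> 0 < kappa \<alpha>"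
proof -
  assume \<alpha>: "\<alpha> \<in> S"
  obtain c :: real where "0 < c" "c * (1/2) ^ excess \<alpha> \<le> kappa \<alpha>"
    using kappa_lower[of "1/2"] \<alpha> by (metis half_gt_zero_iff zero_less_one divide_less_eq_1_pos one_less_numeral_iff semiring_norm(76) zero_less_numeral)
  moreover have "0 < c * (1/2) ^ excess \<alpha>" using \<open>0 < c\<close> by simp
  ultimately show ?thesis by linarith
qed

lemma kernel_summable:
  assumes z: "z \<in> \<Omega>"
  shows "(\<lambda>\<alpha>. norm (monomial2 \<alpha> z) / kappa \<alpha>) summable_on S"
proof -
  \<comment> \<open>Half of the decay \<open>mag z ^ excess \<alpha>\<close> pays for the division
    by \<open>kappa \<alpha>\<close>; the other half keeps the series summable.\<close>
  define \<sigma> where "\<sigma> = sqrt (mag z)"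
  have \<sigma>: "0 < \<sigma>" "\<sigma> < 1" "mag z = \<sigma> * \<sigma>" using mag_bounds[OF z] by (auto simp: \<sigma>_def)
  obtain c where c: "0 < c" "\<And>\<alpha>. \<alpha> \<in> S \<Longrightarrow> c * \<sigma> ^ excess \<alpha> \<le> kappa \<alpha>"
    using kappa_lower[OF \<sigma>(1,2)] by metis
  have "(\<lambda>\<alpha>. W z / c * \<sigma> ^ excess \<alpha>) summable_on S"
    using \<sigma> by (intro summable_on_cmult_right summable_power_excess) auto
  then show ?thesis
  proof (rule summable_on_comparison_test)
    fix \<alpha> assume \<alpha>: "\<alpha> \<in> S"
    have "norm (monomial2 \<alpha> z) / kappa \<alpha> \<le> (W z * (\<sigma> * \<sigma>) ^ excess \<alpha>) / (c * \<sigma> ^ excess \<alpha>)"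
      using norm_monomial2_le[OF z \<alpha>] c(2)[OF \<alpha>] c(1) \<sigma> W_ge_1[OF z] by (intro frac_le) auto
    also have "\<dots> = W z / c * \<sigma> ^ excess \<alpha>"
      using \<sigma> by (simp add: power_mult_distrib)
    finally show "norm (monomial2 \<alpha> z) / kappa \<alpha> \<le> W z / c * \<sigma> ^ excess \<alpha>" .
    show "0 \<le> norm (monomial2 \<alpha> z) / kappa \<alpha>" using kappa_pos[OF \<alpha>] by simp
  qed
qed

lemma cnj_monomial2_measurable:
  "\<alpha> \<in> S \<Longrightarrow> (\<lambda>w. cnj (monomial2 \<alpha> w)) \<in> borel_measurable (lebesgue_on \<Omega>)"
  by (rule measurable_compose[OF monomial2_measurable borel_measurable_continuous_onI])
    (auto intro: continuous_intros)

lemma wL1_measurable: "f \<in> wL1 \<Longrightarrow> f \<in> borel_measurable (lebesgue_on \<Omega>)"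
  and wL1_integrable: "f \<in> wL1 \<Longrightarrow> integrable (lebesgue_on \<Omega>) (\<lambda>w. W w * norm (f w))"
  by (auto simp: wL1_def)

lemma pairing_integrable:
  assumes "f \<in> wL1" "\<alpha> \<in> S"
  shows "integrable (lebesgue_on \<Omega>) (\<lambda>w. cnj (monomial2 \<alpha> w) * f w)"
proof (rule Bochner_Integration.integrable_bound[OF wL1_integrable[OF assms(1)]])
  show "(\<lambda>w. cnj (monomial2 \<alpha> w) * f w) \<in> borel_measurable (lebesgue_on \<Omega>)"
    by (rule borel_measurable_times[OF cnj_monomial2_measurable[OF assms(2)] wL1_measurable[OF assms(1)]])
  show "AE w in lebesgue_on \<Omega>. norm (cnj (monomial2 \<alpha> w) * f w) \<le> norm (W w * norm (f w))"
    using norm_monomial2_le_W[OF _ assms(2)]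
    by (intro AE_I2) (auto simp: norm_mult abs_mult W_def intro!: mult_right_mono)
qed

lemma norm_coeff_pairing_le:
  assumes "f \<in> wL1" "\<alpha> \<in> S"
  shows "norm (coeff_pairing \<alpha> f) \<le> wint f"
  unfolding coeff_pairing_def wint_def
proof (rule Bochner_Integration.integral_norm_bound_integral[OF pairing_integrable[OF assms] wL1_integrable[OF assms(1)]])
  fix w assume "w \<in> space (lebesgue_on \<Omega>)"
  then show "norm (cnj (monomial2 \<alpha> w) * f w) \<le> W w * norm (f w)"
    using norm_monomial2_le_W[of w, OF _ assms(2)] by (auto simp: norm_mult intro!: mult_right_mono)
qed

text \<open>Domination by \<open>W\<close> bounds the term with index \<alpha> by a number depending
  on \<open>z\<close> and \<alpha> times the integrable function \<open>W * |f|\<close>. Sum and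
  integral can thus be interchanged although \<open>f\<close> may lie outside
  \<open>L^2\<close>.\<close>

lemma projection_has_sum:
  assumes f: "f \<in> wL1" and z: "z \<in> \<Omega>"
  shows "((\<lambda>\<alpha>. monomial2 \<alpha> z / of_real (kappa \<alpha>) * coeff_pairing \<alpha> f) has_sum
    sub_bergman_projection \<Omega> r f z) S"
proof -
  define F where "F \<alpha> w = monomial2 \<alpha> z * cnj (monomial2 \<alpha> w) / of_real (kappa \<alpha>) * f w" for \<alpha> w
  have "((\<lambda>\<alpha>. LINT w|lebesgue_on \<Omega>. F \<alpha> w) has_sum (LINT w|lebesgue_on \<Omega>. (\<Sum>\<^sub>\<infinity>\<alpha>\<in>S. F \<alpha> w))) S"
  proof (rule integral_infsum_dominated[OF countable_S infinite_S _ _ kernel_summable[OF z] _ wL1_integrable[OF f]])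
    fix \<alpha> assume \<alpha>: "\<alpha> \<in> S"
    show "F \<alpha> \<in> borel_measurable (lebesgue_on \<Omega>)"
      unfolding F_def
      by (intro borel_measurable_times borel_measurable_divide borel_measurable_const
          cnj_monomial2_measurable[OF \<alpha>] wL1_measurable[OF f])
    show "0 \<le> norm (monomial2 \<alpha> z) / kappa \<alpha>" using kappa_pos[OF \<alpha>] by simp
    fix w assume "w \<in> space (lebesgue_on \<Omega>)"
    then have "norm (monomial2 \<alpha> z) / kappa \<alpha> * norm (f w) * norm (monomial2 \<alpha> w)
        \<le> norm (monomial2 \<alpha> z) / kappa \<alpha> * norm (f w) * W w"
      using norm_monomial2_le_W[OF _ \<alpha>] kappa_pos[OF \<alpha>] by (intro mult_left_mono) auto
    then show "norm (F \<alpha> w) \<le> norm (monomial2 \<alpha> z) / kappa \<alpha> * (W w * norm (f w))"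
      using kappa_pos[OF \<alpha>] by (simp add: F_def norm_mult norm_divide mult_ac)
  qed (simp add: W_def)
  moreover have "(LINT w|lebesgue_on \<Omega>. F \<alpha> w) = monomial2 \<alpha> z / of_real (kappa \<alpha>) * coeff_pairing \<alpha> f" for \<alpha>
    unfolding coeff_pairing_def integral_mult_right_zero[symmetric]
    by (intro Bochner_Integration.integral_cong) (auto simp: F_def)
  moreover have "(LINT w|lebesgue_on \<Omega>. (\<Sum>\<^sub>\<infinity>\<alpha>\<in>S. F \<alpha> w)) = sub_bergman_projection \<Omega> r f z"
    unfolding sub_bergman_projection_def sub_bergman_kernel_def F_def
    by (intro Bochner_Integration.integral_cong refl)
      (simp only: infsum_cmult_left' monomial2_in_bergman_iff Collect_mem_eq kappa_def)
  ultimately show ?thesis by simp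
qed

lemma projection_bound:
  assumes z: "z \<in> \<Omega>"
  obtains C where "0 \<le> C" "\<And>f. f \<in> wL1 \<Longrightarrow> norm (sub_bergman_projection \<Omega> r f z) \<le> C * wint f"
proof (rule that)
  define b where "b \<alpha> = norm (monomial2 \<alpha> z) / kappa \<alpha>" for \<alpha>
  have b: "b summable_on S" unfolding b_def by (rule kernel_summable[OF z])
  have b0: "0 \<le> b \<alpha>" if "\<alpha> \<in> S" for \<alpha> using kappa_pos[OF that] by (simp add: b_def)
  show "0 \<le> infsum b S" by (rule infsum_nonneg[OF b0])
  fix f assume f: "f \<in> wL1"
  show "norm (sub_bergman_projection \<Omega> r f z) \<le> infsum b S * wint f"
  proof (rule norm_infsum_le[OF projection_has_sum[OF f z] has_sum_cmult_left[OF has_sum_infsum[OF b]]])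
    fix \<alpha> assume \<alpha>: "\<alpha> \<in> S"
    show "norm (monomial2 \<alpha> z / of_real (kappa \<alpha>) * coeff_pairing \<alpha> f) \<le> b \<alpha> * wint f"
      using norm_coeff_pairing_le[OF f \<alpha>] kappa_pos[OF \<alpha>]
      by (auto simp: norm_mult norm_divide b_def intro!: mult_left_mono divide_right_mono)
  qed
qed

section \<open>Linearity of the projection and continuity of point evaluation\<close>

lemma wL1_diff:
  assumes "f \<in> wL1" "g \<in> wL1"
  shows "(\<lambda>w. f w - g w) \<in> wL1"
proof -
  have m: "(\<lambda>w. f w - g w) \<in> borel_measurable (lebesgue_on \<Omega>)"
    using assms wL1_measurable by measurable
  have "integrable (lebesgue_on \<Omega>) (\<lambda>w. W w * norm (f w - g w))"
  proof (rule Bochner_Integration.integrable_bound[OF Bochner_Integration.integrable_add[OF wL1_integrable[OF assms(1)] wL1_integrable[OF assms(2)]]])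
    show "(\<lambda>w. W w * norm (f w - g w)) \<in> borel_measurable (lebesgue_on \<Omega>)"
      using m W_measurable by measurable
    have "W w * norm (f w - g w) \<le> W w * norm (f w) + W w * norm (g w)" for w
      unfolding distrib_left[symmetric] by (intro mult_left_mono norm_triangle_ineq4) (simp add: W_def)
    then show "AE w in lebesgue_on \<Omega>. norm (W w * norm (f w - g w)) \<le> norm (W w * norm (f w) + W w * norm (g w))"
      by (intro AE_I2) (simp add: W_def)
  qed
  then show ?thesis using m by (simp add: wL1_def)
qed

lemma projection_diff:
  assumes f: "f \<in> wL1" and g: "g \<in> wL1" and z: "z \<in> \<Omega>"
  shows "sub_bergman_projection \<Omega> r (\<lambda>w. f w - g w) z
    = sub_bergman_projection \<Omega> r f z - sub_bergman_projection \<Omega> r g z"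
proof -
  have *: "coeff_pairing \<alpha> (\<lambda>w. f w - g w) = coeff_pairing \<alpha> f - coeff_pairing \<alpha> g" if "\<alpha> \<in> S" for \<alpha>
    unfolding coeff_pairing_def right_diff_distrib
    by (rule Bochner_Integration.integral_diff[OF pairing_integrable[OF f that] pairing_integrable[OF g that]])
  have "((\<lambda>\<alpha>. monomial2 \<alpha> z / of_real (kappa \<alpha>) * coeff_pairing \<alpha> f
      - monomial2 \<alpha> z / of_real (kappa \<alpha>) * coeff_pairing \<alpha> g) has_sum
    (sub_bergman_projection \<Omega> r f z - sub_bergman_projection \<Omega> r g z)) S"
    using has_sum_add[OF projection_has_sum[OF f z] has_sum_cmult_right[OF projection_has_sum[OF g z], of "-1"]]
    by simp
  then have "((\<lambda>\<alpha>. monomial2 \<alpha> z / of_real (kappa \<alpha>) * coeff_pairing \<alpha> (\<lambda>w. f w - g w)) has_sum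
    (sub_bergman_projection \<Omega> r f z - sub_bergman_projection \<Omega> r g z)) S"
    by (rule has_sum_cong[THEN iffD1, rotated]) (simp add: * right_diff_distrib)
  then show ?thesis
    using projection_has_sum[OF wL1_diff[OF f g] z] has_sum_unique by blast
qed

text \<open>The mean value inequality on a ball inside the domain. The weight can be inserted
  because \<open>k \<le> 0\<close> makes \<open>W\<close> at least 1.\<close>

lemma evaluation_bound:
  assumes z: "z \<in> \<Omega>"
  obtains C where "0 \<le> C"
    "\<And>h. h \<in> wL1 \<Longrightarrow> holomorphic2_on h \<Omega> \<Longrightarrow> norm (h z) \<le> C * wint h"
proof -
  obtain \<delta> where \<delta>: "0 < \<delta>" "ball z \<delta> \<subseteq> \<Omega>"
    using open_\<Omega> z by (meson open_contains_ball)
  define V where "V = measure lborel (ball (0 :: complex \<times> complex) \<delta>)"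
  have V: "emeasure lborel (ball (0 :: complex \<times> complex) \<delta>) = ennreal V" "0 < V"
    unfolding V_def using \<delta>(1) content_ball_pos[OF \<delta>(1)] emeasure_lborel_ball_finite[of "0 :: complex \<times> complex" \<delta>]
    by (auto intro: emeasure_eq_ennreal_measure)
  show ?thesis
  proof (rule that[of "1 / V"])
    show "0 \<le> 1 / V" using V by simp
    fix h assume h: "h \<in> wL1" "holomorphic2_on h \<Omega>"
    have "ennreal (norm (h z) * V) \<le> (\<integral>\<^sup>+x\<in>ball z \<delta>. ennreal (norm (h x)) \<partial>lborel)"
      using holomorphic2_mean_value_le[OF h(2) \<delta>(2)] V by (simp add: ennreal_mult)
    also have "\<dots> \<le> (\<integral>\<^sup>+x\<in>\<Omega>. ennreal (W x * norm (h x)) \<partial>lborel)"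
    proof (rule nn_integral_mono)
      fix x
      have "norm (h x) \<le> W x * norm (h x)" if "x \<in> \<Omega>"
        using mult_right_mono[OF W_ge_1[OF that], of "norm (h x)"] by simp
      then show "ennreal (norm (h x)) * indicator (ball z \<delta>) x \<le> ennreal (W x * norm (h x)) * indicator \<Omega> x"
        using \<delta>(2) by (auto simp: indicator_def intro!: ennreal_leI)
    qed
    also have "\<dots> = (\<integral>\<^sup>+x. ennreal (W x * norm (h x)) \<partial>lebesgue_on \<Omega>)"
      by (simp add: nn_integral_lebesgue_on)
    also have "\<dots> = ennreal (wint h)"
      unfolding wint_def
      by (rule nn_integral_eq_integral[OF wL1_integrable[OF h(1)]]) (simp add: W_def)
    finally have "norm (h z) * V \<le> wint h"
      by (subst (asm) ennreal_le_iff) (auto simp: wint_def W_def intro!: Bochner_Integration.integral_nonneg)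
    then show "norm (h z) \<le> 1 / V * wint h" using V by (simp add: field_simps)
  qed
qed

end

section \<open>Approximation by dilations\<close>

text \<open>A crude Young inequality with constants 1: comparing \<open>x\<close> with
  \<open>y powr (p - 1)\<close> shows that the product is at most one of the two powers.\<close>

lemma young_product:
  fixes x y p p' :: real
  assumes "0 \<le> x" "0 \<le> y" "1 < p" "1 / p + 1 / p' = 1"
  shows "x * y \<le> x powr p' + y powr p"
proof -
  have p': "p' = p / (p - 1)" "1 < p'"
  proof -
    have "p' \<noteq> 0" using assms by auto
    have "1 / p' = (p - 1) / p" using assms by (simp add: field_simps)
    then show eq: "p' = p / (p - 1)" using assms \<open>p' \<noteq> 0\<close> by (simp add: field_simps)
    show "1 < p'" unfolding eq using assms by (simp add: field_simps)
  qed
  consider "x = 0 \<or> y = 0" | "0 < x" "0 < y" using assms by linarith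
  then show ?thesis
  proof cases
    case 2
    show ?thesis
    proof (cases "x \<le> y powr (p - 1)")
      case True
      then have "x * y \<le> y powr (p - 1) * y powr 1" using 2 by (intro mult_mono) auto
      also have "\<dots> = y powr p" by (subst powr_add[symmetric]) simp
      finally show ?thesis using powr_ge_zero[of x p'] by linarith
    next
      case False
      then have "(y powr (p - 1)) powr (1 / (p - 1)) \<le> x powr (1 / (p - 1))"
        using assms by (intro powr_mono2) auto
      then have "y \<le> x powr (1 / (p - 1))" using 2 assms by (simp add: powr_powr)
      then have "x * y \<le> x powr 1 * x powr (1 / (p - 1))" using 2 by (intro mult_mono) auto
      also have "\<dots> = x powr p'" by (subst powr_add[symmetric]) (use assms in \<open>simp add: p' field_simps\<close>)
      finally show ?thesis using powr_ge_zero[of y p] by linarith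
    qed
  qed auto
qed

lemma norm_diff_powr_le:
  fixes a b :: complex
  assumes "0 < p"
  shows "norm (a - b) powr p \<le> 2 powr p * (norm a powr p + norm b powr p)"
proof -
  have "norm (a - b) \<le> 2 * max (norm a) (norm b)"
    using norm_triangle_ineq4[of a b] by linarith
  then have "norm (a - b) powr p \<le> (2 * max (norm a) (norm b)) powr p"
    using assms by (intro powr_mono2) auto
  also have "\<dots> = 2 powr p * max (norm a) (norm b) powr p"
    by (simp add: powr_mult)
  also have "\<dots> \<le> 2 powr p * (norm a powr p + norm b powr p)"
    by (intro mult_left_mono) (auto simp: max_def)
  finally show ?thesis .
qed

text \<open>Pointwise convergence together with asymptotically no gain of norm lets Scheffe's lemma
  act on the powers \<open>G j\<close>. This yields convergence of \<open>|F j|^p\<close> in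
  \<open>L^1\<close>, from which that of the differences is recovered by dominated
  convergence.\<close>

lemma Lp_tendsto_of_norm_le:
  fixes F :: "nat \<Rightarrow> 'a \<Rightarrow> complex" and f :: "'a \<Rightarrow> complex"
  assumes p: "0 < p"
    and meas[measurable]: "\<And>j. F j \<in> borel_measurable M" "f \<in> borel_measurable M"
    and int: "\<And>j. integrable M (\<lambda>x. norm (F j x) powr p)" "integrable M (\<lambda>x. norm (f x) powr p)"
    and lim: "\<And>x. x \<in> space M \<Longrightarrow> (\<lambda>j. F j x) \<longlonglongrightarrow> f x"
    and le: "\<And>j. (LINT x|M. norm (F j x) powr p) \<le> c j * (LINT x|M. norm (f x) powr p)"
    and c: "c \<longlonglongrightarrow> 1"
  shows "(\<lambda>j. LINT x|M. norm (F j x - f x) powr p) \<longlonglongrightarrow> 0"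
proof -
  define G where "G j x = norm (F j x) powr p" for j x
  define g where "g x = norm (f x) powr p" for x
  have [measurable]: "G j \<in> borel_measurable M" "g \<in> borel_measurable M" for j
    by (simp_all add: G_def[abs_def] g_def[abs_def])
  have int': "integrable M (G j)" "integrable M g" for j
    using int by (simp_all add: G_def[abs_def] g_def[abs_def])
  have G0: "0 \<le> G j x" "0 \<le> g x" for j x by (simp_all add: G_def g_def)
  have limG: "(\<lambda>j. G j x) \<longlonglongrightarrow> g x" if "x \<in> space M" for x
    unfolding G_def g_def using p by (intro tendsto_powr' tendsto_norm lim[OF that] tendsto_const) auto
  have nnG: "(\<integral>\<^sup>+x. norm (G j x) \<partial>M) = ennreal (LINT x|M. G j x)" for j
    using nn_integral_eq_integral[OF int'(1)] G0 by simp
  have nng: "(\<integral>\<^sup>+x. norm (g x) \<partial>M) = ennreal (LINT x|M. g x)"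
    using nn_integral_eq_integral[OF int'(2)] G0 by simp
  have "(\<lambda>j. \<integral>\<^sup>+x. norm (G j x - g x) \<partial>M) \<longlonglongrightarrow> 0"
  proof (rule Scheffe_lemma1[OF int'])
    show "AE x in M. (\<lambda>j. G j x) \<longlonglongrightarrow> g x" using limG by auto
    have "(\<lambda>j. c j * (LINT x|M. g x)) \<longlonglongrightarrow> 1 * (LINT x|M. g x)"
      by (intro tendsto_intros c)
    then have L: "(\<lambda>j. ennreal (c j * (LINT x|M. g x))) \<longlonglongrightarrow> ennreal (LINT x|M. g x)"
      by (intro tendsto_ennrealI) simp
    have "limsup (\<lambda>j. ennreal (LINT x|M. G j x)) \<le> limsup (\<lambda>j. ennreal (c j * (LINT x|M. g x)))"
      using le by (intro Limsup_mono always_eventually) (auto simp: G_def g_def intro!: ennreal_leI)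
    also have "\<dots> = ennreal (LINT x|M. g x)"
      by (rule lim_imp_Limsup[OF trivial_limit_sequentially L])
    finally show "limsup (\<lambda>j. \<integral>\<^sup>+x. norm (G j x) \<partial>M) \<le> (\<integral>\<^sup>+x. norm (g x) \<partial>M)"
      by (simp only: nnG nng)
  qed
  moreover have intd: "integrable M (\<lambda>x. norm (G j x - g x))" for j
    using int' by (intro integrable_norm Bochner_Integration.integrable_diff)
  ultimately have "(\<lambda>j. ennreal (LINT x|M. norm (G j x - g x))) \<longlonglongrightarrow> ennreal 0"
    by (simp add: nn_integral_eq_integral)
  then have L1: "(\<lambda>j. LINT x|M. norm (G j x - g x)) \<longlonglongrightarrow> 0"
    by (subst (asm) tendsto_ennreal_iff) (auto intro!: Bochner_Integration.integral_nonneg)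
  \<comment> \<open>The part of \<open>|F j - f|^p\<close> that is not covered by
    \<open>|G j - g|\<close>, already small in \<open>L^1\<close>. It is dominated by a multiple of
    \<open>g\<close> independent of \<open>j\<close>, although the \<open>F j\<close> have no common
    majorant.\<close>
  define y where "y j x = max 0 (norm (F j x - f x) powr p - 2 powr p * norm (G j x - g x))" for j x
  have [measurable]: "y j \<in> borel_measurable M" for j
    unfolding y_def by measurable
  have diff_le: "norm (F j x - f x) powr p \<le> 2 powr p * norm (G j x - g x) + 2 powr p * (2 * g x)" for j x
  proof -
    have "norm (F j x - f x) powr p \<le> 2 powr p * (G j x + g x)"
      using norm_diff_powr_le[OF p] by (simp add: G_def g_def)
    also have "\<dots> \<le> 2 powr p * (norm (G j x - g x) + 2 * g x)"
      by (intro mult_left_mono) auto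
    finally show ?thesis by (simp add: distrib_left)
  qed
  have y_le: "norm (y j x) \<le> 2 powr p * (2 * g x)" for j x
    using diff_le[of j x] G0(2)[of x] by (simp add: y_def)
  have "(\<lambda>j. LINT x|M. y j x) \<longlonglongrightarrow> (LINT x|M. 0)"
  proof (rule integral_dominated_convergence[where w = "\<lambda>x. 2 powr p * (2 * g x)"])
    show "integrable M (\<lambda>x. 2 powr p * (2 * g x))" using int' by simp
    show "AE x in M. norm (y j x) \<le> 2 powr p * (2 * g x)" for j
      by (intro AE_I2 y_le)
    show "AE x in M. (\<lambda>j. y j x) \<longlonglongrightarrow> 0"
    proof (rule AE_I2)
      fix x assume x: "x \<in> space M"
      have 1: "(\<lambda>j. norm (F j x - f x) powr p) \<longlonglongrightarrow> norm (f x - f x) powr p"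
        using p by (intro tendsto_powr' tendsto_norm tendsto_diff lim[OF x] tendsto_const) auto
      have 2: "(\<lambda>j. norm (G j x - g x)) \<longlonglongrightarrow> norm (g x - g x)"
        by (intro tendsto_norm tendsto_diff limG[OF x] tendsto_const)
      have "(\<lambda>j. y j x) \<longlonglongrightarrow> max 0 (norm (f x - f x) powr p - 2 powr p * norm (g x - g x))"
        unfolding y_def by (intro tendsto_max tendsto_diff tendsto_mult tendsto_const 1 2)
      then show "(\<lambda>j. y j x) \<longlonglongrightarrow> 0" by simp
    qed
  qed auto
  then have Y: "(\<lambda>j. (LINT x|M. y j x) + 2 powr p * (LINT x|M. norm (G j x - g x))) \<longlonglongrightarrow> 0 + 2 powr p * 0"
    by (intro tendsto_intros L1) simp
  have inty: "integrable M (y j)" for j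
    by (rule Bochner_Integration.integrable_bound[where f = "\<lambda>x. 2 powr p * (2 * g x)"])
      (use int' in \<open>auto intro!: AE_I2 order_trans[OF y_le[unfolded real_norm_def]]\<close>)
  show ?thesis
  proof (rule tendsto_sandwich[OF _ _ tendsto_const])
    show "\<forall>\<^sub>F j in sequentially. 0 \<le> (LINT x|M. norm (F j x - f x) powr p)"
      by (intro always_eventually allI Bochner_Integration.integral_nonneg) auto
    show "(\<lambda>j. (LINT x|M. y j x) + 2 powr p * (LINT x|M. norm (G j x - g x))) \<longlonglongrightarrow> 0"
      using Y by simp
    show "\<forall>\<^sub>F j in sequentially. (LINT x|M. norm (F j x - f x) powr p)
        \<le> (LINT x|M. y j x) + 2 powr p * (LINT x|M. norm (G j x - g x))"
    proof (intro always_eventually allI)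
      fix j
      have I: "integrable M (\<lambda>x. y j x + 2 powr p * norm (G j x - g x))"
        using inty intd by simp
      have "(LINT x|M. norm (F j x - f x) powr p) \<le> (LINT x|M. y j x + 2 powr p * norm (G j x - g x))"
        by (rule integral_mono'[OF I]) (auto simp: y_def)
      also have "\<dots> = (LINT x|M. y j x) + 2 powr p * (LINT x|M. norm (G j x - g x))"
        using inty intd by simp
      finally show "(LINT x|M. norm (F j x - f x) powr p) \<le> \<dots>" .
    qed
  qed
qed

section \<open>Comparison of the weighted \<open>L^1\<close> norm with the \<open>L^p\<close>
  norm\<close>

context sub_bergman
begin

lemma weighted_young:
  fixes h :: "complex \<times> complex \<Rightarrow> complex"
  assumes "1 < p" "1 / p + 1 / p' = 1" "0 < \<delta>"
  shows "W z * norm (h z) \<le> \<delta> powr p' * W z powr p' + \<delta> powr (- p) * norm (h z) powr p"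
proof -
  have "(\<delta> * W z) * (norm (h z) / \<delta>) \<le> (\<delta> * W z) powr p' + (norm (h z) / \<delta>) powr p"
    using assms by (intro young_product) (auto simp: W_def)
  then show ?thesis
    using assms(3) by (simp add: powr_mult powr_divide powr_minus field_simps)
qed

lemma integrable_weighted_young:
  assumes "1 < p" "1 / p + 1 / p' = 1" "- real_of_int k * p' < 2 * real m + 2 * real n"
    and "h \<in> Lp_space \<Omega> p"
  shows "integrable (lebesgue_on \<Omega>) (\<lambda>z. \<delta> powr p' * W z powr p' + \<delta> powr (- p) * norm (h z) powr p)"
proof -
  have "0 < p'"
    using assms(1,2) by (smt (verit) divide_le_0_1_iff divide_less_eq_1_pos)
  then show ?thesis
    using integrable_W_powr[OF _ assms(3)] assms(4) by (auto simp: Lp_space_def)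
qed

lemma Lp_subset_wL1:
  assumes "1 < p" "1 / p + 1 / p' = 1" "- real_of_int k * p' < 2 * real m + 2 * real n"
    and h: "h \<in> Lp_space \<Omega> p"
  shows "h \<in> wL1"
proof -
  have m: "h \<in> borel_measurable (lebesgue_on \<Omega>)" using h by (simp add: Lp_space_def)
  have "integrable (lebesgue_on \<Omega>) (\<lambda>z. W z * norm (h z))"
  proof (rule Bochner_Integration.integrable_bound[OF integrable_weighted_young[OF assms, of 1]])
    show "(\<lambda>z. W z * norm (h z)) \<in> borel_measurable (lebesgue_on \<Omega>)"
      by (intro borel_measurable_times W_measurable measurable_compose[OF m borel_measurable_norm])
    show "AE z in lebesgue_on \<Omega>. norm (W z * norm (h z))
        \<le> norm (1 powr p' * W z powr p' + 1 powr (- p) * norm (h z) powr p)"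
      using weighted_young[OF assms(1,2) zero_less_one, of _ h] by (intro AE_I2) (simp add: W_def)
  qed
  then show ?thesis using m by (simp add: wL1_def)
qed

lemma wint_small:
  assumes conj: "1 < p" "1 / p + 1 / p' = 1" "- real_of_int k * p' < 2 * real m + 2 * real n"
    and "0 < e"
  obtains d where "0 < d"
    "\<And>h. h \<in> Lp_space \<Omega> p \<Longrightarrow> (LINT z|lebesgue_on \<Omega>. norm (h z) powr p) < d \<Longrightarrow> wint h < e"
proof -
  define A where "A = (LINT z|lebesgue_on \<Omega>. W z powr p')"
  have A: "0 \<le> A" by (simp add: A_def)
  have p': "0 < p'"
    using assms(1,2) by (smt (verit) divide_le_0_1_iff divide_less_eq_1_pos)
  \<comment> \<open>\<delta> first makes the term with \<open>W\<close> at most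
    \<open>e / 2\<close>, uniformly in \<open>h\<close>; the smallness required of the integral of
    \<open>|h|^p\<close> then absorbs the factor \<open>\<delta> powr (- p)\<close>.\<close>
  define \<delta> where "\<delta> = (e / (2 * (A + 1))) powr (1 / p')"
  have \<delta>: "0 < \<delta>" using A \<open>0 < e\<close> by (simp add: \<delta>_def)
  have "\<delta> powr p' = e / (2 * (A + 1))"
    using A \<open>0 < e\<close> p' by (simp add: \<delta>_def powr_powr)
  then have "\<delta> powr p' * (A + 1) = e / 2"
    using A by (simp add: field_simps)
  then have half: "\<delta> powr p' * A \<le> e / 2"
    using mult_left_mono[of A "A + 1" "\<delta> powr p'"] by simp
  show ?thesis
  proof (rule that[of "e / 2 * \<delta> powr p"])
    show "0 < e / 2 * \<delta> powr p" using \<delta> \<open>0 < e\<close> by simp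
    fix h assume h: "h \<in> Lp_space \<Omega> p"
      and lt: "(LINT z|lebesgue_on \<Omega>. norm (h z) powr p) < e / 2 * \<delta> powr p"
    have "wint h \<le> (LINT z|lebesgue_on \<Omega>. \<delta> powr p' * W z powr p' + \<delta> powr (- p) * norm (h z) powr p)"
      unfolding wint_def
      by (rule integral_mono[OF wL1_integrable[OF Lp_subset_wL1[OF conj h]] integrable_weighted_young[OF conj h]])
        (rule weighted_young[OF conj(1,2) \<delta>])
    also have "\<dots> = \<delta> powr p' * A + \<delta> powr (- p) * (LINT z|lebesgue_on \<Omega>. norm (h z) powr p)"
      unfolding A_def using integrable_W_powr[OF p' conj(3)] h by (simp add: Lp_space_def)
    also have "\<dots> < e / 2 + \<delta> powr (- p) * (e / 2 * \<delta> powr p)"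
      using half lt \<delta> by (intro add_le_less_mono mult_strict_left_mono) auto
    also have "\<delta> powr (- p) * (e / 2 * \<delta> powr p) = e / 2"
      using \<delta> by (simp add: powr_minus)
    finally show "wint h < e" by simp
  qed
qed

section \<open>Dilations of Bergman functions\<close>

definition shrink :: "real \<Rightarrow> complex \<times> complex \<Rightarrow> complex \<times> complex"
  where "shrink t = scale2 (of_real t ^ Suc n) (of_real t ^ m)"

text \<open>The factor \<open>t powr (-k)\<close> makes the multiplier \<open>t ^ excess \<alpha>\<close> of a monomial in \<open>A\<^sup>r\<close> at most 1.\<close>

definition shrunk :: "real \<Rightarrow> (complex \<times> complex \<Rightarrow> complex) \<Rightarrow> complex \<times> complex \<Rightarrow> complex"
  where "shrunk t f z = of_real t ^ nat (- k) * f (shrink t z)"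

lemma shrink_mem: "0 < t \<Longrightarrow> t \<le> 1 \<Longrightarrow> z \<in> \<Omega> \<Longrightarrow> shrink t z \<in> \<Omega>"
proof -
  assume t: "0 < t" "t \<le> 1" and z: "z \<in> \<Omega>"
  have "t ^ Suc n * norm (fst z) \<le> t ^ n * norm (fst z)"
    using t by (intro mult_right_mono power_decreasing) auto
  then have "(t ^ Suc n * norm (fst z)) ^ m \<le> (t ^ n * norm (fst z)) ^ m"
    using t by (intro power_mono) auto
  moreover have "norm (fst (shrink t z)) = t ^ Suc n * norm (fst z)" "norm (snd (shrink t z)) = norm (snd (dil t z))"
    "norm (fst (dil t z)) = t ^ n * norm (fst z)"
    using t by (simp_all add: shrink_def dil_def scale2_def norm_mult norm_power)
  ultimately show ?thesis
    using dil_mem[OF t z] by (simp add: mem_\<Omega>)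
qed

lemma shrunk_monomial2:
  assumes "0 < t" "\<alpha> \<in> S"
  shows "shrunk t (monomial2 \<alpha>) z = of_real t ^ excess \<alpha> * monomial2 \<alpha> z"
proof -
  have "of_real t ^ nat (- k) * ((of_real t ^ Suc n) powi fst \<alpha> * (of_real t ^ m) powi snd \<alpha> :: complex)
      = of_real t powi (- k) * (of_real t powi (int (Suc n) * fst \<alpha>) * of_real t powi (int m * snd \<alpha>))"
  proof -
    have "of_real t ^ nat (- k) = (of_real t powi (- k) :: complex)"
      using k_nonpos by (simp add: power_int_def)
    then show ?thesis by (simp only: power_int_mult power_int_of_nat)
  qed
  also have "\<dots> = of_real t powi (- k + (int (Suc n) * fst \<alpha> + int m * snd \<alpha>))"
  proof -
    have "(of_real t :: complex) \<noteq> 0" using assms by simp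
    then show ?thesis by (simp only: power_int_add simp_thms)
  qed
  also have "- k + (int (Suc n) * fst \<alpha> + int m * snd \<alpha>) = int (excess \<alpha>)"
    using assms(2) by (simp add: S_def excess_def weight_def algebra_simps)
  finally show ?thesis
    by (simp add: shrunk_def shrink_def monomial2_scale2 mult.assoc)
qed

lemma holomorphic2_on_shrunk:
  assumes "holomorphic2_on f \<Omega>" "0 < t" "t \<le> 1"
  shows "holomorphic2_on (shrunk t f) \<Omega>"
  unfolding shrunk_def[abs_def] shrink_def
  by (rule holomorphic2_on_scale2[OF assms(1)]) (use shrink_mem[OF assms(2,3)] in \<open>simp add: shrink_def\<close>)

text \<open>Because \<open>k \<le> 0\<close> the scalar factor is at most 1, which leaves the
  inverse Jacobian of \<open>shrink t\<close>. That constant is at least 1 but tends to 1 with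
  \<open>t\<close>, as \<open>Lp_tendsto_of_norm_le\<close> demands.\<close>

lemma shrunk_norm_le:
  assumes f: "f \<in> bergman \<Omega> p" and p: "0 < p" and t: "0 < t" "t \<le> 1"
  shows "shrunk t f \<in> Lp_space \<Omega> p"
    and "(LINT z|lebesgue_on \<Omega>. norm (shrunk t f z) powr p)
      \<le> inverse ((t ^ Suc n * t ^ m)\<^sup>2) * (LINT z|lebesgue_on \<Omega>. norm (f z) powr p)"
proof -
  have hol: "holomorphic2_on f \<Omega>" and Lp: "f \<in> Lp_space \<Omega> p" using f by (auto simp: bergman_def)
  define G where "G z = ennreal (norm (indicat_real \<Omega> z *\<^sub>R f z) powr p)" for z
  have G[measurable]: "G \<in> borel_measurable borel"
    unfolding G_def
    by (intro measurable_compose[OF borel_measurable_continuous_on_indicator[OF sets_\<Omega> holomorphic2_on_imp_continuous_on[OF hol]]]) auto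
  have G_eq: "G z = ennreal (norm (f z) powr p) * indicator \<Omega> z" for z
    using p by (auto simp: G_def indicator_def)
  define I where "I = (LINT z|lebesgue_on \<Omega>. norm (f z) powr p)"
  have I: "(\<integral>\<^sup>+z. G z \<partial>lborel) = ennreal I"
    using nn_integral_eq_integral[of "lebesgue_on \<Omega>" "\<lambda>z. norm (f z) powr p"] Lp
    by (simp add: Lp_space_def G_eq nn_integral_lebesgue_on I_def)
  define c where "c = (t ^ Suc n * t ^ m)\<^sup>2"
  have c: "0 < c" using t by (simp add: c_def)
  have "ennreal I = ennreal c * (\<integral>\<^sup>+z. G (shrink t z) \<partial>lborel)"
    using nn_integral_scale2[OF G, of "of_real t ^ Suc n" "of_real t ^ m"] t
    unfolding I shrink_def c_def by (simp add: norm_power norm_mult)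
  then have "ennreal (inverse c) * ennreal I = ennreal (inverse c * c) * (\<integral>\<^sup>+z. G (shrink t z) \<partial>lborel)"
    using c ennreal_mult[of "inverse c" c] by (simp only: mult.assoc less_imp_le inverse_nonnegative_iff_nonnegative)
  then have J: "(\<integral>\<^sup>+z. G (shrink t z) \<partial>lborel) = ennreal (inverse c * I)"
    using c by (simp add: ennreal_mult' flip: ennreal_mult'')
  have le: "(\<integral>\<^sup>+z\<in>\<Omega>. ennreal (norm (shrunk t f z) powr p) \<partial>lborel) \<le> (\<integral>\<^sup>+z. G (shrink t z) \<partial>lborel)"
  proof (rule nn_integral_mono)
    fix z
    show "ennreal (norm (shrunk t f z) powr p) * indicator \<Omega> z \<le> G (shrink t z)"
    proof (cases "z \<in> \<Omega>")
      case True
      have "t ^ nat (- k) \<le> 1" using t by (simp add: power_le_one)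
      then have "norm (shrunk t f z) \<le> norm (f (shrink t z))"
        using t by (simp add: shrunk_def norm_mult norm_power mult_left_le_one_le)
      then show ?thesis
        using True shrink_mem[OF t True] p by (simp add: G_eq powr_mono2 ennreal_leI)
    qed simp
  qed
  have meas: "shrunk t f \<in> borel_measurable (lebesgue_on \<Omega>)"
    by (rule measurable_lebesgue_on_continuous[OF open_\<Omega> holomorphic2_on_imp_continuous_on[OF holomorphic2_on_shrunk[OF hol t]]])
  show L: "shrunk t f \<in> Lp_space \<Omega> p"
    using le meas unfolding J by (simp add: Lp_space_iff le_less_trans[OF _ ennreal_less_top])
  have "ennreal (LINT z|lebesgue_on \<Omega>. norm (shrunk t f z) powr p)
      = (\<integral>\<^sup>+z\<in>\<Omega>. ennreal (norm (shrunk t f z) powr p) \<partial>lborel)"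
    using nn_integral_eq_integral[of "lebesgue_on \<Omega>" "\<lambda>z. norm (shrunk t f z) powr p"] L
    by (simp add: Lp_space_def nn_integral_lebesgue_on)
  then have "ennreal (LINT z|lebesgue_on \<Omega>. norm (shrunk t f z) powr p) \<le> ennreal (inverse c * I)"
    using le J by simp
  moreover have "0 \<le> inverse c * I" using c by (simp add: I_def)
  ultimately show "(LINT z|lebesgue_on \<Omega>. norm (shrunk t f z) powr p)
      \<le> inverse ((t ^ Suc n * t ^ m)\<^sup>2) * (LINT z|lebesgue_on \<Omega>. norm (f z) powr p)"
    by (simp add: c_def I_def)
qed

lemma shrunk_approx:
  assumes f: "f \<in> bergman \<Omega> p" and p: "0 < p" and "0 < e"
  obtains t where "0 < t" "t < 1" "(LINT z|lebesgue_on \<Omega>. norm (shrunk t f z - f z) powr p) < e"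
proof -
  \<comment> \<open>The shift by 2 makes the first ratio \<open>1/2\<close>, so that no ratio is
    0.\<close>
  define t where "t j = 1 - 1 / real (Suc (Suc j))" for j
  have t: "0 < t j" "t j < 1" "t j \<le> 1" for j by (auto simp: t_def field_simps)
  have "t \<longlonglongrightarrow> 1 - 0"
    unfolding t_def by (intro tendsto_intros LIMSEQ_Suc lim_1_over_n)
  then have tl: "t \<longlonglongrightarrow> 1" by simp
  have hol: "holomorphic2_on f \<Omega>" and Lp: "f \<in> Lp_space \<Omega> p" using f by (auto simp: bergman_def)
  have "(\<lambda>j. LINT z|lebesgue_on \<Omega>. norm (shrunk (t j) f z - f z) powr p) \<longlonglongrightarrow> 0"
  proof (rule Lp_tendsto_of_norm_le[OF p])
    show "shrunk (t j) f \<in> borel_measurable (lebesgue_on \<Omega>)"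
      "integrable (lebesgue_on \<Omega>) (\<lambda>z. norm (shrunk (t j) f z) powr p)" for j
      using shrunk_norm_le(1)[OF f p t(1) t(3)] by (auto simp: Lp_space_def)
    show "f \<in> borel_measurable (lebesgue_on \<Omega>)"
      "integrable (lebesgue_on \<Omega>) (\<lambda>z. norm (f z) powr p)"
      using Lp by (auto simp: Lp_space_def)
    show "(LINT z|lebesgue_on \<Omega>. norm (shrunk (t j) f z) powr p)
        \<le> inverse ((t j ^ Suc n * t j ^ m)\<^sup>2) * (LINT z|lebesgue_on \<Omega>. norm (f z) powr p)" for j
      by (rule shrunk_norm_le(2)[OF f p t(1) t(3)])
    have "(\<lambda>j. inverse ((t j ^ Suc n * t j ^ m)\<^sup>2)) \<longlonglongrightarrow> inverse ((1 ^ Suc n * 1 ^ m)\<^sup>2)"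
      by (intro tendsto_intros tl) simp
    then show "(\<lambda>j. inverse ((t j ^ Suc n * t j ^ m)\<^sup>2)) \<longlonglongrightarrow> 1" by simp
    fix z assume "z \<in> space (lebesgue_on \<Omega>)"
    then have z: "z \<in> \<Omega>" by simp
    have "(\<lambda>j. shrink (t j) z) \<longlonglongrightarrow> (of_real 1 ^ Suc n * fst z, of_real 1 ^ m * snd z)"
      unfolding shrink_def scale2_def by (intro tendsto_intros tl)
    then have "(\<lambda>j. shrink (t j) z) \<longlonglongrightarrow> z" by simp
    moreover have "isCont f z"
      using holomorphic2_on_imp_continuous_on[OF hol] z open_\<Omega> by (simp add: continuous_on_eq_continuous_at)
    ultimately have "(\<lambda>j. f (shrink (t j) z)) \<longlonglongrightarrow> f z"
      by (rule isCont_tendsto_compose[rotated])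
    then have "(\<lambda>j. shrunk (t j) f z) \<longlonglongrightarrow> of_real 1 ^ nat (- k) * f z"
      unfolding shrunk_def by (intro tendsto_intros tl)
    then show "(\<lambda>j. shrunk (t j) f z) \<longlonglongrightarrow> f z" by simp
  qed
  then have "\<forall>\<^sub>F j in sequentially. (LINT z|lebesgue_on \<Omega>. norm (shrunk (t j) f z - f z) powr p) < e"
    using \<open>0 < e\<close> by (rule order_tendstoD(2))
  then obtain j where "(LINT z|lebesgue_on \<Omega>. norm (shrunk (t j) f z - f z) powr p) < e"
    by (auto simp: eventually_sequentially)
  then show ?thesis by (rule that[OF t(1,2)])
qed

end

section \<open>Rotation invariance and orthogonality of monomials\<close>

lemma integral_lebesgue_on_eq_lborel:
  fixes F :: "'a::euclidean_space \<Rightarrow> complex"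
  assumes "open A" "continuous_on A F"
  shows "(LINT z|lebesgue_on A. F z) = (LINT z|lborel. indicat_real A z *\<^sub>R F z)"
    and "(\<lambda>z. indicat_real A z *\<^sub>R F z) \<in> borel_measurable borel"
proof -
  show m: "(\<lambda>z. indicat_real A z *\<^sub>R F z) \<in> borel_measurable borel"
    using assms by (intro borel_measurable_continuous_on_indicator) auto
  have "(LINT z|lebesgue_on A. F z) = (LINT z|lebesgue. indicat_real A z *\<^sub>R F z)"
    using assms by (intro integral_restrict_space) auto
  also have "\<dots> = (LINT z|lborel. indicat_real A z *\<^sub>R F z)"
    using m by (intro integral_completion) auto
  finally show "(LINT z|lebesgue_on A. F z) = (LINT z|lborel. indicat_real A z *\<^sub>R F z)" .
qed

lemma distr_lborel_rotation:
  assumes "norm l = 1" "norm u = 1"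
  shows "distr lborel borel (scale2 l u) = lborel"
proof (rule measure_eqI)
  fix A assume "A \<in> sets (distr lborel borel (scale2 l u))"
  then have A[measurable]: "A \<in> sets borel" by simp
  have "emeasure (distr lborel borel (scale2 l u)) A = (\<integral>\<^sup>+z. indicator A z \<partial>distr lborel borel (scale2 l u))"
    by simp
  also have "\<dots> = (\<integral>\<^sup>+z. indicator A (scale2 l u z) \<partial>lborel)"
    by (rule nn_integral_distr) auto
  also have "\<dots> = (\<integral>\<^sup>+z. indicator A z \<partial>lborel)"
    using nn_integral_scale2[of "indicator A" l u] assms by force
  finally show "emeasure (distr lborel borel (scale2 l u)) A = emeasure lborel A" by simp
qed simp

context sub_bergman
begin

lemma integral_rotation:
  fixes F :: "complex \<times> complex \<Rightarrow> complex"
  assumes cont: "continuous_on \<Omega> F" and "norm l = 1" "norm u = 1"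
  shows "(LINT z|lebesgue_on \<Omega>. F (scale2 l u z)) = (LINT z|lebesgue_on \<Omega>. F z)"
proof -
  have mem: "scale2 l u z \<in> \<Omega> \<longleftrightarrow> z \<in> \<Omega>" for z
    using assms by (simp add: mem_\<Omega> scale2_def norm_mult)
  have cont': "continuous_on \<Omega> (\<lambda>z. F (scale2 l u z))"
    by (rule continuous_on_compose2[OF cont]) (auto simp: mem intro!: continuous_intros)
  have "(LINT z|lebesgue_on \<Omega>. F (scale2 l u z)) = (LINT z|lborel. indicat_real \<Omega> z *\<^sub>R F (scale2 l u z))"
    by (rule integral_lebesgue_on_eq_lborel(1)[OF open_\<Omega> cont'])
  also have "\<dots> = (LINT z|lborel. indicat_real \<Omega> (scale2 l u z) *\<^sub>R F (scale2 l u z))"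
    by (simp add: indicator_def mem)
  also have "\<dots> = (LINT z|distr lborel borel (scale2 l u). indicat_real \<Omega> z *\<^sub>R F z)"
    using integral_lebesgue_on_eq_lborel(2)[OF open_\<Omega> cont] by (intro integral_distr[symmetric]) auto
  also have "\<dots> = (LINT z|lebesgue_on \<Omega>. F z)"
    using assms by (simp add: distr_lborel_rotation integral_lebesgue_on_eq_lborel(1)[OF open_\<Omega> cont])
  finally show ?thesis .
qed

lemma continuous_on_monomial2: "\<alpha> \<in> S \<Longrightarrow> continuous_on \<Omega> (monomial2 \<alpha>)"
  by (rule holomorphic2_on_imp_continuous_on[OF holomorphic2_on_monomial2])
    (auto simp: S_def snd_nonzero)

text \<open>Some rotation of the torus multiplies the integrand by -1, while every rotation
  preserves the integral; so the integral equals its own negative.\<close>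

lemma monomial2_orthogonal:
  assumes \<alpha>: "\<alpha> \<in> S" and \<beta>: "\<beta> \<in> S" and ne: "\<alpha> \<noteq> \<beta>"
  shows "coeff_pairing \<beta> (monomial2 \<alpha>) = 0"
proof -
  have root: "\<exists>\<omega>. norm \<omega> = 1 \<and> cnj (\<omega> powi b) * \<omega> powi a = -1" if "a \<noteq> b" for a b :: int
  proof (intro exI conjI)
    \<comment> \<open>Chosen so that the difference of the two exponents turns the angle into
      \<open>pi\<close>.\<close>
    define \<theta> where "\<theta> = pi / of_int (a - b)"
    show "norm (cis \<theta>) = 1" by simp
    have "cnj (cis \<theta> powi b) * cis \<theta> powi a = cis (of_int (a - b) * \<theta>)"
      by (simp add: cis_power_int cis_cnj cis_mult algebra_simps)
    also have "of_int (a - b) * \<theta> = pi" using that by (simp add: \<theta>_def)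
    finally show "cnj (cis \<theta> powi b) * cis \<theta> powi a = -1" by simp
  qed
  obtain l u where lu: "norm l = 1" "norm u = 1"
    "cnj (l powi fst \<beta> * u powi snd \<beta>) * (l powi fst \<alpha> * u powi snd \<alpha>) = -1"
  proof (cases "fst \<alpha> = fst \<beta>")
    case False
    then obtain \<omega> where "norm \<omega> = 1" "cnj (\<omega> powi fst \<beta>) * \<omega> powi fst \<alpha> = -1" using root by blast
    then show ?thesis by (intro that[of \<omega> 1]) auto
  next
    case True
    then have "snd \<alpha> \<noteq> snd \<beta>" using ne by (simp add: prod_eq_iff)
    then obtain \<omega> where "norm \<omega> = 1" "cnj (\<omega> powi snd \<beta>) * \<omega> powi snd \<alpha> = -1" using root by blast
    then show ?thesis by (intro that[of 1 \<omega>]) auto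
  qed
  define F where "F z = cnj (monomial2 \<beta> z) * monomial2 \<alpha> z" for z
  have cont: "continuous_on \<Omega> F"
    unfolding F_def by (intro continuous_intros continuous_on_monomial2 \<alpha> \<beta>)
  have "F (scale2 l u z) = cnj (l powi fst \<beta> * u powi snd \<beta>) * (l powi fst \<alpha> * u powi snd \<alpha>) * F z" for z
    by (simp add: F_def monomial2_scale2 mult_ac)
  then have "F (scale2 l u z) = - F z" for z by (simp add: lu(3) del: complex_cnj_mult)
  then have "(LINT z|lebesgue_on \<Omega>. F z) = (LINT z|lebesgue_on \<Omega>. - F z)"
    using integral_rotation[OF cont lu(1,2)] by simp
  also have "\<dots> = - (LINT z|lebesgue_on \<Omega>. F z)"
    by simp
  finally show ?thesis by (simp add: coeff_pairing_def F_def)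
qed

lemma coeff_pairing_self:
  assumes "\<alpha> \<in> S"
  shows "coeff_pairing \<alpha> (monomial2 \<alpha>) = of_real (kappa \<alpha>)"
proof -
  have "coeff_pairing \<alpha> (monomial2 \<alpha>) = (LINT z|lebesgue_on \<Omega>. of_real ((norm (monomial2 \<alpha> z))\<^sup>2))"
    unfolding coeff_pairing_def complex_norm_square by (simp add: mult.commute)
  then show ?thesis by (simp only: kappa_eq integral_complex_of_real)
qed

section \<open>Series of monomials with absolutely summable coefficients\<close>

lemma series_norm_le:
  assumes h: "((\<lambda>\<alpha>. a \<alpha> * monomial2 \<alpha> z) has_sum h) S"
    and a: "(\<lambda>\<alpha>. norm (a \<alpha>)) summable_on S" and z: "z \<in> \<Omega>"
  shows "norm h \<le> (\<Sum>\<^sub>\<infinity>\<alpha>\<in>S. norm (a \<alpha>)) * W z"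
  by (rule norm_infsum_le[OF h has_sum_cmult_left[OF has_sum_infsum[OF a]]])
    (auto simp: norm_mult intro!: mult_left_mono norm_monomial2_le_W z)

lemma series_Lp:
  assumes h: "\<And>z. z \<in> \<Omega> \<Longrightarrow> ((\<lambda>\<alpha>. a \<alpha> * monomial2 \<alpha> z) has_sum h z) S"
    and a: "(\<lambda>\<alpha>. norm (a \<alpha>)) summable_on S" and hol: "holomorphic2_on h \<Omega>"
    and s: "0 < s" "- real_of_int k * s < 2 * real m + 2 * real n"
  shows "h \<in> Lp_space \<Omega> s"
proof -
  define A where "A = (\<Sum>\<^sub>\<infinity>\<alpha>\<in>S. norm (a \<alpha>))"
  have A: "0 \<le> A" unfolding A_def by (rule infsum_nonneg) simp
  have m: "h \<in> borel_measurable (lebesgue_on \<Omega>)"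
    by (rule measurable_lebesgue_on_continuous[OF open_\<Omega> holomorphic2_on_imp_continuous_on[OF hol]])
  have "integrable (lebesgue_on \<Omega>) (\<lambda>z. norm (h z) powr s)"
  proof (rule Bochner_Integration.integrable_bound[OF integrable_mult_right[OF integrable_W_powr[OF s], of "A powr s"]])
    show "(\<lambda>z. norm (h z) powr s) \<in> borel_measurable (lebesgue_on \<Omega>)"
      using measurable_compose[OF m borel_measurable_norm] by (rule measurable_powr_lebesgue_on)
    show "AE z in lebesgue_on \<Omega>. norm (norm (h z) powr s) \<le> norm (A powr s * W z powr s)"
    proof (rule AE_I2)
      fix z assume "z \<in> space (lebesgue_on \<Omega>)"
      then have z: "z \<in> \<Omega>" by simp
      have "norm (h z) powr s \<le> (A * W z) powr s"
        using series_norm_le[OF h[OF z] a z] s by (intro powr_mono2) (auto simp: A_def)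
      then show "norm (norm (h z) powr s) \<le> norm (A powr s * W z powr s)"
        by (simp add: powr_mult)
    qed
  qed
  then show ?thesis using m by (simp add: Lp_space_def)
qed

text \<open>Pairing with a monomial may be done term by term, since the products of two monomials
  are dominated by the square of \<open>W\<close>, integrable because 2 lies below the upper
  threshold. Orthogonality leaves one term, which returns the coefficient, so the projection has the
  same series as \<open>h\<close>.\<close>

lemma projection_series:
  assumes h: "\<And>z. z \<in> \<Omega> \<Longrightarrow> ((\<lambda>\<alpha>. a \<alpha> * monomial2 \<alpha> z) has_sum h z) S"
    and a: "(\<lambda>\<alpha>. norm (a \<alpha>)) summable_on S" and h1: "h \<in> wL1" and z: "z \<in> \<Omega>"
  shows "sub_bergman_projection \<Omega> r h z = h z"
proof -
  have pairing: "coeff_pairing \<beta> h = a \<beta> * of_real (kappa \<beta>)" if \<beta>: "\<beta> \<in> S" for \<beta>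
  proof -
    define F where "F \<alpha> w = cnj (monomial2 \<beta> w) * (a \<alpha> * monomial2 \<alpha> w)" for \<alpha> w
    have "((\<lambda>\<alpha>. LINT w|lebesgue_on \<Omega>. F \<alpha> w) has_sum (LINT w|lebesgue_on \<Omega>. (\<Sum>\<^sub>\<infinity>\<alpha>\<in>S. F \<alpha> w))) S"
    proof (rule integral_infsum_dominated[OF countable_S infinite_S _ _ a])
      show "integrable (lebesgue_on \<Omega>) (\<lambda>w. W w powr 2)"
        using integrable_W_powr[of 2] square_threshold by simp
      fix \<alpha> assume \<alpha>: "\<alpha> \<in> S"
      show "F \<alpha> \<in> borel_measurable (lebesgue_on \<Omega>)"
        unfolding F_def
        by (intro borel_measurable_times borel_measurable_const cnj_monomial2_measurable[OF \<beta>] monomial2_measurable[OF \<alpha>])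
      fix w assume "w \<in> space (lebesgue_on \<Omega>)"
      then have w: "w \<in> \<Omega>" by simp
      have "norm (F \<alpha> w) = norm (a \<alpha>) * (norm (monomial2 \<beta> w) * norm (monomial2 \<alpha> w))"
        by (simp add: F_def norm_mult)
      also have "\<dots> \<le> norm (a \<alpha>) * (W w * W w)"
        using W_ge_1[OF w] by (intro mult_left_mono mult_mono norm_monomial2_le_W w \<alpha> \<beta>) auto
      finally show "norm (F \<alpha> w) \<le> norm (a \<alpha>) * W w powr 2"
        using W_ge_1[OF w] by (simp add: power2_eq_square)
    qed auto
    moreover have "(LINT w|lebesgue_on \<Omega>. F \<alpha> w) = a \<alpha> * coeff_pairing \<beta> (monomial2 \<alpha>)" for \<alpha>
      unfolding coeff_pairing_def integral_mult_right_zero[symmetric]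
      by (intro Bochner_Integration.integral_cong) (auto simp: F_def)
    moreover have "(LINT w|lebesgue_on \<Omega>. (\<Sum>\<^sub>\<infinity>\<alpha>\<in>S. F \<alpha> w)) = coeff_pairing \<beta> h"
      unfolding coeff_pairing_def
    proof (rule Bochner_Integration.integral_cong[OF refl])
      fix w assume "w \<in> space (lebesgue_on \<Omega>)"
      then have "((\<lambda>\<alpha>. a \<alpha> * monomial2 \<alpha> w) has_sum h w) S" using h by simp
      from has_sum_cmult_right[OF this] show "(\<Sum>\<^sub>\<infinity>\<alpha>\<in>S. F \<alpha> w) = cnj (monomial2 \<beta> w) * h w"
        unfolding F_def by (rule infsumI)
    qed
    ultimately have "((\<lambda>\<alpha>. a \<alpha> * coeff_pairing \<beta> (monomial2 \<alpha>)) has_sum coeff_pairing \<beta> h) S"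
      by simp
    moreover have "((\<lambda>\<alpha>. a \<alpha> * coeff_pairing \<beta> (monomial2 \<alpha>)) has_sum a \<beta> * of_real (kappa \<beta>)) S"
      by (rule has_sum_finite_neutralI[of "{\<beta>}"]) (use \<beta> monomial2_orthogonal[OF _ \<beta>] coeff_pairing_self in auto)
    ultimately show ?thesis by (rule has_sum_unique)
  qed
  have "((\<lambda>\<alpha>. a \<alpha> * monomial2 \<alpha> z) has_sum sub_bergman_projection \<Omega> r h z) S"
    using projection_has_sum[OF h1 z]
    by (rule has_sum_cong[THEN iffD1, rotated]) (use kappa_pos in \<open>force simp: pairing\<close>)
  then show ?thesis using h[OF z] by (rule has_sum_unique)
qed

lemma shrunk_series:
  assumes f: "((\<lambda>\<alpha>. c \<alpha> * monomial2 \<alpha> (shrink t z)) has_sum f (shrink t z)) S" and t: "0 < t"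
  shows "((\<lambda>\<alpha>. (c \<alpha> * of_real t ^ excess \<alpha>) * monomial2 \<alpha> z) has_sum shrunk t f z) S"
proof -
  have "((\<lambda>\<alpha>. of_real t ^ nat (- k) * (c \<alpha> * monomial2 \<alpha> (shrink t z))) has_sum shrunk t f z) S"
    unfolding shrunk_def by (rule has_sum_cmult_right[OF f])
  then show ?thesis
    by (rule has_sum_cong[THEN iffD1, rotated])
      (use shrunk_monomial2[OF t] in \<open>simp add: shrunk_def mult_ac\<close>)
qed

text \<open>The gap between \<open>t\<close> and \<open>\<rho>\<close> turns a mere growth bound
  into geometric decay at rate \<open>t / \<rho>\<close>.\<close>

lemma shrunk_summable:
  fixes c :: "int \<times> int \<Rightarrow> complex"
  assumes "0 < t" "t < \<rho>" and c: "\<And>\<alpha>. \<alpha> \<in> S \<Longrightarrow> norm (c \<alpha>) * \<rho> ^ excess \<alpha> \<le> M"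
  shows "(\<lambda>\<alpha>. norm (c \<alpha> * of_real t ^ excess \<alpha>)) summable_on S"
proof (rule summable_on_comparison_test)
  show "(\<lambda>\<alpha>. M * (t / \<rho>) ^ excess \<alpha>) summable_on S"
    using assms by (intro summable_on_cmult_right summable_power_excess) auto
  fix \<alpha> assume \<alpha>: "\<alpha> \<in> S"
  have "norm (c \<alpha> * of_real t ^ excess \<alpha>) = norm (c \<alpha>) * \<rho> ^ excess \<alpha> * (t / \<rho>) ^ excess \<alpha>"
    using assms by (simp add: norm_mult norm_power power_divide)
  also have "\<dots> \<le> M * (t / \<rho>) ^ excess \<alpha>"
    using assms(1,2) c[OF \<alpha>] by (intro mult_right_mono) auto
  finally show "norm (c \<alpha> * of_real t ^ excess \<alpha>) \<le> M * (t / \<rho>) ^ excess \<alpha>" .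
qed simp

end

section \<open>Monomial expansion of Bergman functions\<close>

text \<open>Applying Cauchy's formula to \<open>F\<close> in the parameter and swapping the two
  contour integrals shows that \<open>G\<close> satisfies Cauchy's formula on the circle around
  \<open>w0\<close>. Being continuous there, \<open>G\<close> is differentiable inside as a Cauchy
  integral.\<close>

lemma holomorphic_on_contour_integral_parameter:
  fixes F :: "complex \<Rightarrow> complex \<Rightarrow> complex"
  assumes "0 < R" "0 < e"
    and cont: "continuous_on (sphere c R \<times> cball w0 e) (\<lambda>(\<zeta>, w). F \<zeta> w)"
    and hol: "\<And>\<zeta>. \<zeta> \<in> sphere c R \<Longrightarrow> F \<zeta> holomorphic_on ball w0 e"
  shows "(\<lambda>w. contour_integral (circlepath c R) (\<lambda>\<zeta>. F \<zeta> w)) holomorphic_on ball w0 e"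
proof -
  define G where "G w = contour_integral (circlepath c R) (\<lambda>\<zeta>. F \<zeta> w)" for w
  have pi: "path_image (circlepath c R) = sphere c R" "path_image (circlepath w0 e) = sphere w0 e"
    using assms(1,2) by simp_all
  have contF: "continuous_on (cball w0 e) (F \<zeta>)" if "\<zeta> \<in> sphere c R" for \<zeta>
    by (rule continuous_on_compose2[OF cont, of _ "\<lambda>w. (\<zeta>, w)", simplified])
      (use that in \<open>auto intro!: continuous_intros\<close>)
  have contG: "continuous_on (cball w0 e) G"
  proof -
    have "continuous_on (cball w0 e \<times> cbox 0 1)
       (\<lambda>(w, t). F (circlepath c R t) w * (2 * of_real pi * \<i> * of_real R * exp (2 * of_real pi * \<i> * of_real t)))"
    proof -
      have "continuous_on (cball w0 e \<times> cbox 0 1) (\<lambda>x. (circlepath c R (snd x), fst x))"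
        unfolding circlepath by (intro continuous_intros)
      then have "continuous_on (cball w0 e \<times> cbox 0 1) (\<lambda>x. (\<lambda>(\<zeta>, w). F \<zeta> w) (circlepath c R (snd x), fst x))"
        by (rule continuous_on_compose2[OF cont]) (use assms(1) in \<open>auto simp: circlepath dist_norm norm_mult\<close>)
      then show ?thesis
        unfolding case_prod_unfold by (intro continuous_intros) simp
    qed
    from integral_continuous_on_param[OF this]
    show ?thesis
      unfolding G_def[abs_def] contour_integral_integral vector_derivative_circlepath by simp
  qed
  \<comment> \<open>The exponent 1 is kept to match the theorem that differentiates Cauchy integrals
    of arbitrary order.\<close>
  have int: "((\<lambda>u. G u / (u - w) ^ 1) has_contour_integral 2 * of_real pi * \<i> * G w) (circlepath w0 e)"
    if w: "w \<in> ball w0 e" for w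
  proof -
    have nz: "u - w \<noteq> 0" if "u \<in> sphere w0 e" for u using w that by auto
    have "continuous_on (sphere w0 e) G" by (rule continuous_on_subset[OF contG]) auto
    then have "continuous_on (sphere w0 e) (\<lambda>u. G u / (u - w))"
      using nz by (intro continuous_intros) auto
    then have "(\<lambda>u. G u / (u - w)) contour_integrable_on circlepath w0 e"
      by (intro contour_integrable_continuous_circlepath) (simp only: pi)
    moreover have "contour_integral (circlepath w0 e) (\<lambda>u. G u / (u - w)) = 2 * of_real pi * \<i> * G w"
    proof -
      have "contour_integral (circlepath w0 e) (\<lambda>u. G u / (u - w))
          = contour_integral (circlepath w0 e) (\<lambda>u. contour_integral (circlepath c R) (\<lambda>\<zeta>. F \<zeta> u / (u - w)))"
      proof (rule contour_integral_eq)
        fix u assume "u \<in> path_image (circlepath w0 e)"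
        then have u: "u \<in> cball w0 e" using assms(2) by auto
        have "continuous_on (sphere c R) (\<lambda>\<zeta>. F \<zeta> u)"
          by (rule continuous_on_compose2[OF cont, of _ "\<lambda>\<zeta>. (\<zeta>, u)", simplified])
            (use u in \<open>auto intro!: continuous_intros\<close>)
        then have "(\<lambda>\<zeta>. F \<zeta> u) contour_integrable_on circlepath c R"
          by (intro contour_integrable_continuous_circlepath) (simp only: pi)
        then show "G u / (u - w) = contour_integral (circlepath c R) (\<lambda>\<zeta>. F \<zeta> u / (u - w))"
          by (simp add: G_def contour_integral_div)
      qed
      also have "\<dots> = contour_integral (circlepath c R) (\<lambda>\<zeta>. contour_integral (circlepath w0 e) (\<lambda>u. F \<zeta> u / (u - w)))"
      proof (rule contour_integral_swap)
        have "continuous_on (sphere w0 e \<times> sphere c R) (\<lambda>x. (\<lambda>(\<zeta>, w). F \<zeta> w) (snd x, fst x))"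
          by (rule continuous_on_compose2[OF cont]) (auto intro!: continuous_intros)
        then show "continuous_on (path_image (circlepath w0 e) \<times> path_image (circlepath c R)) (\<lambda>(u, \<zeta>). F \<zeta> u / (u - w))"
          unfolding pi case_prod_unfold using nz by (intro continuous_intros) auto
      qed (auto simp: vector_derivative_circlepath intro!: continuous_intros)
      also have "\<dots> = contour_integral (circlepath c R) (\<lambda>\<zeta>. 2 * of_real pi * \<i> * F \<zeta> w)"
      proof (rule contour_integral_eq)
        fix \<zeta> assume "\<zeta> \<in> path_image (circlepath c R)"
        then have \<zeta>: "\<zeta> \<in> sphere c R" by (simp only: pi)
        show "contour_integral (circlepath w0 e) (\<lambda>u. F \<zeta> u / (u - w)) = 2 * of_real pi * \<i> * F \<zeta> w"
          using Cauchy_integral_circlepath[OF contF[OF \<zeta>] hol[OF \<zeta>], of w] w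
          by (intro contour_integral_unique) (simp add: dist_norm norm_minus_commute)
      qed
      also have "\<dots> = 2 * of_real pi * \<i> * G w"
      proof -
        have "continuous_on (sphere c R) (\<lambda>\<zeta>. F \<zeta> w)"
          by (rule continuous_on_compose2[OF cont, of _ "\<lambda>\<zeta>. (\<zeta>, w)", simplified])
            (use w in \<open>auto intro!: continuous_intros\<close>)
        then have "(\<lambda>\<zeta>. F \<zeta> w) contour_integrable_on circlepath c R"
          by (intro contour_integrable_continuous_circlepath) (simp only: pi)
        then show ?thesis by (simp add: G_def contour_integral_lmul)
      qed
      finally show ?thesis .
    qed
    ultimately show ?thesis
      using has_contour_integral_integral by fastforce
  qed
  have "\<exists>D. (G has_field_derivative D) (at w)" if w: "w \<in> ball w0 e" for w
  proof -
    have "((\<lambda>w. 2 * of_real pi * \<i> * G w) has_field_derivative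
        (of_nat 1 * contour_integral (circlepath w0 e) (\<lambda>u. G u / (u - w) ^ Suc 1))) (at w)"
      by (rule Cauchy_next_derivative_circlepath(2)[OF _ int _ w])
        (use assms(2) in \<open>auto intro: continuous_on_subset[OF contG]\<close>)
    then have "((\<lambda>w. (1 / (2 * of_real pi * \<i>)) * (2 * of_real pi * \<i> * G w)) has_field_derivative
        (1 / (2 * of_real pi * \<i>)) * (of_nat 1 * contour_integral (circlepath w0 e) (\<lambda>u. G u / (u - w) ^ Suc 1))) (at w)"
      by (rule DERIV_cmult)
    moreover have "(\<lambda>w. (1 / (2 * of_real pi * \<i>)) * (2 * of_real pi * \<i> * G w)) = G" by auto
    ultimately show ?thesis by metis
  qed
  then have "G holomorphic_on ball w0 e" by (auto simp: holomorphic_on_open)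
  then show ?thesis by (simp only: G_def[abs_def])
qed

section \<open>Taylor expansion in the first coordinate\<close>

context hartogs_domain
begin

lemma mem_slice:
  assumes "0 < norm v" "norm v < 1"
  shows "(\<zeta>, v) \<in> \<Omega> \<longleftrightarrow> norm \<zeta> < norm v powr (real n / real m)"
proof
  assume "(\<zeta>, v) \<in> \<Omega>"
  from rad_less_1[OF this] show "norm \<zeta> < norm v powr (real n / real m)"
    using assms by (simp add: rad_def)
next
  assume "norm \<zeta> < norm v powr (real n / real m)"
  then have "norm \<zeta> ^ m < (norm v powr (real n / real m)) ^ m"
    using m_pos by (intro power_strict_mono) auto
  also have "\<dots> = norm v ^ n"
    using assms m_pos by (simp add: powr_powr flip: powr_realpow)
  finally show "(\<zeta>, v) \<in> \<Omega>" using assms by (simp add: mem_\<Omega>)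
qed

definition taylor_coeff :: "(complex \<times> complex \<Rightarrow> complex) \<Rightarrow> nat \<Rightarrow> complex \<Rightarrow> complex"
  where "taylor_coeff g a v = (deriv ^^ a) (\<lambda>\<zeta>. g (\<zeta>, v)) 0 / fact a"

lemma holomorphic_slice_fst:
  assumes "holomorphic2_on g \<Omega>" "0 < norm v" "norm v < 1"
  shows "(\<lambda>\<zeta>. g (\<zeta>, v)) holomorphic_on ball 0 (norm v powr (real n / real m))"
  by (rule holomorphic2_on_compose_curve[OF assms(1)]) (use assms mem_slice in \<open>auto intro: holomorphic_intros\<close>)

lemma taylor_sums:
  assumes "holomorphic2_on g \<Omega>" "z \<in> \<Omega>"
  shows "(\<lambda>a. taylor_coeff g a (snd z) * fst z ^ a) sums g z"
proof -
  have v: "0 < norm (snd z)" "norm (snd z) < 1" using snd_nonzero[OF assms(2)] assms(2) by (auto simp: mem_\<Omega>)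
  have "fst z \<in> ball 0 (norm (snd z) powr (real n / real m))"
    using mem_slice[OF v, of "fst z"] assms(2) by simp
  from holomorphic_power_series[OF holomorphic_slice_fst[OF assms(1) v] this]
  show ?thesis by (simp add: taylor_coeff_def)
qed

lemma taylor_coeff_bound:
  assumes g: "holomorphic2_on g \<Omega>" and v: "0 < norm v" "norm v < 1"
    and R: "0 < R" "R < norm v powr (real n / real m)"
    and B: "\<And>\<zeta>. norm \<zeta> = R \<Longrightarrow> norm (g (\<zeta>, v)) \<le> B"
  shows "norm (taylor_coeff g a v) \<le> B / R ^ a"
proof -
  have sub: "cball 0 R \<subseteq> ball 0 (norm v powr (real n / real m))" using R by auto
  have "norm ((deriv ^^ a) (\<lambda>\<zeta>. g (\<zeta>, v)) 0) \<le> fact a * B / R ^ a"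
  proof (rule Cauchy_inequality)
    show "(\<lambda>\<zeta>. g (\<zeta>, v)) holomorphic_on ball 0 R"
      by (rule holomorphic_on_subset[OF holomorphic_slice_fst[OF g v] order_trans[OF ball_subset_cball sub]])
    show "continuous_on (cball 0 R) (\<lambda>\<zeta>. g (\<zeta>, v))"
      by (rule holomorphic_on_imp_continuous_on[OF holomorphic_on_subset[OF holomorphic_slice_fst[OF g v] sub]])
  qed (use R B in auto)
  then show ?thesis by (simp add: taylor_coeff_def norm_divide field_simps)
qed

text \<open>The point \<open>(0, v0)\<close> is interior, so one small circle in \<open>z_1\<close>
  serves all \<open>v\<close> near \<open>v0\<close>; the coefficient is then a contour integral
  depending holomorphically on \<open>v\<close>.\<close>

lemma taylor_coeff_holomorphic:
  assumes g: "holomorphic2_on g \<Omega>"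
  shows "taylor_coeff g a holomorphic_on ball 0 1 - {0}"
proof (subst holomorphic_on_open)
  show "open (ball (0::complex) 1 - {0})" by auto
  show "\<forall>v0\<in>ball 0 1 - {0}. \<exists>f'. (taylor_coeff g a has_field_derivative f') (at v0)"
  proof
    fix v0 :: complex assume v0: "v0 \<in> ball 0 1 - {0}"
    then have "(0, v0) \<in> \<Omega>" using m_pos by (auto simp: mem_\<Omega> zero_power)
    then obtain A B where AB: "open A" "open B" "0 \<in> A" "v0 \<in> B" "A \<times> B \<subseteq> \<Omega>"
      using open_\<Omega> by (metis open_prod_elim mem_Sigma_iff)
    obtain R where R: "0 < R" "cball 0 R \<subseteq> A" using AB(1,3) open_contains_cball by blast
    obtain e where e: "0 < e" "cball v0 e \<subseteq> B" using AB(2,4) open_contains_cball by blast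
    have sub: "(\<zeta>, v) \<in> \<Omega>" if "\<zeta> \<in> cball 0 R" "v \<in> cball v0 e" for \<zeta> v
      using subsetD[OF R(2) that(1)] subsetD[OF e(2) that(2)] AB(5) by blast
    have cont: "continuous_on (cball 0 R \<times> cball v0 e) g"
      using sub by (intro continuous_on_subset[OF holomorphic2_on_imp_continuous_on[OF g]]) auto
    have "(\<lambda>v. contour_integral (circlepath 0 R) (\<lambda>\<zeta>. g (\<zeta>, v) / (\<zeta> - 0) ^ Suc a)) holomorphic_on ball v0 e"
    proof (rule holomorphic_on_contour_integral_parameter[OF R(1) e(1)])
      have "continuous_on (sphere 0 R \<times> cball v0 e) g"
        by (rule continuous_on_subset[OF cont]) auto
      then show "continuous_on (sphere 0 R \<times> cball v0 e) (\<lambda>(\<zeta>, v). g (\<zeta>, v) / (\<zeta> - 0) ^ Suc a)"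
        unfolding case_prod_unfold prod.collapse using R(1) by (intro continuous_intros) auto
      fix \<zeta> :: complex assume \<zeta>: "\<zeta> \<in> sphere 0 R"
      then have "(\<lambda>v. g (\<zeta>, v)) holomorphic_on ball v0 e"
        using sub by (intro holomorphic2_on_compose_curve[OF g] holomorphic_intros) auto
      then show "(\<lambda>v. g (\<zeta>, v) / (\<zeta> - 0) ^ Suc a) holomorphic_on ball v0 e"
        using \<zeta> R(1) by (intro holomorphic_intros) auto
    qed
    then have "(\<lambda>v. contour_integral (circlepath 0 R) (\<lambda>\<zeta>. g (\<zeta>, v) / (\<zeta> - 0) ^ Suc a) / (2 * of_real pi * \<i>))
        holomorphic_on ball v0 e"
      by (intro holomorphic_intros) auto
    moreover have "contour_integral (circlepath 0 R) (\<lambda>\<zeta>. g (\<zeta>, v) / (\<zeta> - 0) ^ Suc a) / (2 * of_real pi * \<i>)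
        = taylor_coeff g a v" if v: "v \<in> ball v0 e" for v
    proof -
      have "contour_integral (circlepath 0 R) (\<lambda>\<zeta>. g (\<zeta>, v) / (\<zeta> - 0) ^ Suc a)
          = 2 * of_real pi * \<i> * (deriv ^^ a) (\<lambda>\<zeta>. g (\<zeta>, v)) 0 / fact a"
      proof -
        have c1: "continuous_on (cball 0 R) (\<lambda>\<zeta>. g (\<zeta>, v))"
          by (rule continuous_on_compose2[OF cont]) (use v in \<open>auto intro!: continuous_intros\<close>)
        have c2: "(\<lambda>\<zeta>. g (\<zeta>, v)) holomorphic_on ball 0 R"
          using sub v by (intro holomorphic2_on_compose_curve[OF g] holomorphic_intros) auto
        show ?thesis
          by (subst Cauchy_contour_integral_circlepath[OF c1 c2]) (use R in auto)
      qed
      then show ?thesis by (simp add: taylor_coeff_def)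
    qed
    ultimately have "taylor_coeff g a holomorphic_on ball v0 e"
      by (rule holomorphic_transform)
    then show "\<exists>f'. (taylor_coeff g a has_field_derivative f') (at v0)"
      using e(1) by (meson centre_in_ball holomorphic_on_open open_ball)
  qed
qed

end

section \<open>Poles at the puncture and the double series\<close>

context sub_bergman
begin

text \<open>Riemann's theorem on removable singularities, in the form that \<open>v * G v\<close>
  tends to 0. The exponents balance with no room to spare in the extreme case, where boundedness of
  \<open>v * G v\<close> would still allow a simple pole; hence the arbitrarily small constant in
  \<open>decay\<close>.\<close>

lemma taylor_coeff_extends:
  assumes g: "g \<in> bergman \<Omega> r"
  obtains h where "h holomorphic_on ball 0 1"
    "\<And>v. v \<in> ball 0 1 - {0} \<Longrightarrow> h v = v powi (- base a) * taylor_coeff g a v"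
proof -
  have hol: "holomorphic2_on g \<Omega>" and "g \<in> Lp_space \<Omega> r" using g by (auto simp: bergman_def)
  then have fin: "(\<integral>\<^sup>+z\<in>\<Omega>. ennreal (norm (g z) powr r) \<partial>lborel) < \<infinity>" by (simp add: Lp_space_iff)
  define G where "G v = v powi (- base a) * taylor_coeff g a v" for v
  define q where "q = (2 * real m + 2 * real n) / r"
  have q: "q \<le> 1 - real_of_int k" using lower_threshold r_ge_1 by (simp add: q_def field_simps)
  \<comment> \<open>The second radius is \<open>(1/2)^m\<close> and the first is half the radius
    \<open>(1/2)^n\<close> of the corresponding slice, so \<open>K\<close> is a compact subset of
    the domain that dilations carry to the circles needed for Cauchy's inequality.\<close>
  define K where "K = cball (0 :: complex) (1/2 * (1/2) ^ n) \<times> sphere (0 :: complex) ((1/2) ^ m)"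
  have K: "compact K" "K \<subseteq> \<Omega>"
  proof -
    show "compact K" unfolding K_def by (intro compact_Times compact_cball compact_sphere)
    show "K \<subseteq> \<Omega>"
    proof
      fix z assume z: "z \<in> K"
      have "norm (fst z) ^ m \<le> (1/2 * (1/2) ^ n) ^ m" using z by (intro power_mono) (auto simp: K_def)
      also have "\<dots> < ((1/2) ^ n) ^ m" using m_pos by (intro power_strict_mono) auto
      also have "\<dots> = norm (snd z) ^ n" using z by (auto simp: K_def mult.commute simp flip: power_mult)
      finally show "z \<in> \<Omega>" using z m_pos by (auto simp: mem_\<Omega> K_def power_less_one_iff)
    qed
  qed
  have holG: "G holomorphic_on ball 0 1 - {0}"
    unfolding G_def by (intro holomorphic_intros taylor_coeff_holomorphic[OF hol]) auto
  \<comment> \<open>Minimality of \<open>base a\<close>: the exponent \<open>base a - 1\<close>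
    violates the weight condition. This makes the final power of \<open>x\<close>
    nonnegative.\<close>
  have e0: "int m * base a \<le> int m + k - int n * int a - 1"
    using base_le_iff[of a "base a - 1"] by (simp add: algebra_simps)
  have "((\<lambda>v. (v - 0) * G v) \<longlongrightarrow> 0) (at 0)"
    unfolding LIM_eq
  proof (intro allI impI)
    fix \<epsilon> :: real assume \<epsilon>: "0 < \<epsilon>"
    \<comment> \<open>\<open>2 ^ a\<close> compensates the halved radius in Cauchy's inequality, and
      the other 2 makes the final bound strict.\<close>
    define \<eta> where "\<eta> = \<epsilon> / 2 / 2 ^ a"
    have \<eta>: "0 < \<eta>" using \<epsilon> by (simp add: \<eta>_def)
    obtain \<tau>0 where \<tau>0: "0 < \<tau>0" "\<tau>0 \<le> 1"
      and dec: "\<And>\<tau> z. 0 < \<tau> \<Longrightarrow> \<tau> \<le> \<tau>0 \<Longrightarrow> z \<in> K \<Longrightarrow> norm (g (dil \<tau> z)) * \<tau> powr q \<le> \<eta>"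
      using decay[OF hol r_ge_1 fin K \<eta>] unfolding q_def by metis
    show "\<exists>s>0. \<forall>v. v \<noteq> 0 \<and> norm (v - 0) < s \<longrightarrow> norm ((v - 0) * G v - 0) < \<epsilon>"
    proof (intro exI conjI allI impI)
      show "0 < (\<tau>0 / 2) ^ m" using \<tau>0 by simp
      fix v :: complex assume "v \<noteq> 0 \<and> norm (v - 0) < (\<tau>0 / 2) ^ m"
      then have v: "0 < norm v" "norm v < (\<tau>0 / 2) ^ m" by auto
      define x where "x = norm v powr (1 / real m)"
      have x0: "0 < x" using v by (simp add: x_def)
      have xm: "x ^ m = norm v" using v m_pos by (simp add: x_def powr_powr flip: powr_realpow)
      have xn: "norm v powr (real n / real m) = x ^ n"
        using v by (simp add: x_def powr_powr flip: powr_realpow)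
      have "x < \<tau>0 / 2"
      proof (rule power_less_imp_less_base)
        show "x ^ m < (\<tau>0 / 2) ^ m" unfolding xm by (rule v(2))
        show "0 \<le> \<tau>0 / 2" using \<tau>0 by simp
      qed
      \<comment> \<open>With \<open>|v| = x^m\<close>, the ratio \<open>2 x\<close> takes the circle
        \<open>|z_2| = (1/2)^m\<close> of \<open>K\<close> to the circle through
        \<open>v\<close>.\<close>
      define \<tau> where "\<tau> = 2 * x"
      have \<tau>: "0 < \<tau>" "\<tau> \<le> \<tau>0" "\<tau> \<le> 1" using x0 \<open>x < \<tau>0 / 2\<close> \<tau>0 by (auto simp: \<tau>_def)
      have x1: "x < 1" using \<tau> \<tau>_def by simp
      have v1: "norm v < 1" unfolding xm[symmetric] using x0 x1 m_pos by (simp add: power_less_one_iff)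
      have B: "norm (g (\<zeta>, v)) \<le> \<eta> * \<tau> powr (real_of_int k - 1)" if \<zeta>: "norm \<zeta> = 1/2 * x ^ n" for \<zeta>
      proof -
        define w where "w = (\<zeta> / of_real \<tau> ^ n, v / of_real \<tau> ^ m)"
        have nt: "norm (of_real \<tau> :: complex) = 2 * x" using x0 by (simp add: \<tau>_def norm_mult)
        have "norm (fst w) = 1/2 * (1/2) ^ n" "norm (snd w) = (1/2) ^ m"
          unfolding w_def fst_conv snd_conv norm_divide norm_power nt \<zeta> xm[symmetric]
          using x0 by (simp_all add: power_mult_distrib power_divide)
        then have "w \<in> K" by (simp add: K_def mem_Times_iff)
        moreover have "dil \<tau> w = (\<zeta>, v)" using \<tau>(1) by (simp add: dil_def scale2_def w_def)
        ultimately have "norm (g (\<zeta>, v)) * \<tau> powr q \<le> \<eta>" using dec[OF \<tau>(1,2)] by metis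
        then have "norm (g (\<zeta>, v)) * \<tau> powr q * \<tau> powr (- q) \<le> \<eta> * \<tau> powr (- q)"
          by (rule mult_right_mono) simp
        then have "norm (g (\<zeta>, v)) \<le> \<eta> * \<tau> powr (- q)"
          using \<tau>(1) by (simp add: mult.assoc flip: powr_add)
        also have "\<dots> \<le> \<eta> * \<tau> powr (real_of_int k - 1)"
          using \<eta> q \<tau> by (intro mult_left_mono powr_mono') auto
        finally show ?thesis .
      qed
      have "norm (taylor_coeff g a v) \<le> \<eta> * \<tau> powr (real_of_int k - 1) / (1/2 * x ^ n) ^ a"
        by (rule taylor_coeff_bound[OF hol v(1) v1 _ _ B]) (use x0 xn in auto)
      also have "\<dots> = \<eta> * 2 ^ a * \<tau> powr (real_of_int k - 1) * x powr (- (real n * real a))"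
        using x0 by (simp add: power_mult_distrib power_divide powr_minus divide_simps powr_realpow flip: power_mult of_nat_mult)
      also have "\<tau> powr (real_of_int k - 1) = 2 powr (real_of_int k - 1) * x powr (real_of_int k - 1)"
        using x0 by (simp add: \<tau>_def powr_mult)
      also have "\<eta> * 2 ^ a * (2 powr (real_of_int k - 1) * x powr (real_of_int k - 1)) * x powr (- (real n * real a))
          = \<eta> * 2 ^ a * 2 powr (real_of_int k - 1) * x powr (real_of_int k - 1 - real n * real a)"
        by (simp add: mult.assoc flip: powr_add)
      finally have tc: "norm (taylor_coeff g a v)
          \<le> \<eta> * 2 ^ a * 2 powr (real_of_int k - 1) * x powr (real_of_int k - 1 - real n * real a)" .
      have nv: "norm (v * v powi (- base a)) = x powr (real m * (1 - real_of_int (base a)))"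
      proof -
        have "norm (v * v powi (- base a)) = norm v powr 1 * norm v powr (- real_of_int (base a))"
          using v(1) by (simp add: norm_mult norm_power_int powr_real_of_int' flip: of_int_minus)
        also have "\<dots> = (x powr real m) powr (1 - real_of_int (base a))"
          unfolding powr_realpow[OF x0] xm by (subst powr_add[symmetric]) simp
        finally show ?thesis by (simp add: powr_powr)
      qed
      have "norm ((v - 0) * G v - 0) = norm (v * v powi (- base a)) * norm (taylor_coeff g a v)"
        by (simp add: G_def norm_mult mult.assoc)
      also have "\<dots> \<le> x powr (real m * (1 - real_of_int (base a))) *
          (\<eta> * 2 ^ a * 2 powr (real_of_int k - 1) * x powr (real_of_int k - 1 - real n * real a))"
        unfolding nv by (intro mult_left_mono tc) simp
      also have "\<dots> = \<eta> * 2 ^ a * 2 powr (real_of_int k - 1) *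
          x powr (real m * (1 - real_of_int (base a)) + (real_of_int k - 1 - real n * real a))"
        by (simp add: powr_add)
      also have "\<dots> \<le> \<eta> * 2 ^ a * 1 * 1"
      proof (intro mult_mono order_refl)
        show "2 powr (real_of_int k - 1) \<le> 1"
          using k_nonpos powr_mono[of "real_of_int k - 1" 0 2] by simp
        have "real_of_int (int m * base a) \<le> real_of_int (int m + k - int n * int a - 1)"
          using e0 by (simp only: of_int_le_iff)
        then have "0 \<le> real m * (1 - real_of_int (base a)) + (real_of_int k - 1 - real n * real a)"
          by (simp add: right_diff_distrib)
        then show "x powr (real m * (1 - real_of_int (base a)) + (real_of_int k - 1 - real n * real a)) \<le> 1"
          using x0 x1 by (intro powr_le1) auto
      qed (use \<eta> in auto)
      also have "\<dots> < \<epsilon>" using \<epsilon> by (simp add: \<eta>_def)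
      finally show "norm ((v - 0) * G v - 0) < \<epsilon>" .
    qed
  qed
  then obtain h where "h holomorphic_on ball 0 1" "\<forall>v\<in>ball 0 1 - {0}. h v = G v"
    using holomorphic_on_extend_lim[OF holG] by auto
  then show ?thesis by (intro that[of h]) (auto simp: G_def)
qed

text \<open>Each Taylor coefficient in \<open>z_1\<close>, freed of its pole, is a power series in
  \<open>z_2\<close>. Cauchy's inequality in both variables bounds the coefficients, and this bound
  makes the double series absolutely convergent, so that it may be summed in the order in which it
  was produced.\<close>

lemma bergman_expansion:
  assumes g: "g \<in> bergman \<Omega> r"
  obtains c :: "int \<times> int \<Rightarrow> complex"
  where "\<And>z. z \<in> \<Omega> \<Longrightarrow> ((\<lambda>\<alpha>. c \<alpha> * monomial2 \<alpha> z) has_sum g z) S"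
    and "\<And>\<rho>. 0 < \<rho> \<Longrightarrow> \<rho> < 1 \<Longrightarrow> \<exists>M. \<forall>\<alpha>\<in>S. norm (c \<alpha>) * \<rho> ^ excess \<alpha> \<le> M"
proof -
  have hol: "holomorphic2_on g \<Omega>" using g by (simp add: bergman_def)
  have "\<exists>h. \<forall>a. h a holomorphic_on ball 0 1 \<and>
      (\<forall>v\<in>ball 0 1 - {0}. h a v = v powi (- base a) * taylor_coeff g a v)"
    using taylor_coeff_extends[OF g] by (intro choice allI) metis
  then obtain h where h: "\<And>a. h a holomorphic_on ball 0 1"
    "\<And>a v. v \<in> ball 0 1 - {0} \<Longrightarrow> h a v = v powi (- base a) * taylor_coeff g a v" by blast
  define \<gamma> where "\<gamma> a l = (deriv ^^ l) (h a) 0 / fact l" for a l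
  define c where "c \<alpha> = \<gamma> (nat (fst \<alpha>)) (nat (snd \<alpha> - base (nat (fst \<alpha>))))" for \<alpha>
  have c_idx: "c (idx p) = \<gamma> (fst p) (snd p)" for p by (simp add: c_def idx_def)
  have S_idx: "idx p \<in> S" for p using bij_idx by (auto simp: bij_betw_def)
  have bound: "\<exists>M. \<forall>\<alpha>\<in>S. norm (c \<alpha>) * \<rho> ^ excess \<alpha> \<le> M" if \<rho>: "0 < \<rho>" "\<rho> < 1" for \<rho>
  proof -
    \<comment> \<open>Contains the torus with radii \<open>\<rho> ^ Suc n\<close> and
      \<open>\<rho> ^ m\<close>. These are the powers occurring in \<open>shrink\<close>, so
      Cauchy's inequality produces exactly the exponent \<open>excess\<close>; the extra factor
      \<open>\<rho>\<close> keeps the first radius inside the slice.\<close>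
    define K where "K = cball (0 :: complex) (\<rho> ^ Suc n) \<times> sphere (0 :: complex) (\<rho> ^ m)"
    have sn: "\<rho> ^ Suc n < \<rho> ^ n" using \<rho> by simp
    have v1: "\<rho> ^ m < 1" using \<rho> m_pos by (simp add: power_less_one_iff)
    have vn: "(\<rho> ^ m) powr (real n / real m) = \<rho> ^ n"
    proof -
      have "(\<rho> ^ m) powr (real n / real m) = \<rho> powr real n"
        unfolding powr_realpow[OF \<rho>(1), symmetric] powr_powr using m_pos by simp
      then show ?thesis using \<rho>(1) by (simp add: powr_realpow)
    qed
    have "K \<subseteq> \<Omega>"
    proof
      fix z assume z: "z \<in> K"
      then have "norm (fst z) < norm (snd z) powr (real n / real m)"
        using sn vn by (auto simp: K_def)
      moreover have "0 < norm (snd z)" "norm (snd z) < 1" using z \<rho> v1 by (auto simp: K_def)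
      ultimately show "z \<in> \<Omega>" using mem_slice[of "snd z" "fst z"] by simp
    qed
    then have "compact (g ` K)"
      unfolding K_def
      by (intro compact_continuous_image compact_Times compact_cball compact_sphere
          continuous_on_subset[OF holomorphic2_on_imp_continuous_on[OF hol]])
    then obtain M where M: "\<And>z. z \<in> K \<Longrightarrow> norm (g z) \<le> M"
      using compact_imp_bounded bounded_iff by (metis imageI)
    have "norm (\<gamma> a l) * \<rho> ^ excess (idx (a, l)) \<le> M * \<rho> powi (- k)" for a l
    proof -
      define B where "B = (\<rho> ^ m) powi (- base a) * (M / (\<rho> ^ Suc n) ^ a)"
      have hb: "norm (h a v) \<le> B" if v: "norm v = \<rho> ^ m" for v
      proof -
        have "norm (taylor_coeff g a v) \<le> M / (\<rho> ^ Suc n) ^ a"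
        proof (rule taylor_coeff_bound[OF hol])
          show "0 < norm v" "norm v < 1" "0 < \<rho> ^ Suc n" using v \<rho> v1 by auto
          show "\<rho> ^ Suc n < norm v powr (real n / real m)" unfolding v vn by (rule sn)
          show "norm (g (\<zeta>, v)) \<le> M" if "norm \<zeta> = \<rho> ^ Suc n" for \<zeta>
            using that v by (intro M) (simp add: K_def)
        qed
        then have "(\<rho> ^ m) powi (- base a) * norm (taylor_coeff g a v) \<le> B"
          unfolding B_def by (rule mult_left_mono) (use \<rho> in simp)
        moreover have "h a v = v powi (- base a) * taylor_coeff g a v"
          using v v1 \<rho> by (intro h(2)) auto
        ultimately show ?thesis
          by (simp only: norm_mult norm_power_int v)
      qed
      have sub: "cball 0 (\<rho> ^ m) \<subseteq> ball (0 :: complex) 1" using v1 by auto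
      have "norm ((deriv ^^ l) (h a) 0) \<le> fact l * B / (\<rho> ^ m) ^ l"
      proof (rule Cauchy_inequality)
        show "h a holomorphic_on ball 0 (\<rho> ^ m)"
          by (rule holomorphic_on_subset[OF h(1) order_trans[OF ball_subset_cball sub]])
        show "continuous_on (cball 0 (\<rho> ^ m)) (h a)"
          by (rule holomorphic_on_imp_continuous_on[OF holomorphic_on_subset[OF h(1) sub]])
      qed (use \<rho> hb in auto)
      then have "norm (\<gamma> a l) \<le> B / (\<rho> ^ m) ^ l"
        by (simp add: \<gamma>_def norm_divide field_simps)
      also have "\<dots> = M * (\<rho> powi (int m * (- base a)) * \<rho> powi (- int (Suc n * a)) * \<rho> powi (- int (m * l)))"
      proof -
        have "inverse ((\<rho> ^ Suc n) ^ a) = \<rho> powi (- int (Suc n * a))"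
          by (simp only: power_int_minus power_int_of_nat power_mult)
        moreover have "inverse ((\<rho> ^ m) ^ l) = \<rho> powi (- int (m * l))"
          by (simp only: power_int_minus power_int_of_nat power_mult)
        moreover have "(\<rho> ^ m) powi (- base a) = \<rho> powi (int m * (- base a))"
          by (simp only: power_int_mult power_int_of_nat)
        ultimately show ?thesis by (simp only: B_def divide_inverse mult_ac)
      qed
      also have "\<dots> = M * \<rho> powi (int m * (- base a) + - int (Suc n * a) + - int (m * l))"
        using \<rho> by (simp only: power_int_add less_imp_neq[symmetric] simp_thms)
      finally have "norm (\<gamma> a l) * \<rho> powi int (excess (idx (a, l)))
          \<le> M * \<rho> powi (int m * (- base a) + - int (Suc n * a) + - int (m * l)) * \<rho> powi int (excess (idx (a, l)))"
        using \<rho> by (intro mult_right_mono) auto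
      also have "\<dots> = M * \<rho> powi (int m * (- base a) + - int (Suc n * a) + - int (m * l) + int (excess (idx (a, l))))"
        using \<rho> by (simp only: power_int_add less_imp_neq[symmetric] simp_thms mult.assoc)
      \<comment> \<open>All dependence on \<open>a\<close> and \<open>l\<close> cancels, which is
        why one constant serves for all coefficients.\<close>
      also have "int m * (- base a) + - int (Suc n * a) + - int (m * l) + int (excess (idx (a, l))) = - k"
        using S_idx[of "(a, l)"] by (simp add: S_def excess_def idx_def weight_def algebra_simps)
      finally show ?thesis by simp
    qed
    then have "norm (c \<alpha>) * \<rho> ^ excess \<alpha> \<le> M * \<rho> powi (- k)" if "\<alpha> \<in> S" for \<alpha>
    proof -
      have "\<alpha> \<in> range idx" using that bij_idx by (simp add: bij_betw_def)
      then obtain p where "\<alpha> = idx p" by blast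
      then show ?thesis
        using \<open>\<And>a l. norm (\<gamma> a l) * \<rho> ^ excess (idx (a, l)) \<le> M * \<rho> powi (- k)\<close>[of "fst p" "snd p"]
        by (simp add: c_idx)
    qed
    then show ?thesis by blast
  qed
  have "((\<lambda>\<alpha>. c \<alpha> * monomial2 \<alpha> z) has_sum g z) S" if z: "z \<in> \<Omega>" for z
  proof -
    define t where "t p = c (idx p) * monomial2 (idx p) z" for p
    \<comment> \<open>The coefficient bound at a rate strictly between \<open>mag z\<close> and 1
      beats the growth of the monomials at \<open>z\<close>.\<close>
    obtain \<rho> where \<rho>: "mag z < \<rho>" "\<rho> < 1" using dense mag_bounds(2)[OF z] by blast
    have mag0: "0 < mag z" by (rule mag_bounds(1)[OF z])
    obtain M where M: "\<And>\<alpha>. \<alpha> \<in> S \<Longrightarrow> norm (c \<alpha>) * \<rho> ^ excess \<alpha> \<le> M"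
      using bound[of \<rho>] \<rho> mag0 by auto
    have "(\<lambda>\<alpha>. norm (c \<alpha> * of_real (mag z) ^ excess \<alpha>)) summable_on S"
      by (rule shrunk_summable[OF mag0 \<rho>(1) M])
    then have "(\<lambda>\<alpha>. W z * norm (c \<alpha> * of_real (mag z) ^ excess \<alpha>)) summable_on S"
      by (rule summable_on_cmult_right)
    then have "(\<lambda>\<alpha>. norm (c \<alpha> * monomial2 \<alpha> z)) summable_on S"
    proof (rule summable_on_comparison_test)
      fix \<alpha> assume "\<alpha> \<in> S"
      then have "norm (c \<alpha>) * norm (monomial2 \<alpha> z) \<le> norm (c \<alpha>) * (W z * mag z ^ excess \<alpha>)"
        by (intro mult_left_mono norm_monomial2_le z) auto
      then show "norm (c \<alpha> * monomial2 \<alpha> z) \<le> W z * norm (c \<alpha> * of_real (mag z) ^ excess \<alpha>)"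
        using mag0 by (simp add: norm_mult norm_power mult_ac)
    qed simp
    then have "(\<lambda>p. norm (t p)) summable_on UNIV"
      unfolding t_def using summable_on_reindex_bij_betw[OF bij_idx, of "\<lambda>\<alpha>. norm (c \<alpha> * monomial2 \<alpha> z)"] by simp
    then have abs: "(\<lambda>p. norm (t p)) summable_on UNIV" "t summable_on UNIV"
      by (auto intro: abs_summable_summable)
    then obtain T where T: "(t has_sum T) UNIV" by (auto simp: summable_on_def)
    have v: "snd z \<in> ball 0 1 - {0}" using z snd_nonzero[OF z] by (simp add: mem_\<Omega>)
    have inner: "((\<lambda>l. t (a, l)) has_sum taylor_coeff g a (snd z) * fst z ^ a) UNIV" for a
    proof -
      have "(\<lambda>l. \<gamma> a l * (snd z - 0) ^ l) sums h a (snd z)"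
        unfolding \<gamma>_def by (rule holomorphic_power_series[OF h(1)]) (use v in auto)
      then have "(\<lambda>l. snd z powi base a * fst z ^ a * (\<gamma> a l * (snd z - 0) ^ l)) sums
          (snd z powi base a * fst z ^ a * h a (snd z))"
        by (rule sums_mult)
      also have "(\<lambda>l. snd z powi base a * fst z ^ a * (\<gamma> a l * (snd z - 0) ^ l)) = (\<lambda>l. t (a, l))"
      proof
        fix l
        have "t (a, l) = \<gamma> a l * monomial2 (idx (a, l)) z" by (simp add: t_def c_idx)
        then show "snd z powi base a * fst z ^ a * (\<gamma> a l * (snd z - 0) ^ l) = t (a, l)"
          using v by (simp add: monomial2_def idx_def power_int_add mult_ac)
      qed
      also have "snd z powi base a * fst z ^ a * h a (snd z) = taylor_coeff g a (snd z) * fst z ^ a"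
        using v by (simp add: h(2)[OF v] power_int_minus)
      finally have s: "(\<lambda>l. t (a, l)) sums (taylor_coeff g a (snd z) * fst z ^ a)" .
      have "(\<lambda>l. norm (t (a, l))) summable_on UNIV"
        using summable_on_SigmaD1[of "\<lambda>a l. norm (t (a, l))" UNIV "\<lambda>_. UNIV" a] abs(1)
        by (simp add: case_prod_unfold)
      then have "summable (\<lambda>l. norm (t (a, l)))" by (rule summable_on_imp_summable)
      then show ?thesis using s by (rule norm_summable_imp_has_sum)
    qed
    \<comment> \<open>The iterated sum is the Taylor series of \<open>g\<close> in
      \<open>z_1\<close>, which identifies the value \<open>T\<close> of the double sum.\<close>
    have "((\<lambda>a. taylor_coeff g a (snd z) * fst z ^ a) has_sum T) UNIV"
      by (rule has_sum_SigmaD[where f = t and B = "\<lambda>_. UNIV"]) (use T inner in auto)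
    then have "T = g z"
      using has_sum_imp_sums taylor_sums[OF hol z] sums_unique2 by blast
    then show ?thesis
      using T has_sum_reindex_bij_betw[OF bij_idx, of "\<lambda>\<alpha>. c \<alpha> * monomial2 \<alpha> z"] by (simp add: t_def[abs_def])
  qed
  then show ?thesis using bound by (rule that)
qed

end

section \<open>Functions fixed by the projection\<close>

lemma Lp_space_diff:
  assumes "0 < p" "f \<in> Lp_space A p" "g \<in> Lp_space A p"
  shows "(\<lambda>z. f z - g z) \<in> Lp_space A p"
proof -
  have f: "f \<in> borel_measurable (lebesgue_on A)" "integrable (lebesgue_on A) (\<lambda>z. norm (f z) powr p)"
    and g: "g \<in> borel_measurable (lebesgue_on A)" "integrable (lebesgue_on A) (\<lambda>z. norm (g z) powr p)"
    using assms by (auto simp: Lp_space_def)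
  have m: "(\<lambda>z. f z - g z) \<in> borel_measurable (lebesgue_on A)"
    by (rule borel_measurable_diff[OF f(1) g(1)])
  have "integrable (lebesgue_on A) (\<lambda>z. 2 powr p * (norm (f z) powr p + norm (g z) powr p))"
    using f g by simp
  then have "integrable (lebesgue_on A) (\<lambda>z. norm (f z - g z) powr p)"
  proof (rule Bochner_Integration.integrable_bound)
    show "(\<lambda>z. norm (f z - g z) powr p) \<in> borel_measurable (lebesgue_on A)"
      by (rule measurable_compose[OF m]) measurable
    show "AE z in lebesgue_on A. norm (norm (f z - g z) powr p)
        \<le> norm (2 powr p * (norm (f z) powr p + norm (g z) powr p))"
      using norm_diff_powr_le[OF assms(1)] by (intro AE_I2) simp
  qed
  then show ?thesis using m by (simp add: Lp_space_def)
qed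

lemma (in hartogs_domain) Lp_space_antimono:
  assumes "0 < p" "p \<le> s" "f \<in> Lp_space \<Omega> s"
  shows "f \<in> Lp_space \<Omega> p"
proof -
  have m: "f \<in> borel_measurable (lebesgue_on \<Omega>)" using assms by (simp add: Lp_space_def)
  have "emeasure (lebesgue_on \<Omega>) \<Omega> < \<infinity>"
    using emeasure_\<Omega>_finite by (simp add: emeasure_restrict_space)
  then have "integrable (lebesgue_on \<Omega>) (\<lambda>z. 1 :: real)"
    by (intro integrableI_bounded_set[where A = \<Omega> and B = 1]) (auto simp: sets_restrict_space)
  then have "integrable (lebesgue_on \<Omega>) (\<lambda>z. 1 + norm (f z) powr s)"
    using assms(3) by (simp add: Lp_space_def)
  then have "integrable (lebesgue_on \<Omega>) (\<lambda>z. norm (f z) powr p)"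
  proof (rule Bochner_Integration.integrable_bound)
    show "(\<lambda>z. norm (f z) powr p) \<in> borel_measurable (lebesgue_on \<Omega>)"
      by (rule measurable_compose[OF m]) measurable
    have "norm (f z) powr p \<le> 1 + norm (f z) powr s" for z
    proof (cases "norm (f z) \<le> 1")
      case True
      then show ?thesis using powr_le1[of p "norm (f z)"] assms(1) by (intro add_increasing2) auto
    next
      case False
      then have "norm (f z) powr p \<le> norm (f z) powr s"
        using assms(2) by (intro powr_mono) auto
      then show ?thesis by simp
    qed
    then show "AE z in lebesgue_on \<Omega>. norm (norm (f z) powr p) \<le> norm (1 + norm (f z) powr s)"
      by (intro AE_I2) simp
  qed
  then show ?thesis using m by (simp add: Lp_space_def)
qed

text \<open>The last assumption says \<open>p' < p_(k+1)\<close>, so \<open>W\<close> lies in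
  \<open>L^p'\<close> and \<open>L^p\<close> embeds into the weighted \<open>L^1\<close>
  space.\<close>

locale sub_bergman_conjugate = sub_bergman +
  fixes p p' :: real
  assumes p_gt_1: "1 < p" and p_le_r: "p \<le> r" and conj: "1 / p + 1 / p' = 1"
    and conj_threshold: "- real_of_int k * p' < 2 * real m + 2 * real n"
begin

lemma p_pos: "0 < p"
  using p_gt_1 by simp

lemma bergman_wL1: "f \<in> bergman \<Omega> p \<Longrightarrow> f \<in> wL1"
  using Lp_subset_wL1[OF p_gt_1 conj conj_threshold] by (simp add: bergman_def)

lemma bergman_r_subset_p: "g \<in> bergman \<Omega> r \<Longrightarrow> g \<in> bergman \<Omega> p"
  using Lp_space_antimono[OF p_pos p_le_r] by (simp add: bergman_def)

text \<open>On holomorphic functions in \<open>wL1\<close>, the difference between the projection at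
  \<open>z\<close> and the value at \<open>z\<close> is a bounded linear functional. Its kernel is
  therefore closed under \<open>L^p\<close> limits.\<close>

lemma projection_eq_if_approx:
  assumes f: "f \<in> bergman \<Omega> p" and z: "z \<in> \<Omega>"
    and approx: "\<And>e. 0 < e \<Longrightarrow> \<exists>g \<in> bergman \<Omega> p. sub_bergman_projection \<Omega> r g z = g z \<and>
      (LINT w|lebesgue_on \<Omega>. norm (f w - g w) powr p) < e"
  shows "sub_bergman_projection \<Omega> r f z = f z"
proof (rule ccontr)
  assume ne: "sub_bergman_projection \<Omega> r f z \<noteq> f z"
  define D where "D = norm (sub_bergman_projection \<Omega> r f z - f z)"
  have D: "0 < D" using ne by (simp add: D_def)
  obtain C1 where C1: "0 \<le> C1" "\<And>h. h \<in> wL1 \<Longrightarrow> norm (sub_bergman_projection \<Omega> r h z) \<le> C1 * wint h"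
    using projection_bound[OF z] by metis
  obtain C2 where C2: "0 \<le> C2" "\<And>h. h \<in> wL1 \<Longrightarrow> holomorphic2_on h \<Omega> \<Longrightarrow> norm (h z) \<le> C2 * wint h"
    using evaluation_bound[OF z] by metis
  \<comment> \<open>The summand 1 excludes a zero denominator and makes the concluding inequality
    strict.\<close>
  define e where "e = D / (C1 + C2 + 1)"
  have e: "0 < e" using D C1(1) C2(1) by (simp add: e_def)
  obtain d where d: "0 < d" "\<And>h. h \<in> Lp_space \<Omega> p \<Longrightarrow>
      (LINT z|lebesgue_on \<Omega>. norm (h z) powr p) < d \<Longrightarrow> wint h < e"
    using wint_small[OF p_gt_1 conj conj_threshold e] by metis
  obtain g where g: "g \<in> bergman \<Omega> p" "sub_bergman_projection \<Omega> r g z = g z"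
    "(LINT w|lebesgue_on \<Omega>. norm (f w - g w) powr p) < d"
    using approx[OF d(1)] by blast
  define h where "h w = f w - g w" for w
  have h: "h \<in> Lp_space \<Omega> p" "holomorphic2_on h \<Omega>"
    using f g(1) p_pos unfolding h_def[abs_def] bergman_def
    by (auto intro: Lp_space_diff holomorphic2_on_diff)
  have h1: "h \<in> wL1" by (rule Lp_subset_wL1[OF p_gt_1 conj conj_threshold h(1)])
  have w: "wint h < e" using d(2)[OF h(1)] g(3) by (simp add: h_def)
  have "sub_bergman_projection \<Omega> r f z - f z = sub_bergman_projection \<Omega> r h z - h z"
    using projection_diff[OF bergman_wL1[OF f] bergman_wL1[OF g(1)] z] g(2)
    by (simp add: h_def[abs_def])
  then have "D \<le> norm (sub_bergman_projection \<Omega> r h z) + norm (h z)"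
    unfolding D_def by (metis norm_triangle_ineq4)
  also have "\<dots> \<le> (C1 + C2) * wint h"
    using C1(2)[OF h1] C2(2)[OF h1 h(2)] by (simp add: distrib_right)
  also have "\<dots> \<le> (C1 + C2) * e"
    using w C1(1) C2(1) by (intro mult_left_mono) auto
  also have "\<dots> < (C1 + C2 + 1) * e"
    using e by simp
  also have "\<dots> = D" using C1(1) C2(1) by (simp add: e_def)
  finally show False by simp
qed

lemma shrunk_in_bergman:
  assumes "f \<in> bergman \<Omega> p" "0 < t" "t < 1"
  shows "shrunk t f \<in> bergman \<Omega> p"
  using shrunk_norm_le(1)[OF assms(1) p_pos] holomorphic2_on_shrunk assms by (simp add: bergman_def)

text \<open>The coefficients of \<open>g\<close> itself need not be summable, so
  \<open>projection_series\<close> is applied to its dilations and the identity is carried to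
  \<open>g\<close> by approximation.\<close>

lemma projection_bergman_r:
  assumes g: "g \<in> bergman \<Omega> r" and z: "z \<in> \<Omega>"
  shows "sub_bergman_projection \<Omega> r g z = g z"
proof (rule projection_eq_if_approx[OF bergman_r_subset_p[OF g] z])
  obtain c where c: "\<And>z. z \<in> \<Omega> \<Longrightarrow> ((\<lambda>\<alpha>. c \<alpha> * monomial2 \<alpha> z) has_sum g z) S"
    and c_bound: "\<And>\<rho>. 0 < \<rho> \<Longrightarrow> \<rho> < 1 \<Longrightarrow> \<exists>M. \<forall>\<alpha>\<in>S. norm (c \<alpha>) * \<rho> ^ excess \<alpha> \<le> M"
    using bergman_expansion[OF g] by metis
  fix e :: real assume "0 < e"
  then obtain t where t: "0 < t" "t < 1" and le: "(LINT w|lebesgue_on \<Omega>. norm (shrunk t g w - g w) powr p) < e"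
    using shrunk_approx[OF bergman_r_subset_p[OF g] p_pos] by metis
  have gt: "shrunk t g \<in> bergman \<Omega> p" by (rule shrunk_in_bergman[OF bergman_r_subset_p[OF g] t])
  \<comment> \<open>Any rate strictly between \<open>t\<close> and 1 would do; the midpoint is
    taken.\<close>
  obtain M where M: "\<And>\<alpha>. \<alpha> \<in> S \<Longrightarrow> norm (c \<alpha>) * ((1 + t) / 2) ^ excess \<alpha> \<le> M"
    using c_bound[of "(1 + t) / 2"] t by auto
  have "sub_bergman_projection \<Omega> r (shrunk t g) z = shrunk t g z"
  proof (rule projection_series[OF _ _ bergman_wL1[OF gt] z])
    show "((\<lambda>\<alpha>. (c \<alpha> * of_real t ^ excess \<alpha>) * monomial2 \<alpha> w) has_sum shrunk t g w) S" if "w \<in> \<Omega>" for w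
      using t that by (intro shrunk_series c shrink_mem) auto
    show "(\<lambda>\<alpha>. norm (c \<alpha> * of_real t ^ excess \<alpha>)) summable_on S"
      by (rule shrunk_summable[OF t(1) _ M]) (use t in auto)
  qed
  then show "\<exists>h \<in> bergman \<Omega> p. sub_bergman_projection \<Omega> r h z = h z \<and>
      (LINT w|lebesgue_on \<Omega>. norm (g w - h w) powr p) < e"
    using gt le by (intro bexI[of _ "shrunk t g"]) (auto simp: norm_minus_commute)
qed

text \<open>The coefficients of \<open>f\<close> are bounded pairings divided by
  \<open>kappa\<close>, hence subexponential by \<open>kappa_lower\<close>. Dilation makes them
  summable, and then the sum is bounded by a multiple of \<open>W\<close>, which lies in
  \<open>L^r\<close> as well as in \<open>L^p\<close>.\<close>

lemma shrunk_in_bergman_r: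
  assumes f: "f \<in> bergman \<Omega> p" and t: "0 < t" "t < 1"
    and fix_f: "\<And>z. z \<in> \<Omega> \<Longrightarrow> sub_bergman_projection \<Omega> r f z = f z"
  shows "shrunk t f \<in> bergman \<Omega> r"
proof -
  define c where "c \<alpha> = coeff_pairing \<alpha> f / of_real (kappa \<alpha>)" for \<alpha>
  have f1: "f \<in> wL1" by (rule bergman_wL1[OF f])
  have c: "((\<lambda>\<alpha>. c \<alpha> * monomial2 \<alpha> z) has_sum f z) S" if "z \<in> \<Omega>" for z
    using projection_has_sum[OF f1 that] by (simp add: c_def fix_f[OF that] mult.commute)
  define \<rho> where "\<rho> = (1 + t) / 2"
  have \<rho>: "0 < \<rho>" "t < \<rho>" "\<rho> < 1" using t by (auto simp: \<rho>_def)
  obtain c0 where c0: "0 < c0" "\<And>\<alpha>. \<alpha> \<in> S \<Longrightarrow> c0 * \<rho> ^ excess \<alpha> \<le> kappa \<alpha>"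
    using kappa_lower[OF \<rho>(1,3)] by metis
  have M: "norm (c \<alpha>) * \<rho> ^ excess \<alpha> \<le> wint f / c0" if "\<alpha> \<in> S" for \<alpha>
  proof -
    have "norm (coeff_pairing \<alpha> f) * (c0 * \<rho> ^ excess \<alpha>) \<le> wint f * kappa \<alpha>"
      using norm_coeff_pairing_le[OF f1 that] c0(2)[OF that] c0(1) \<rho>(1) 
      by (intro mult_mono) (auto intro: order_trans[OF norm_ge_zero])
    then show ?thesis
      using kappa_pos[OF that] c0(1) by (simp add: c_def norm_divide field_simps)
  qed
  have hol: "holomorphic2_on (shrunk t f) \<Omega>"
    using f t by (intro holomorphic2_on_shrunk) (auto simp: bergman_def)
  have "shrunk t f \<in> Lp_space \<Omega> r"
  proof (rule series_Lp[OF _ _ hol _ upper_threshold])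
    show "((\<lambda>\<alpha>. (c \<alpha> * of_real t ^ excess \<alpha>) * monomial2 \<alpha> w) has_sum shrunk t f w) S" if "w \<in> \<Omega>" for w
      using t that by (intro shrunk_series c shrink_mem) auto
    show "(\<lambda>\<alpha>. norm (c \<alpha> * of_real t ^ excess \<alpha>)) summable_on S"
      by (rule shrunk_summable[OF t(1) \<rho>(2) M])
  qed (use r_ge_1 in simp)
  then show ?thesis using hol by (simp add: bergman_def)
qed

lemma approximable_iff:
  assumes f: "f \<in> bergman \<Omega> p"
  shows "Lp_approximable_by \<Omega> p f (bergman \<Omega> r) \<longleftrightarrow> (\<forall>z\<in>\<Omega>. sub_bergman_projection \<Omega> r f z = f z)"
proof
  assume approx: "Lp_approximable_by \<Omega> p f (bergman \<Omega> r)"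
  show "\<forall>z\<in>\<Omega>. sub_bergman_projection \<Omega> r f z = f z"
  proof (intro ballI projection_eq_if_approx[OF f])
    fix e :: real and z' assume z': "z' \<in> \<Omega>" and e: "0 < e"
    then obtain g where g: "g \<in> bergman \<Omega> r" "Lp_norm \<Omega> p (\<lambda>z. f z - g z) < e powr (1 / p)"
      using approx unfolding Lp_approximable_by_def by (metis powr_gt_zero less_irrefl)
    have "(LINT w|lebesgue_on \<Omega>. norm (f w - g w) powr p) < e"
    proof (rule ccontr)
      assume "\<not> (LINT w|lebesgue_on \<Omega>. norm (f w - g w) powr p) < e"
      then have "e powr (1 / p) \<le> Lp_norm \<Omega> p (\<lambda>z. f z - g z)"
        unfolding Lp_norm_def using e p_pos by (intro powr_mono2) auto
      then show False using g(2) by simp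
    qed
    then show "\<exists>g \<in> bergman \<Omega> p. sub_bergman_projection \<Omega> r g z' = g z' \<and>
        (LINT w|lebesgue_on \<Omega>. norm (f w - g w) powr p) < e"
      using g(1) bergman_r_subset_p projection_bergman_r[OF _ z'] by blast
  qed
next
  assume fix_f: "\<forall>z\<in>\<Omega>. sub_bergman_projection \<Omega> r f z = f z"
  show "Lp_approximable_by \<Omega> p f (bergman \<Omega> r)"
    unfolding Lp_approximable_by_def
  proof (intro allI impI)
    fix \<epsilon> :: real assume "0 < \<epsilon>"
    then have "0 < \<epsilon> powr p" by simp
    then obtain t where t: "0 < t" "t < 1"
      and le: "(LINT w|lebesgue_on \<Omega>. norm (shrunk t f w - f w) powr p) < \<epsilon> powr p"
      using shrunk_approx[OF f p_pos] by metis
    have "Lp_norm \<Omega> p (\<lambda>z. f z - shrunk t f z) < (\<epsilon> powr p) powr (1 / p)"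
      unfolding Lp_norm_def using le p_pos
      by (intro powr_less_mono2) (auto simp: norm_minus_commute intro!: Bochner_Integration.integral_nonneg)
    then have "Lp_norm \<Omega> p (\<lambda>z. f z - shrunk t f z) < \<epsilon>"
      using p_pos \<open>0 < \<epsilon>\<close> by (simp add: powr_powr)
    moreover have "(\<lambda>z. f z - shrunk t f z) \<in> Lp_space \<Omega> p"
      using f shrunk_in_bergman[OF f t] by (intro Lp_space_diff[OF p_pos]) (auto simp: bergman_def)
    ultimately show "\<exists>g\<in>bergman \<Omega> r. (\<lambda>z. f z - g z) \<in> Lp_space \<Omega> p \<and> Lp_norm \<Omega> p (\<lambda>z. f z - g z) < \<epsilon>"
      using shrunk_in_bergman_r[OF f t] fix_f by blast
  qed
qed

end

section \<open>Thresholds and the characterization\<close>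

lemma below_threshold:
  assumes "ereal s < threshold_exponent m n (k + 1)" "k \<le> 0" "0 < m"
  shows "- real_of_int k * s < 2 * real m + 2 * real n"
proof (cases "k = 0")
  case False
  then have "s < (2 * real m + 2 * real n) / (- real_of_int k)"
    using assms(1) by (simp add: threshold_exponent_def)
  then show ?thesis using False assms(2) by (simp add: field_simps)
qed (use assms in simp)

theorem proposition4p44:
  fixes m n :: nat and k :: int and p p' r :: real
    and f :: "complex \<times> complex \<Rightarrow> complex"
  assumes "m > 0" and "n > 0" and "coprime m n"
    and "1 < p" and "p < 2" and "1 / p + 1 / p' = 1"
    and "k \<in> {1 - 2 * int m - 2 * int n..0}"
    and "ereal p' < threshold_exponent m n (k + 1)"
    and "threshold_exponent m n k \<le> ereal r" and "ereal r < threshold_exponent m n (k + 1)"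
    and "f \<in> bergman (hartogs m n) p"
  shows "Lp_approximable_by (hartogs m n) p f (bergman (hartogs m n) r) \<longleftrightarrow>
    (\<forall>z \<in> hartogs m n. sub_bergman_projection (hartogs m n) r f z = f z)"
proof -
  have k: "k \<le> 0" using assms by simp
  have p': "2 < p'"
  proof -
    have "1 / 2 < 1 / p" "1 / p < 1" using assms by (simp_all add: field_simps)
    then have *: "0 < 1 / p'" "1 / p' < 1 / 2" using assms(6) by linarith+
    then have "0 < p'" by simp
    then show ?thesis using *(2) by (simp add: field_simps)
  qed
  have tp': "- real_of_int k * p' < 2 * real m + 2 * real n"
    using below_threshold assms k by blast
  have tr: "- real_of_int k * r < 2 * real m + 2 * real n"
    using below_threshold assms k by blast
  have low: "2 * real m + 2 * real n \<le> r * (1 - real_of_int k)"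
    using assms(9) k by (simp add: threshold_exponent_def field_simps)
  \<comment> \<open>As \<open>p' > 2\<close>, the bound on \<open>p'\<close> also puts 2 below the
    upper threshold, so \<open>W\<close> is square integrable.\<close>
  have t2: "- real_of_int k * 2 < 2 * real m + 2 * real n"
    using mult_left_mono[of 2 p' "- real_of_int k"] k p' tp' by simp
  \<comment> \<open>Passing through the integers sharpens this strict inequality to
    \<open>1 - k \<le> m + n\<close>, that is \<open>p_k \<ge> 2\<close>; hence
    \<open>r \<ge> 2 > p\<close>.\<close>
  have "- k < int m + int n"
    using t2 by linarith
  then have "1 - k \<le> int m + int n" by simp
  then have "1 - real_of_int k \<le> real m + real n" by linarith
  from mult_left_mono[OF this, of 2]
  have "2 * (1 - real_of_int k) \<le> 2 * real m + 2 * real n" by (simp add: algebra_simps)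
  also note low
  finally have r: "2 \<le> r"
    by (rule mult_right_le_imp_le) (use k in simp)
  interpret sub_bergman_conjugate m n k r p p'
    by unfold_locales (use assms k tp' tr low t2 r in auto)
  show ?thesis
    using approximable_iff assms(11) by (simp add: \<Omega>_def)
qed

end
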